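(* Let $M$ be a microlinear space, $G$ a groupoid over $M$, $L$ a group bundle over $M$, and $\rho$ a representation of the Nishimura algebroid $\mathcal{A}G$ of $G$ in the vector bundle $\mathcal{A}^{1}L$. Given $\omega\in\mathbf{C}^{1}(G,\mathcal{A}^{1}L)$ and $\gamma\in\mathcal{A}^{2}G$, we have $$\mathbf{d}_{\circlearrowleft}\omega(\gamma)=\mathbf{d}_{\times}\omega(\gamma)+[\omega(\gamma_{0}^{2}),\omega(\gamma_{0}^{1})],$$ where $\mathbf{d}_{\times}$ is the multiplicative coboundary operator and $\mathbf{d}_{\circlearrowleft}$ the contour derivative, both with respect to $\rho$.
   Context: Setting: synthetic differential geometry (internal, intuitionistic reasoning). $\mathbb{R}$ is the line object satisfying the general Kock–Lawvere axiom, $D=\{d\in\mathbb{R}: d^2=0\}$, $D(2)=\{(d_1,d_2)\in D^2: d_1d_2=0\}$; all spaces are assumed microlinear. A vector bundle over $M$ is a map $E\to M$ whose fibers $E_x$ are Euclidean $\mathbb{R}$-modules (for each $F:D\to E_x$ there is a unique $b\in E_x$ with $F(d)=F(0)+db$ for all $d\in D$). Groupoids: a groupoid $G$ over $M$ has source and target $\alpha,\beta:G\to M$ and identities $\mathrm{id}_x$; $gh$ is defined when $\alpha(g)=\beta(h)$. $\mathcal{A}^n_xG$ is the set of maps $\gamma:D^n\to G$ with $\gamma(0,\dots,0)=\mathrm{id}_x$ and $\alpha\circ\gamma$ constantly $x$; $\mathcal{A}^nG=\bigcup_{x\in M}\mathcal{A}^n_xG$, and $\pi_n:\mathcal{A}^nG\to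 M$ sends $\mathcal{A}^n_xG$ to $x$ (the base point). Write $\gamma_{d_1,\dots,d_n}=\gamma(d_1,\dots,d_n)$. $\mathcal{A}^1G$ is a vector bundle over $M$: $(at)_d=t_{ad}$, and $(t+t')_d=l(d,d)$ where $l:D(2)\to G$ is the unique map into $\alpha^{-1}(x)$ with $l(d,0)=t_d$, $l(0,d)=t'_d$. The anchor $\mathbf{a}_n:\mathcal{A}^nG\to M^{D^n}$ is $\gamma\mapsto\beta\circ\gamma$. For $i=1,2$: $\mathbf{s}_i:\mathcal{A}^1G\to\mathcal{A}^2G$, $\mathbf{s}_1(t)_{d_1,d_2}=t_{d_2}$, $\mathbf{s}_2(t)_{d_1,d_2}=t_{d_1}$; $\mathbf{d}_i:\mathcal{A}^2G\to\mathcal{A}^1G$, $\mathbf{d}_1(\gamma)_d=\gamma_{0,d}$, $\mathbf{d}_2(\gamma)_d=\gamma_{d,0}$. $\mathcal{A}^2G$ is a double vector bundle: its fibers over $\mathcal{A}^1G$ along $\mathbf{d}_1$ (resp. $\mathbf{d}_2$) are $\mathbb{R}$-modules, with addition and scalar multiplication performed as for $\mathcal{A}^1$ in the first (resp. second) variable, the other variable being a parameter. For $\zeta\in(\mathcal{A}^1G)^D$, $t\in\mathcal{A}^1G$ with $\pi_1(\zeta(d))=\beta(t_d)$ for all $d$, $\zeta\ast t\in\mathcal{A}^2G$ is $(\zeta\ast t)_{d_1,d_2}=\zeta(d_1)_{d_2}\,t_{d_1}$. The Nishimura algebroid $\mathcal{A}G$ is $(\mathcal{A}^1G,\mathcal{A}^2G)$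 with these structures. A homomorphism $\mathcal{A}G\to\mathcal{A}G'$ ($G,G'$ over the same $M$) is a pair $(\varphi_1,\varphi_2)$, $\varphi_k:\mathcal{A}^kG\to\mathcal{A}^kG'$, compatible with $\pi_k,\mathbf{a}_k,\mathbf{s}_i,\mathbf{d}_i$, with $\varphi_1$ fiberwise linear, $\varphi_2$ a morphism of double vector bundles, and $\varphi_2(\zeta\ast t)=(\varphi_1\circ\zeta)\ast\varphi_1(t)$. A representation $\rho$ of $\mathcal{A}G$ in a vector bundle $E$ is a homomorphism $\mathcal{A}G\to\mathcal{A}(\Phi_{\mathrm{Lin}}(E))$, where $\Phi_{\mathrm{Lin}}(E)$ is the groupoid over $M$ whose arrows $x\to y$ are the linear isomorphisms $E_x\to E_y$. For $t\in\mathcal{A}^1_xG$ write $\rho(t)=\rho_1(t)$; so $\rho(t)_d:E_x\to E_{\beta(t_d)}$ is a linear isomorphism. Forms: $\mathbf{C}^n(G,E)$ is the set of maps $\omega:\mathcal{A}^nG\to E$ with $\omega(\mathcal{A}^n_xG)\subseteq E_x$ such that (1) $\omega(a\cdot_i\gamma)=a\,\omega(\gamma)$ for $a\in\mathbb{R}$, $1\le i\le n$, where $(a\cdot_i\gamma)_{d_1,\dots,d_n}=\gamma_{d_1,\dots,ad_i,\dots,d_n}$; (2) $\omega(\gamma\circ D^\sigma)=\mathrm{sign}(\sigma)\omega(\gamma)$ for each permutation $\sigma$ of $\{1,\dots,n\}$, where $D^\sigma:D^n\to D^n$ permutes coordinates by $\sigma$. For $\gamma\in\mathcal{A}^{2}G$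 and $e\in D$: $\gamma^1_e,\gamma^2_e\in\mathcal{A}^1G$ are $\gamma^1_e(d)=\gamma(e,d)\gamma(e,0)^{-1}$, $\gamma^2_e(d)=\gamma(d,e)\gamma(0,e)^{-1}$; and $\gamma_1,\gamma_2\in\mathcal{A}^1G$ are $\gamma_1(d)=\gamma(d,0)$, $\gamma_2(d)=\gamma(0,d)$. Group bundle: $L$ is a groupoid over $M$ with $\alpha=\beta$, i.e. a family of groups $L_x$, $x\in M$. $\mathcal{A}^1_xL$ is the set of maps $t:D\to L_x$ with $t_0=\mathrm{id}_x$, and $\mathcal{A}^1L=\bigcup_{x\in M}\mathcal{A}^1_xL$ is a vector bundle over $M$ with fibers $\mathcal{A}^1_xL$, where $(at)_d=t_{ad}$ for $a\in\mathbb{R}$, and $(t+t')_d=l(d,d)$ with $l:D(2)\to L_x$ the unique map such that $l(d,0)=t_d$, $l(0,d)=t'_d$ for all $d\in D$. For $t_1,t_2\in\mathcal{A}^1_xL$, $[t_1,t_2]\in\mathcal{A}^1_xL$ is the unique (known to exist) element with $[t_1,t_2]_{d_1d_2}=(t_2)_{-d_2}(t_1)_{-d_1}(t_2)_{d_2}(t_1)_{d_1}$ for all $d_1,d_2\in D$; this makes $\mathcal{A}^1_xL$ a Lie algebra. Multiplicative coboundary operator in degree 1: for $\omega\in\mathbf{C}^1(G,\mathcal{A}^1L)$, $\mathbf{d}_\times\omega\in\mathbf{C}^{2}(G,\mathcal{A}^1L)$ is the unique (known to exist) form such that for all $\gamma\in\mathcal{A}^2G$, $d_1,d_2\in D$,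 $$(\mathbf{d}_{\times}\omega(\gamma))_{d_{1}d_{2}}=\Big\{\omega(\gamma_{0}^{1})_{d_2}\big((\rho(\gamma_{1})_{d_{1}})^{-1}(\omega(\gamma_{d_{1}}^{1}))\big)_{-d_2}\Big\}^{-1}\Big\{\omega(\gamma_{0}^{2})_{d_1}\big((\rho(\gamma_{2})_{d_{2}})^{-1}(\omega(\gamma_{d_{2}}^{2}))\big)_{-d_1}\Big\}.$$ Contour derivative: $\mathbf{d}_{\circlearrowleft}\omega(\gamma)\in\mathcal{A}^1L$ is the unique (known to exist) element such that for all $d_1,d_2\in D$, $$(\mathbf{d}_{\circlearrowleft}\omega(\gamma))_{d_1d_2}=\omega(\gamma^1_0)_{-d_2}\{(\rho(\gamma_2)_{d_2})^{-1}(\omega(\gamma^2_{d_2}))\}_{-d_1}\{(\rho(\gamma_1)_{d_1})^{-1}(\omega(\gamma^1_{d_1}))\}_{d_2}\,\omega(\gamma^2_0)_{d_1}.$$ *)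

theory Defs
  imports "HOL-Algebra.Ring" "HOL-Combinatorics.Permutations"
begin

text \<open>
  Over HOL's own function space the Kock--Lawvere axiom is inconsistent with a nonzero ring, so
  the internal language is interpreted by Kripke--Joyal semantics in presheaves over an arbitrary
  small category. A space is a presheaf; an internal element is an element at a stage \<open>c\<close>; an
  internal universal quantifier ranges over all arrows \<open>f\<close> into \<open>c\<close> and all elements at the
  domain of \<open>f\<close>, parameters being restricted along \<open>f\<close>. Unique existence is unique existence at
  every stage.
\<close>

record ('o, 'a) cat =
  Ob :: "'o set"
  Ar :: "'a set"
  dm :: "'a \<Rightarrow> 'o"
  cd :: "'a \<Rightarrow> 'o"
  idt :: "'o \<Rightarrow> 'a"
  cmp :: "'a \<Rightarrow> 'a \<Rightarrow> 'a"

definition into :: "('o, 'a, 'z) cat_scheme \<Rightarrow> 'o \<Rightarrow> 'a set" where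
  "into S c = {f \<in> Ar S. cd S f = c}"

definition category :: "('o, 'a, 'z) cat_scheme \<Rightarrow> bool" where
  "category S \<longleftrightarrow>
     (\<forall>f\<in>Ar S. dm S f \<in> Ob S \<and> cd S f \<in> Ob S) \<and>
     (\<forall>c\<in>Ob S. idt S c \<in> Ar S \<and> dm S (idt S c) = c \<and> cd S (idt S c) = c) \<and>
     (\<forall>f\<in>Ar S. cmp S f (idt S (dm S f)) = f \<and> cmp S (idt S (cd S f)) f = f) \<and>
     (\<forall>f\<in>Ar S. \<forall>g\<in>into S (dm S f).
        cmp S f g \<in> Ar S \<and> dm S (cmp S f g) = dm S g \<and> cd S (cmp S f g) = cd S f \<and>
        (\<forall>h\<in>into S (dm S g). cmp S (cmp S f g) h = cmp S f (cmp S g h)))"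

record ('o, 'a, 'x) psh =
  el :: "'o \<Rightarrow> 'x set"
  rs :: "'a \<Rightarrow> 'x \<Rightarrow> 'x"

definition presheaf :: "('o, 'a, 'z) cat_scheme \<Rightarrow> ('o, 'a, 'x, 'w) psh_scheme \<Rightarrow> bool" where
  "presheaf S X \<longleftrightarrow>
     (\<forall>f\<in>Ar S. \<forall>x\<in>el X (cd S f). rs X f x \<in> el X (dm S f)) \<and>
     (\<forall>c\<in>Ob S. \<forall>x\<in>el X c. rs X (idt S c) x = x) \<and>
     (\<forall>f\<in>Ar S. \<forall>g\<in>into S (dm S f). \<forall>x\<in>el X (cd S f).
        rs X (cmp S f g) x = rs X g (rs X f x))"

text \<open>
  Internal maps at stage \<open>c\<close> into \<open>X\<close>, out of a family of sets \<open>A f\<close> indexed by the arrows into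
  \<open>c\<close> (a presheaf on the slice over \<open>c\<close>, with restriction \<open>r\<close>). Values outside the domain are
  \<open>undefined\<close>, so that equality of internal maps is equality in HOL. The value of an
  internal map \<open>\<phi>\<close> at an element \<open>x\<close> of the same stage is \<open>\<phi> (idt S c) x\<close>.
\<close>

definition dlam :: "('o, 'a, 'z) cat_scheme \<Rightarrow> ('a \<Rightarrow> 'x set) \<Rightarrow> 'o
    \<Rightarrow> ('a \<Rightarrow> 'x \<Rightarrow> 'y) \<Rightarrow> 'a \<Rightarrow> 'x \<Rightarrow> 'y" where
  "dlam S A c F = (\<lambda>f x. if f \<in> into S c \<and> x \<in> A f then F f x else undefined)"

definition dmaps :: "('o, 'a, 'z) cat_scheme \<Rightarrow> ('a \<Rightarrow> 'x set) \<Rightarrow> ('a \<Rightarrow> 'x \<Rightarrow> 'x)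
    \<Rightarrow> ('o, 'a, 'y, 'w) psh_scheme \<Rightarrow> 'o \<Rightarrow> ('a \<Rightarrow> 'x \<Rightarrow> 'y) set" where
  "dmaps S A r X c = {\<phi>. dlam S A c \<phi> = \<phi> \<and>
     (\<forall>f\<in>into S c. \<forall>x\<in>A f. \<phi> f x \<in> el X (dm S f) \<and>
        (\<forall>g\<in>into S (dm S f). \<phi> (cmp S f g) (r g x) = rs X g (\<phi> f x)))}"

definition ilam :: "('o, 'a, 'z) cat_scheme \<Rightarrow> ('o, 'a, 'x, 'w) psh_scheme \<Rightarrow> 'o
    \<Rightarrow> ('a \<Rightarrow> 'x \<Rightarrow> 'y) \<Rightarrow> 'a \<Rightarrow> 'x \<Rightarrow> 'y" where
  "ilam S X c = dlam S (\<lambda>f. el X (dm S f)) c"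

text \<open>The exponential \<open>Y\<^sup>X\<close>, and restriction of its elements.\<close>

definition rsf :: "('o, 'a, 'z) cat_scheme \<Rightarrow> ('o, 'a, 'x, 'w) psh_scheme \<Rightarrow> 'a
    \<Rightarrow> ('a \<Rightarrow> 'x \<Rightarrow> 'y) \<Rightarrow> 'a \<Rightarrow> 'x \<Rightarrow> 'y" where
  "rsf S X f \<phi> = ilam S X (dm S f) (\<lambda>g. \<phi> (cmp S f g))"

definition expo :: "('o, 'a, 'z) cat_scheme \<Rightarrow> ('o, 'a, 'x, 'w) psh_scheme
    \<Rightarrow> ('o, 'a, 'y, 'v) psh_scheme \<Rightarrow> ('o, 'a, 'a \<Rightarrow> 'x \<Rightarrow> 'y) psh" where
  "expo S X Y = \<lparr>el = dmaps S (\<lambda>f. el X (dm S f)) (rs X) Y, rs = rsf S X\<rparr>"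

record ('o, 'a, 'r) line = "('o, 'a) cat" +
  rg :: "'o \<Rightarrow> 'r ring"
  rr :: "'a \<Rightarrow> 'r \<Rightarrow> 'r"

definition line_psh :: "('o, 'a, 'r) line \<Rightarrow> ('o, 'a, 'r) psh" where
  "line_psh S = \<lparr>el = (\<lambda>c. carrier (rg S c)), rs = rr S\<rparr>"

definition ring_object :: "('o, 'a, 'r) line \<Rightarrow> bool" where
  "ring_object S \<longleftrightarrow> category S \<and> presheaf S (line_psh S) \<and>
     (\<forall>c\<in>Ob S. cring (rg S c)) \<and>
     (\<forall>f\<in>Ar S. rr S f \<in> ring_hom (rg S (cd S f)) (rg S (dm S f)))"

text \<open>
  A Weil algebra at a stage is the free module with basis \<open>e\<^sub>0, \<dots>, e\<^sub>n\<^sub>-\<^sub>1\<close> together with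
  structure constants, \<open>e\<^sub>i e\<^sub>j = (\<Sum>k. \<mu> i j k e\<^sub>k)\<close>, such that \<open>e\<^sub>0\<close> is the unit and
  \<open>e\<^sub>1, \<dots>, e\<^sub>n\<^sub>-\<^sub>1\<close> span a nilpotent ideal.
\<close>

type_synonym 'r weil = "nat \<times> (nat \<Rightarrow> nat \<Rightarrow> nat \<Rightarrow> 'r)"

definition wvec :: "'r ring \<Rightarrow> nat \<Rightarrow> (nat \<Rightarrow> 'r) set" where
  "wvec R n = {..<n} \<rightarrow>\<^sub>E carrier R"

definition wone :: "'r ring \<Rightarrow> nat \<Rightarrow> nat \<Rightarrow> 'r" where
  "wone R n = (\<lambda>k\<in>{..<n}. if k = 0 then \<one>\<^bsub>R\<^esub> else \<zero>\<^bsub>R\<^esub>)"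

definition wmul :: "'r ring \<Rightarrow> 'r weil \<Rightarrow> (nat \<Rightarrow> 'r) \<Rightarrow> (nat \<Rightarrow> 'r) \<Rightarrow> nat \<Rightarrow> 'r" where
  "wmul R W v w = (\<lambda>k\<in>{..<fst W}. finsum R (\<lambda>i. finsum R (\<lambda>j.
      v i \<otimes>\<^bsub>R\<^esub> w j \<otimes>\<^bsub>R\<^esub> snd W i j k) {..<fst W}) {..<fst W})"

definition weil_algebra :: "'r ring \<Rightarrow> 'r weil \<Rightarrow> bool" where
  "weil_algebra R W \<longleftrightarrow> 0 < fst W \<and>
     (\<forall>i<fst W. \<forall>j<fst W. \<forall>k<fst W. snd W i j k \<in> carrier R) \<and>
     (\<forall>v\<in>wvec R (fst W). wmul R W (wone R (fst W)) v = v) \<and>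
     (\<forall>v\<in>wvec R (fst W). \<forall>w\<in>wvec R (fst W). wmul R W v w = wmul R W w v \<and>
        (\<forall>u\<in>wvec R (fst W). wmul R W (wmul R W v w) u = wmul R W v (wmul R W w u))) \<and>
     (\<forall>v\<in>wvec R (fst W). \<forall>w\<in>wvec R (fst W). v 0 = \<zero>\<^bsub>R\<^esub> \<longrightarrow> wmul R W v w 0 = \<zero>\<^bsub>R\<^esub>) \<and>
     (\<exists>N. \<forall>vs. length vs = N \<and> set vs \<subseteq> {v \<in> wvec R (fst W). v 0 = \<zero>\<^bsub>R\<^esub>} \<longrightarrow>
        foldr (wmul R W) vs (wone R (fst W)) = (\<lambda>k\<in>{..<fst W}. \<zero>\<^bsub>R\<^esub>))"

text \<open>Homomorphisms are given by matrices, \<open>e\<^sub>i \<mapsto> (\<Sum>j. h i j e\<^sub>j)\<close>, and preserve the augmentation.\<close>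

definition wapp :: "'r ring \<Rightarrow> nat \<Rightarrow> nat \<Rightarrow> (nat \<Rightarrow> nat \<Rightarrow> 'r) \<Rightarrow> (nat \<Rightarrow> 'r) \<Rightarrow> nat \<Rightarrow> 'r" where
  "wapp R n m h v = (\<lambda>j\<in>{..<m}. finsum R (\<lambda>i. v i \<otimes>\<^bsub>R\<^esub> h i j) {..<n})"

definition weil_hom :: "'r ring \<Rightarrow> 'r weil \<Rightarrow> 'r weil \<Rightarrow> (nat \<Rightarrow> nat \<Rightarrow> 'r) \<Rightarrow> bool" where
  "weil_hom R W W' h \<longleftrightarrow> (let n = fst W; m = fst W' in
     (\<forall>i<n. \<forall>j<m. h i j \<in> carrier R) \<and>
     wapp R n m h (wone R n) = wone R m \<and>
     (\<forall>v\<in>wvec R n. wapp R n m h v 0 = v 0 \<and>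
        (\<forall>w\<in>wvec R n. wapp R n m h (wmul R W v w) = wmul R W' (wapp R n m h v) (wapp R n m h w))))"

definition mrs :: "('o, 'a, 'r) line \<Rightarrow> 'a \<Rightarrow> (nat \<Rightarrow> nat \<Rightarrow> 'r) \<Rightarrow> nat \<Rightarrow> nat \<Rightarrow> 'r" where
  "mrs S f h = (\<lambda>i j. rr S f (h i j))"

text \<open>
  \<open>weil_spec S W f\<close> is the spectrum of \<open>W\<close> at the stage \<open>dm S f\<close>: a homomorphism from \<open>W\<close> to the
  line is given by its values \<open>p 0, \<dots>, p (n - 1)\<close> on the basis.
\<close>

definition weil_spec :: "('o, 'a, 'r) line \<Rightarrow> 'r weil \<Rightarrow> 'a \<Rightarrow> (nat \<Rightarrow> 'r) set" where
  "weil_spec S W f = (let R = rg S (dm S f); n = fst W in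
     {p \<in> wvec R n. p 0 = \<one>\<^bsub>R\<^esub> \<and> (\<forall>i<n. \<forall>j<n.
        p i \<otimes>\<^bsub>R\<^esub> p j = finsum R (\<lambda>k. rr S f (snd W i j k) \<otimes>\<^bsub>R\<^esub> p k) {..<n})})"

definition vrs :: "('o, 'a, 'r) line \<Rightarrow> nat \<Rightarrow> 'a \<Rightarrow> (nat \<Rightarrow> 'r) \<Rightarrow> nat \<Rightarrow> 'r" where
  "vrs S n f p = (\<lambda>i\<in>{..<n}. rr S f (p i))"

definition spec_maps :: "('o, 'a, 'r) line \<Rightarrow> 'r weil \<Rightarrow> ('o, 'a, 'x, 'w) psh_scheme \<Rightarrow> 'o
    \<Rightarrow> ('a \<Rightarrow> (nat \<Rightarrow> 'r) \<Rightarrow> 'x) set" where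
  "spec_maps S W X c = dmaps S (weil_spec S W) (vrs S (fst W)) X c"

text \<open>The map of spectra induced by a homomorphism of Weil algebras of ranks \<open>n\<close> and \<open>m\<close>.\<close>

definition spec_pull :: "('o, 'a, 'r) line \<Rightarrow> nat \<Rightarrow> nat \<Rightarrow> (nat \<Rightarrow> nat \<Rightarrow> 'r) \<Rightarrow> 'a
    \<Rightarrow> (nat \<Rightarrow> 'r) \<Rightarrow> nat \<Rightarrow> 'r" where
  "spec_pull S n m h f p = (\<lambda>i\<in>{..<n}.
     finsum (rg S (dm S f)) (\<lambda>j. rr S f (h i j) \<otimes>\<^bsub>rg S (dm S f)\<^esub> p j) {..<m})"

text \<open>For every Weil algebra \<open>W\<close>, evaluation from \<open>W\<close> to the functions on its spectrum is bijective.\<close>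

definition kock_lawvere :: "('o, 'a, 'r) line \<Rightarrow> bool" where
  "kock_lawvere S \<longleftrightarrow>
     (\<forall>c\<in>Ob S. \<forall>W. weil_algebra (rg S c) W \<longrightarrow>
        (\<forall>\<phi>\<in>spec_maps S W (line_psh S) c. \<exists>!a. a \<in> wvec (rg S c) (fst W) \<and>
           (\<forall>f\<in>into S c. \<forall>p\<in>weil_spec S W f. \<phi> f p =
              finsum (rg S (dm S f)) (\<lambda>k. rr S f (a k) \<otimes>\<^bsub>rg S (dm S f)\<^esub> p k) {..<fst W})))"

definition line_object :: "('o, 'a, 'r) line \<Rightarrow> bool" where
  "line_object S \<longleftrightarrow> ring_object S \<and> kock_lawvere S"

text \<open>
  A finite diagram at stage \<open>c\<close> is a list \<open>Ws\<close> of Weil algebras with a list \<open>es\<close> of edges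
  \<open>(i, j, h)\<close>, where \<open>h\<close> is a homomorphism from \<open>Ws ! i\<close> to \<open>Ws ! j\<close>; \<open>ps\<close> are the projections
  of a cone with apex \<open>W\<close>.
\<close>

definition weil_limit :: "('o, 'a, 'r) line \<Rightarrow> 'o \<Rightarrow> 'r weil list
    \<Rightarrow> (nat \<times> nat \<times> (nat \<Rightarrow> nat \<Rightarrow> 'r)) list \<Rightarrow> 'r weil \<Rightarrow> (nat \<Rightarrow> nat \<Rightarrow> 'r) list \<Rightarrow> bool" where
  "weil_limit S c Ws es W ps \<longleftrightarrow>
     (\<forall>V\<in>set Ws. weil_algebra (rg S c) V) \<and>
     (\<forall>(i, j, h)\<in>set es. i < length Ws \<and> j < length Ws \<and> weil_hom (rg S c) (Ws ! i) (Ws ! j) h) \<and>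
     weil_algebra (rg S c) W \<and> length ps = length Ws \<and>
     (\<forall>i<length Ws. weil_hom (rg S c) W (Ws ! i) (ps ! i)) \<and>
     (\<forall>(i, j, h)\<in>set es. \<forall>w\<in>wvec (rg S c) (fst W).
        wapp (rg S c) (fst (Ws ! i)) (fst (Ws ! j)) h (wapp (rg S c) (fst W) (fst (Ws ! i)) (ps ! i) w)
          = wapp (rg S c) (fst W) (fst (Ws ! j)) (ps ! j) w) \<and>
     (\<forall>f\<in>into S c. let R = rg S (dm S f) in
        \<forall>vs. length vs = length Ws \<and>
          (\<forall>i<length Ws. vs ! i \<in> wvec R (fst (Ws ! i))) \<and>
          (\<forall>(i, j, h)\<in>set es.
             wapp R (fst (Ws ! i)) (fst (Ws ! j)) (mrs S f h) (vs ! i) = vs ! j) \<longrightarrow>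
          (\<exists>!w. w \<in> wvec R (fst W) \<and>
             (\<forall>i<length Ws. wapp R (fst W) (fst (Ws ! i)) (mrs S f (ps ! i)) w = vs ! i)))"

definition microlinear :: "('o, 'a, 'r) line \<Rightarrow> ('o, 'a, 'x, 'w) psh_scheme \<Rightarrow> bool" where
  "microlinear S X \<longleftrightarrow>
     (\<forall>c\<in>Ob S. \<forall>Ws es W ps. weil_limit S c Ws es W ps \<longrightarrow>
        (\<forall>\<phi>s. length \<phi>s = length Ws \<and>
           (\<forall>i<length Ws. \<phi>s ! i \<in> spec_maps S (Ws ! i) X c) \<and>
           (\<forall>(i, j, h)\<in>set es. \<forall>f\<in>into S c. \<forall>p\<in>weil_spec S (Ws ! j) f.
              (\<phi>s ! i) f (spec_pull S (fst (Ws ! i)) (fst (Ws ! j)) h f p) = (\<phi>s ! j) f p) \<longrightarrow>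
           (\<exists>!\<phi>. \<phi> \<in> spec_maps S W X c \<and>
              (\<forall>i<length Ws. \<forall>f\<in>into S c. \<forall>p\<in>weil_spec S (Ws ! i) f.
                 \<phi> f (spec_pull S (fst W) (fst (Ws ! i)) (ps ! i) f p) = (\<phi>s ! i) f p))))"

record ('o, 'a, 'p, 'g) grpd = "('o, 'a, 'g) psh" +
  src :: "'o \<Rightarrow> 'g \<Rightarrow> 'p"
  tgt :: "'o \<Rightarrow> 'g \<Rightarrow> 'p"
  unt :: "'o \<Rightarrow> 'p \<Rightarrow> 'g"
  mul :: "'o \<Rightarrow> 'g \<Rightarrow> 'g \<Rightarrow> 'g"

definition groupoid :: "('o, 'a, 'r) line \<Rightarrow> ('o, 'a, 'p) psh \<Rightarrow> ('o, 'a, 'p, 'g) grpd \<Rightarrow> bool" where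
  "groupoid S M G \<longleftrightarrow> presheaf S M \<and> presheaf S G \<and>
     (\<forall>c\<in>Ob S.
        (\<forall>g\<in>el G c. src G c g \<in> el M c \<and> tgt G c g \<in> el M c \<and>
           mul G c g (unt G c (src G c g)) = g \<and> mul G c (unt G c (tgt G c g)) g = g \<and>
           (\<exists>h\<in>el G c. src G c h = tgt G c g \<and> tgt G c h = src G c g \<and>
              mul G c g h = unt G c (tgt G c g) \<and> mul G c h g = unt G c (src G c g))) \<and>
        (\<forall>x\<in>el M c. unt G c x \<in> el G c \<and> src G c (unt G c x) = x \<and> tgt G c (unt G c x) = x) \<and>
        (\<forall>g\<in>el G c. \<forall>h\<in>el G c. src G c g = tgt G c h \<longrightarrow>
           mul G c g h \<in> el G c \<and> src G c (mul G c g h) = src G c h \<and>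
           tgt G c (mul G c g h) = tgt G c g \<and>
           (\<forall>k\<in>el G c. src G c h = tgt G c k \<longrightarrow>
              mul G c (mul G c g h) k = mul G c g (mul G c h k)))) \<and>
     (\<forall>f\<in>Ar S.
        (\<forall>g\<in>el G (cd S f). src G (dm S f) (rs G f g) = rs M f (src G (cd S f) g) \<and>
           tgt G (dm S f) (rs G f g) = rs M f (tgt G (cd S f) g) \<and>
           (\<forall>h\<in>el G (cd S f). src G (cd S f) g = tgt G (cd S f) h \<longrightarrow>
              rs G f (mul G (cd S f) g h) = mul G (dm S f) (rs G f g) (rs G f h))) \<and>
        (\<forall>x\<in>el M (cd S f). rs G f (unt G (cd S f) x) = unt G (dm S f) (rs M f x)))"

definition group_bundle :: "('o, 'a, 'r) line \<Rightarrow> ('o, 'a, 'p) psh \<Rightarrow> ('o, 'a, 'p, 'g) grpd \<Rightarrow> bool" where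
  "group_bundle S M L \<longleftrightarrow> groupoid S M L \<and> (\<forall>c\<in>Ob S. \<forall>g\<in>el L c. src L c g = tgt L c g)"

definition ginv :: "('o, 'a, 'p, 'g) grpd \<Rightarrow> 'o \<Rightarrow> 'g \<Rightarrow> 'g" where
  "ginv G c g = (THE h. h \<in> el G c \<and> src G c h = tgt G c g \<and> tgt G c h = src G c g \<and>
     mul G c g h = unt G c (tgt G c g) \<and> mul G c h g = unt G c (src G c g))"

definition Dset :: "('o, 'a, 'r) line \<Rightarrow> 'o \<Rightarrow> 'r set" where
  "Dset S c = {d \<in> carrier (rg S c). d \<otimes>\<^bsub>rg S c\<^esub> d = \<zero>\<^bsub>rg S c\<^esub>}"

text \<open>\<open>D\<^sup>n\<close>, as lists; the coordinates are numbered from \<open>0\<close>.\<close>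

definition Dn :: "('o, 'a, 'r) line \<Rightarrow> nat \<Rightarrow> ('o, 'a, 'r list) psh" where
  "Dn S n = \<lparr>el = (\<lambda>c. {ds. length ds = n \<and> set ds \<subseteq> Dset S c}), rs = (\<lambda>f. map (rr S f))\<rparr>"

definition bpt :: "('o, 'a, 'r) line \<Rightarrow> ('o, 'a, 'p, 'g) grpd \<Rightarrow> nat \<Rightarrow> 'o
    \<Rightarrow> ('a \<Rightarrow> 'r list \<Rightarrow> 'g) \<Rightarrow> 'p" where
  "bpt S G n c \<gamma> = src G c (\<gamma> (idt S c) (replicate n \<zero>\<^bsub>rg S c\<^esub>))"

definition An :: "('o, 'a, 'r) line \<Rightarrow> ('o, 'a, 'p) psh \<Rightarrow> ('o, 'a, 'p, 'g) grpd \<Rightarrow> nat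
    \<Rightarrow> ('o, 'a, 'a \<Rightarrow> 'r list \<Rightarrow> 'g) psh" where
  "An S M G n = \<lparr>el = (\<lambda>c. {\<gamma> \<in> el (expo S (Dn S n) G) c.
       \<gamma> (idt S c) (replicate n \<zero>\<^bsub>rg S c\<^esub>) = unt G c (bpt S G n c \<gamma>) \<and>
       (\<forall>f\<in>into S c. \<forall>ds\<in>el (Dn S n) (dm S f).
          src G (dm S f) (\<gamma> f ds) = rs M f (bpt S G n c \<gamma>))}),
     rs = rsf S (Dn S n)\<rparr>"

text \<open>Scalar multiplication and addition in the \<open>i\<close>-th variable.\<close>

definition scl :: "('o, 'a, 'r) line \<Rightarrow> nat \<Rightarrow> nat \<Rightarrow> 'o \<Rightarrow> 'r
    \<Rightarrow> ('a \<Rightarrow> 'r list \<Rightarrow> 'g) \<Rightarrow> 'a \<Rightarrow> 'r list \<Rightarrow> 'g" where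
  "scl S n i c a \<gamma> = ilam S (Dn S n) c
     (\<lambda>f ds. \<gamma> f (ds[i := rr S f a \<otimes>\<^bsub>rg S (dm S f)\<^esub> ds ! i]))"

text \<open>
  \<open>D2n S n i\<close> consists of the pairs \<open>(e, ds)\<close> with \<open>(ds ! i, e) \<in> D(2)\<close>, the coordinates of \<open>ds\<close>
  other than the \<open>i\<close>-th being parameters.
\<close>

definition D2n :: "('o, 'a, 'r) line \<Rightarrow> nat \<Rightarrow> nat \<Rightarrow> ('o, 'a, 'r \<times> 'r list) psh" where
  "D2n S n i = \<lparr>el = (\<lambda>c. {(e, ds). e \<in> Dset S c \<and> ds \<in> el (Dn S n) c \<and>
       ds ! i \<otimes>\<^bsub>rg S c\<^esub> e = \<zero>\<^bsub>rg S c\<^esub>}),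
     rs = (\<lambda>f (e, ds). (rr S f e, map (rr S f) ds))\<rparr>"

definition sum_map :: "('o, 'a, 'r) line \<Rightarrow> ('o, 'a, 'p) psh \<Rightarrow> ('o, 'a, 'p, 'g) grpd \<Rightarrow> nat \<Rightarrow> nat
    \<Rightarrow> 'o \<Rightarrow> ('a \<Rightarrow> 'r list \<Rightarrow> 'g) \<Rightarrow> ('a \<Rightarrow> 'r list \<Rightarrow> 'g) \<Rightarrow> 'a \<Rightarrow> 'r \<times> 'r list \<Rightarrow> 'g" where
  "sum_map S M G n i c \<gamma> \<gamma>' = (THE l. l \<in> el (expo S (D2n S n i) G) c \<and>
     (\<forall>f\<in>into S c.
        (\<forall>q\<in>el (D2n S n i) (dm S f). src G (dm S f) (l f q) = rs M f (bpt S G n c \<gamma>)) \<and>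
        (\<forall>ds\<in>el (Dn S n) (dm S f).
           l f (\<zero>\<^bsub>rg S (dm S f)\<^esub>, ds) = \<gamma> f ds \<and>
           l f (ds ! i, ds[i := \<zero>\<^bsub>rg S (dm S f)\<^esub>]) = \<gamma>' f ds)))"

definition add_at :: "('o, 'a, 'r) line \<Rightarrow> ('o, 'a, 'p) psh \<Rightarrow> ('o, 'a, 'p, 'g) grpd \<Rightarrow> nat \<Rightarrow> nat
    \<Rightarrow> 'o \<Rightarrow> ('a \<Rightarrow> 'r list \<Rightarrow> 'g) \<Rightarrow> ('a \<Rightarrow> 'r list \<Rightarrow> 'g) \<Rightarrow> 'a \<Rightarrow> 'r list \<Rightarrow> 'g" where
  "add_at S M G n i c \<gamma> \<gamma>' = ilam S (Dn S n) c (\<lambda>f ds. sum_map S M G n i c \<gamma> \<gamma>' f (ds ! i, ds))"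

text \<open>The faces \<open>d\<^sub>1\<close>, \<open>d\<^sub>2\<close> and the degeneracies \<open>s\<^sub>1\<close>, \<open>s\<^sub>2\<close> are those for \<open>i = 0, 1\<close>.\<close>

definition face :: "('o, 'a, 'r) line \<Rightarrow> nat \<Rightarrow> 'o \<Rightarrow> ('a \<Rightarrow> 'r list \<Rightarrow> 'g) \<Rightarrow> 'a \<Rightarrow> 'r list \<Rightarrow> 'g" where
  "face S i c \<gamma> = ilam S (Dn S 1) c (\<lambda>f ds.
     \<gamma> f (if i = 0 then [\<zero>\<^bsub>rg S (dm S f)\<^esub>, ds ! 0] else [ds ! 0, \<zero>\<^bsub>rg S (dm S f)\<^esub>]))"

definition degen :: "('o, 'a, 'r) line \<Rightarrow> nat \<Rightarrow> 'o \<Rightarrow> ('a \<Rightarrow> 'r list \<Rightarrow> 'g) \<Rightarrow> 'a \<Rightarrow> 'r list \<Rightarrow> 'g" where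
  "degen S i c t = ilam S (Dn S 2) c (\<lambda>f ds. t f [if i = 0 then ds ! 1 else ds ! 0])"

definition star :: "('o, 'a, 'r) line \<Rightarrow> ('o, 'a, 'p, 'g) grpd \<Rightarrow> 'o
    \<Rightarrow> ('a \<Rightarrow> 'r list \<Rightarrow> 'a \<Rightarrow> 'r list \<Rightarrow> 'g) \<Rightarrow> ('a \<Rightarrow> 'r list \<Rightarrow> 'g) \<Rightarrow> 'a \<Rightarrow> 'r list \<Rightarrow> 'g" where
  "star S G c \<zeta> t = ilam S (Dn S 2) c (\<lambda>f ds.
     mul G (dm S f) (\<zeta> f [ds ! 0] (idt S (dm S f)) [ds ! 1]) (t f [ds ! 0]))"

text \<open>Homomorphisms \<open>(\<phi>1, \<phi>2)\<close> of Nishimura algebroids, as internal elements at stage \<open>c\<close>.\<close>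

definition anchored_hom :: "('o, 'a, 'r) line \<Rightarrow> ('o, 'a, 'p) psh \<Rightarrow> ('o, 'a, 'p, 'g) grpd
    \<Rightarrow> ('o, 'a, 'p, 'k) grpd \<Rightarrow> nat \<Rightarrow> 'o
    \<Rightarrow> ('a \<Rightarrow> ('a \<Rightarrow> 'r list \<Rightarrow> 'g) \<Rightarrow> 'a \<Rightarrow> 'r list \<Rightarrow> 'k) \<Rightarrow> bool" where
  "anchored_hom S M G G' n c \<phi> \<longleftrightarrow> \<phi> \<in> el (expo S (An S M G n) (An S M G' n)) c \<and>
     (\<forall>f\<in>into S c. \<forall>\<gamma>\<in>el (An S M G n) (dm S f).
        bpt S G' n (dm S f) (\<phi> f \<gamma>) = bpt S G n (dm S f) \<gamma> \<and>
        (\<forall>g\<in>into S (dm S f). \<forall>ds\<in>el (Dn S n) (dm S g).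
           tgt G' (dm S g) (\<phi> f \<gamma> g ds) = tgt G (dm S g) (\<gamma> g ds)))"

definition nishimura_hom :: "('o, 'a, 'r) line \<Rightarrow> ('o, 'a, 'p) psh \<Rightarrow> ('o, 'a, 'p, 'g) grpd
    \<Rightarrow> ('o, 'a, 'p, 'k) grpd \<Rightarrow> 'o
    \<Rightarrow> ('a \<Rightarrow> ('a \<Rightarrow> 'r list \<Rightarrow> 'g) \<Rightarrow> 'a \<Rightarrow> 'r list \<Rightarrow> 'k)
    \<Rightarrow> ('a \<Rightarrow> ('a \<Rightarrow> 'r list \<Rightarrow> 'g) \<Rightarrow> 'a \<Rightarrow> 'r list \<Rightarrow> 'k) \<Rightarrow> bool" where
  "nishimura_hom S M G G' c \<phi>1 \<phi>2 \<longleftrightarrow>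
     anchored_hom S M G G' 1 c \<phi>1 \<and> anchored_hom S M G G' 2 c \<phi>2 \<and>
     (\<forall>f\<in>into S c. let b = dm S f in
        (\<forall>t\<in>el (An S M G 1) b.
           (\<forall>i<2. \<phi>2 f (degen S i b t) = degen S i b (\<phi>1 f t)) \<and>
           (\<forall>a\<in>carrier (rg S b). \<phi>1 f (scl S 1 0 b a t) = scl S 1 0 b a (\<phi>1 f t)) \<and>
           (\<forall>t'\<in>el (An S M G 1) b. bpt S G 1 b t = bpt S G 1 b t' \<longrightarrow>
              \<phi>1 f (add_at S M G 1 0 b t t') = add_at S M G' 1 0 b (\<phi>1 f t) (\<phi>1 f t'))) \<and>
        (\<forall>\<gamma>\<in>el (An S M G 2) b. \<forall>i<2.
           \<phi>1 f (face S i b \<gamma>) = face S i b (\<phi>2 f \<gamma>) \<and>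
           (\<forall>a\<in>carrier (rg S b). \<phi>2 f (scl S 2 i b a \<gamma>) = scl S 2 i b a (\<phi>2 f \<gamma>)) \<and>
           (\<forall>\<gamma>'\<in>el (An S M G 2) b. face S i b \<gamma> = face S i b \<gamma>' \<longrightarrow>
              \<phi>2 f (add_at S M G 2 i b \<gamma> \<gamma>') = add_at S M G' 2 i b (\<phi>2 f \<gamma>) (\<phi>2 f \<gamma>'))) \<and>
        (\<forall>t\<in>el (An S M G 1) b. \<forall>\<zeta>\<in>el (expo S (Dn S 1) (An S M G 1)) b.
           (\<forall>g\<in>into S b. \<forall>ds\<in>el (Dn S 1) (dm S g).
              bpt S G 1 (dm S g) (\<zeta> g ds) = tgt G (dm S g) (t g ds)) \<longrightarrow>
           \<phi>2 f (star S G b \<zeta> t) =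
             star S G' b (ilam S (Dn S 1) b (\<lambda>g ds. \<phi>1 (cmp S f g) (\<zeta> g ds))) (\<phi>1 f t)))"

text \<open>
  The structure of a vector bundle: projection and, stagewise, addition and scalar multiplication
  in the fibers. Below it is only used for \<open>A1 S M L\<close>, whose fibers are Euclidean modules
  by microlinearity of \<open>L\<close>; no axioms are imposed.
\<close>

record ('o, 'a, 'r, 'p, 'e) vbundle = "('o, 'a, 'e) psh" +
  prj :: "'o \<Rightarrow> 'e \<Rightarrow> 'p"
  vadd :: "'o \<Rightarrow> 'e \<Rightarrow> 'e \<Rightarrow> 'e"
  vsm :: "'o \<Rightarrow> 'r \<Rightarrow> 'e \<Rightarrow> 'e"

definition A1 :: "('o, 'a, 'r) line \<Rightarrow> ('o, 'a, 'p) psh \<Rightarrow> ('o, 'a, 'p, 'g) grpd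
    \<Rightarrow> ('o, 'a, 'r, 'p, 'a \<Rightarrow> 'r list \<Rightarrow> 'g) vbundle" where
  "A1 S M G = \<lparr>el = el (An S M G 1), rs = rs (An S M G 1),
     prj = bpt S G 1, vadd = add_at S M G 1 0, vsm = scl S 1 0\<rparr>"

definition fib :: "('o, 'a, 'r, 'p, 'e) vbundle \<Rightarrow> 'o \<Rightarrow> 'p \<Rightarrow> 'e set" where
  "fib E c x = {v \<in> el E c. prj E c v = x}"

definition fam :: "('o, 'a, 'r) line \<Rightarrow> ('o, 'a, 'p) psh \<Rightarrow> ('o, 'a, 'r, 'p, 'e) vbundle \<Rightarrow> 'p
    \<Rightarrow> 'a \<Rightarrow> 'e set" where
  "fam S M E x f = fib E (dm S f) (rs M f x)"

definition lin_iso :: "('o, 'a, 'r) line \<Rightarrow> ('o, 'a, 'p) psh \<Rightarrow> ('o, 'a, 'r, 'p, 'e) vbundle \<Rightarrow> 'o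
    \<Rightarrow> 'p \<Rightarrow> 'p \<Rightarrow> ('a \<Rightarrow> 'e \<Rightarrow> 'e) set" where
  "lin_iso S M E c x y = {\<phi> \<in> dmaps S (fam S M E x) (rs E) E c.
     \<forall>f\<in>into S c. bij_betw (\<phi> f) (fam S M E x f) (fam S M E y f) \<and>
       (\<forall>v\<in>fam S M E x f.
          (\<forall>w\<in>fam S M E x f. \<phi> f (vadd E (dm S f) v w) = vadd E (dm S f) (\<phi> f v) (\<phi> f w)) \<and>
          (\<forall>a\<in>carrier (rg S (dm S f)). \<phi> f (vsm E (dm S f) a v) = vsm E (dm S f) a (\<phi> f v)))}"

definition Phi_Lin :: "('o, 'a, 'r) line \<Rightarrow> ('o, 'a, 'p) psh \<Rightarrow> ('o, 'a, 'r, 'p, 'e) vbundle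
    \<Rightarrow> ('o, 'a, 'p, 'p \<times> 'p \<times> ('a \<Rightarrow> 'e \<Rightarrow> 'e)) grpd" where
  "Phi_Lin S M E =
    \<lparr>el = (\<lambda>c. {(x, y, \<phi>). x \<in> el M c \<and> y \<in> el M c \<and> \<phi> \<in> lin_iso S M E c x y}),
     rs = (\<lambda>f (x, y, \<phi>). (rs M f x, rs M f y,
             dlam S (fam S M E (rs M f x)) (dm S f) (\<lambda>g. \<phi> (cmp S f g)))),
     src = (\<lambda>c (x, y, \<phi>). x),
     tgt = (\<lambda>c (x, y, \<phi>). y),
     unt = (\<lambda>c x. (x, x, dlam S (fam S M E x) c (\<lambda>f v. v))),
     mul = (\<lambda>c (y', z, \<psi>) (x, y, \<phi>). (x, z, dlam S (fam S M E x) c (\<lambda>f v. \<psi> f (\<phi> f v))))\<rparr>"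

definition lapp :: "('o, 'a, 'r) line \<Rightarrow> 'o \<Rightarrow> 'p \<times> 'p \<times> ('a \<Rightarrow> 'e \<Rightarrow> 'e) \<Rightarrow> 'e \<Rightarrow> 'e" where
  "lapp S c = (\<lambda>(x, y, \<phi>). \<phi> (idt S c))"

definition representation :: "('o, 'a, 'r) line \<Rightarrow> ('o, 'a, 'p) psh \<Rightarrow> ('o, 'a, 'p, 'g) grpd
    \<Rightarrow> ('o, 'a, 'r, 'p, 'e) vbundle \<Rightarrow> 'o
    \<Rightarrow> ('a \<Rightarrow> ('a \<Rightarrow> 'r list \<Rightarrow> 'g) \<Rightarrow> 'a \<Rightarrow> 'r list \<Rightarrow> 'p \<times> 'p \<times> ('a \<Rightarrow> 'e \<Rightarrow> 'e))
    \<Rightarrow> ('a \<Rightarrow> ('a \<Rightarrow> 'r list \<Rightarrow> 'g) \<Rightarrow> 'a \<Rightarrow> 'r list \<Rightarrow> 'p \<times> 'p \<times> ('a \<Rightarrow> 'e \<Rightarrow> 'e)) \<Rightarrow> bool" where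
  "representation S M G E c \<rho>1 \<rho>2 \<longleftrightarrow> nishimura_hom S M G (Phi_Lin S M E) c \<rho>1 \<rho>2"

definition forms :: "('o, 'a, 'r) line \<Rightarrow> ('o, 'a, 'p) psh \<Rightarrow> ('o, 'a, 'p, 'g) grpd
    \<Rightarrow> ('o, 'a, 'r, 'p, 'e) vbundle \<Rightarrow> nat \<Rightarrow> 'o \<Rightarrow> ('a \<Rightarrow> ('a \<Rightarrow> 'r list \<Rightarrow> 'g) \<Rightarrow> 'e) set" where
  "forms S M G E n c = {\<omega> \<in> el (expo S (An S M G n) E) c.
     \<forall>f\<in>into S c. let b = dm S f in \<forall>\<gamma>\<in>el (An S M G n) b.
       prj E b (\<omega> f \<gamma>) = bpt S G n b \<gamma> \<and>
       (\<forall>i<n. \<forall>a\<in>carrier (rg S b). \<omega> f (scl S n i b a \<gamma>) = vsm E b a (\<omega> f \<gamma>)) \<and>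
       (\<forall>\<sigma>. \<sigma> permutes {..<n} \<longrightarrow>
          \<omega> f (ilam S (Dn S n) b (\<lambda>g ds. \<gamma> g (permute_list \<sigma> ds))) =
            vsm E b (if sign \<sigma> = 1 then \<one>\<^bsub>rg S b\<^esub> else \<ominus>\<^bsub>rg S b\<^esub> \<one>\<^bsub>rg S b\<^esub>) (\<omega> f \<gamma>))}"

text \<open>
  The sides \<open>\<gamma>\<^sup>1\<^sub>e\<close> and \<open>\<gamma>\<^sup>2\<^sub>e\<close>. The axes are \<open>\<gamma>\<^sub>1 = face S 1 c \<gamma>\<close> and \<open>\<gamma>\<^sub>2 = face S 0 c \<gamma>\<close>.
\<close>

definition side1 :: "('o, 'a, 'r) line \<Rightarrow> ('o, 'a, 'p, 'g) grpd \<Rightarrow> 'o \<Rightarrow> ('a \<Rightarrow> 'r list \<Rightarrow> 'g) \<Rightarrow> 'r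
    \<Rightarrow> 'a \<Rightarrow> 'r list \<Rightarrow> 'g" where
  "side1 S G c \<gamma> e = ilam S (Dn S 1) c (\<lambda>f ds. mul G (dm S f) (\<gamma> f [rr S f e, ds ! 0])
     (ginv G (dm S f) (\<gamma> f [rr S f e, \<zero>\<^bsub>rg S (dm S f)\<^esub>])))"

definition side2 :: "('o, 'a, 'r) line \<Rightarrow> ('o, 'a, 'p, 'g) grpd \<Rightarrow> 'o \<Rightarrow> ('a \<Rightarrow> 'r list \<Rightarrow> 'g) \<Rightarrow> 'r
    \<Rightarrow> 'a \<Rightarrow> 'r list \<Rightarrow> 'g" where
  "side2 S G c \<gamma> e = ilam S (Dn S 1) c (\<lambda>f ds. mul G (dm S f) (\<gamma> f [ds ! 0, rr S f e])
     (ginv G (dm S f) (\<gamma> f [\<zero>\<^bsub>rg S (dm S f)\<^esub>, rr S f e])))"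

text \<open>\<open>transport S M E c t d v\<close> is \<open>(t\<^sub>d)\<^sup>-\<^sup>1 v\<close> for \<open>t\<close> in \<open>An S M (Phi_Lin S M E) 1\<close>.\<close>

definition transport :: "('o, 'a, 'r) line \<Rightarrow> ('o, 'a, 'p) psh \<Rightarrow> ('o, 'a, 'r, 'p, 'e) vbundle \<Rightarrow> 'o
    \<Rightarrow> ('a \<Rightarrow> 'r list \<Rightarrow> 'p \<times> 'p \<times> ('a \<Rightarrow> 'e \<Rightarrow> 'e)) \<Rightarrow> 'r \<Rightarrow> 'e \<Rightarrow> 'e" where
  "transport S M E c t d = lapp S c (ginv (Phi_Lin S M E) c (t (idt S c) [d]))"

text \<open>
  The right-hand sides of the defining equations, at stage \<open>c\<close>; \<open>r\<close> and \<open>w\<close> are the functions on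
  the elements at that stage given by \<open>\<rho>\<close> and \<open>\<omega>\<close>.
\<close>

definition mult_rhs :: "('o, 'a, 'r) line \<Rightarrow> ('o, 'a, 'p) psh \<Rightarrow> ('o, 'a, 'p, 'g) grpd
    \<Rightarrow> ('o, 'a, 'p, 'l) grpd \<Rightarrow> 'o
    \<Rightarrow> (('a \<Rightarrow> 'r list \<Rightarrow> 'g) \<Rightarrow> 'a \<Rightarrow> 'r list \<Rightarrow>
          'p \<times> 'p \<times> ('a \<Rightarrow> ('a \<Rightarrow> 'r list \<Rightarrow> 'l) \<Rightarrow> 'a \<Rightarrow> 'r list \<Rightarrow> 'l))
    \<Rightarrow> (('a \<Rightarrow> 'r list \<Rightarrow> 'g) \<Rightarrow> 'a \<Rightarrow> 'r list \<Rightarrow> 'l)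
    \<Rightarrow> ('a \<Rightarrow> 'r list \<Rightarrow> 'g) \<Rightarrow> 'r \<Rightarrow> 'r \<Rightarrow> 'l" where
  "mult_rhs S M G L c r w \<gamma> d\<^sub>1 d\<^sub>2 =
     (let z = \<zero>\<^bsub>rg S c\<^esub>; m = a_inv (rg S c); at = (\<lambda>t d. t (idt S c) [d]);
          E = A1 S M L;
          A = transport S M E c (r (face S 1 c \<gamma>)) d\<^sub>1 (w (side1 S G c \<gamma> d\<^sub>1));
          B = transport S M E c (r (face S 0 c \<gamma>)) d\<^sub>2 (w (side2 S G c \<gamma> d\<^sub>2))
      in mul L c
           (ginv L c (mul L c (at (w (side1 S G c \<gamma> z)) d\<^sub>2) (at A (m d\<^sub>2))))
           (mul L c (at (w (side2 S G c \<gamma> z)) d\<^sub>1) (at B (m d\<^sub>1))))"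

definition contour_rhs :: "('o, 'a, 'r) line \<Rightarrow> ('o, 'a, 'p) psh \<Rightarrow> ('o, 'a, 'p, 'g) grpd
    \<Rightarrow> ('o, 'a, 'p, 'l) grpd \<Rightarrow> 'o
    \<Rightarrow> (('a \<Rightarrow> 'r list \<Rightarrow> 'g) \<Rightarrow> 'a \<Rightarrow> 'r list \<Rightarrow>
          'p \<times> 'p \<times> ('a \<Rightarrow> ('a \<Rightarrow> 'r list \<Rightarrow> 'l) \<Rightarrow> 'a \<Rightarrow> 'r list \<Rightarrow> 'l))
    \<Rightarrow> (('a \<Rightarrow> 'r list \<Rightarrow> 'g) \<Rightarrow> 'a \<Rightarrow> 'r list \<Rightarrow> 'l)
    \<Rightarrow> ('a \<Rightarrow> 'r list \<Rightarrow> 'g) \<Rightarrow> 'r \<Rightarrow> 'r \<Rightarrow> 'l" where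
  "contour_rhs S M G L c r w \<gamma> d\<^sub>1 d\<^sub>2 =
     (let z = \<zero>\<^bsub>rg S c\<^esub>; m = a_inv (rg S c); at = (\<lambda>t d. t (idt S c) [d]);
          E = A1 S M L;
          A = transport S M E c (r (face S 1 c \<gamma>)) d\<^sub>1 (w (side1 S G c \<gamma> d\<^sub>1));
          B = transport S M E c (r (face S 0 c \<gamma>)) d\<^sub>2 (w (side2 S G c \<gamma> d\<^sub>2))
      in mul L c (at (w (side1 S G c \<gamma> z)) (m d\<^sub>2))
           (mul L c (at B (m d\<^sub>1))
             (mul L c (at A d\<^sub>2) (at (w (side2 S G c \<gamma> z)) d\<^sub>1))))"

definition mult_coboundary :: "('o, 'a, 'r) line \<Rightarrow> ('o, 'a, 'p) psh \<Rightarrow> ('o, 'a, 'p, 'g) grpd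
    \<Rightarrow> ('o, 'a, 'p, 'l) grpd \<Rightarrow> 'o
    \<Rightarrow> ('a \<Rightarrow> ('a \<Rightarrow> 'r list \<Rightarrow> 'g) \<Rightarrow> 'a \<Rightarrow> 'r list \<Rightarrow>
          'p \<times> 'p \<times> ('a \<Rightarrow> ('a \<Rightarrow> 'r list \<Rightarrow> 'l) \<Rightarrow> 'a \<Rightarrow> 'r list \<Rightarrow> 'l))
    \<Rightarrow> ('a \<Rightarrow> ('a \<Rightarrow> 'r list \<Rightarrow> 'g) \<Rightarrow> 'a \<Rightarrow> 'r list \<Rightarrow> 'l)
    \<Rightarrow> 'a \<Rightarrow> ('a \<Rightarrow> 'r list \<Rightarrow> 'g) \<Rightarrow> 'a \<Rightarrow> 'r list \<Rightarrow> 'l" where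
  "mult_coboundary S M G L c \<rho>1 \<omega> = (THE \<eta>. \<eta> \<in> forms S M G (A1 S M L) 2 c \<and>
     (\<forall>f\<in>into S c. \<forall>\<gamma>\<in>el (An S M G 2) (dm S f). \<forall>d\<^sub>1\<in>Dset S (dm S f). \<forall>d\<^sub>2\<in>Dset S (dm S f).
        \<eta> f \<gamma> (idt S (dm S f)) [d\<^sub>1 \<otimes>\<^bsub>rg S (dm S f)\<^esub> d\<^sub>2] =
          mult_rhs S M G L (dm S f) (\<rho>1 f) (\<omega> f) \<gamma> d\<^sub>1 d\<^sub>2))"

definition contour_derivative :: "('o, 'a, 'r) line \<Rightarrow> ('o, 'a, 'p) psh \<Rightarrow> ('o, 'a, 'p, 'g) grpd
    \<Rightarrow> ('o, 'a, 'p, 'l) grpd \<Rightarrow> 'o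
    \<Rightarrow> ('a \<Rightarrow> ('a \<Rightarrow> 'r list \<Rightarrow> 'g) \<Rightarrow> 'a \<Rightarrow> 'r list \<Rightarrow>
          'p \<times> 'p \<times> ('a \<Rightarrow> ('a \<Rightarrow> 'r list \<Rightarrow> 'l) \<Rightarrow> 'a \<Rightarrow> 'r list \<Rightarrow> 'l))
    \<Rightarrow> ('a \<Rightarrow> ('a \<Rightarrow> 'r list \<Rightarrow> 'g) \<Rightarrow> 'a \<Rightarrow> 'r list \<Rightarrow> 'l)
    \<Rightarrow> ('a \<Rightarrow> 'r list \<Rightarrow> 'g) \<Rightarrow> 'a \<Rightarrow> 'r list \<Rightarrow> 'l" where
  "contour_derivative S M G L c \<rho>1 \<omega> \<gamma> = (THE \<kappa>. \<kappa> \<in> el (A1 S M L) c \<and>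
     (\<forall>f\<in>into S c. \<forall>d\<^sub>1\<in>Dset S (dm S f). \<forall>d\<^sub>2\<in>Dset S (dm S f).
        \<kappa> f [d\<^sub>1 \<otimes>\<^bsub>rg S (dm S f)\<^esub> d\<^sub>2] =
          contour_rhs S M G L (dm S f) (\<rho>1 f) (\<omega> f) (rsf S (Dn S 2) f \<gamma>) d\<^sub>1 d\<^sub>2))"

definition bracket :: "('o, 'a, 'r) line \<Rightarrow> ('o, 'a, 'p) psh \<Rightarrow> ('o, 'a, 'p, 'l) grpd \<Rightarrow> 'o
    \<Rightarrow> ('a \<Rightarrow> 'r list \<Rightarrow> 'l) \<Rightarrow> ('a \<Rightarrow> 'r list \<Rightarrow> 'l) \<Rightarrow> 'a \<Rightarrow> 'r list \<Rightarrow> 'l" where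
  "bracket S M L c t\<^sub>1 t\<^sub>2 = (THE t. t \<in> el (A1 S M L) c \<and>
     (\<forall>f\<in>into S c. let b = dm S f; m = a_inv (rg S b) in
        \<forall>d\<^sub>1\<in>Dset S b. \<forall>d\<^sub>2\<in>Dset S b. t f [d\<^sub>1 \<otimes>\<^bsub>rg S b\<^esub> d\<^sub>2] =
          mul L b (t\<^sub>2 f [m d\<^sub>2]) (mul L b (t\<^sub>1 f [m d\<^sub>1]) (mul L b (t\<^sub>2 f [d\<^sub>2]) (t\<^sub>1 f [d\<^sub>1])))))"

end

theory Submission
  imports Defs
begin

text \<open>
  Microlinearity of a space \<open>X\<close> is used for two Weil algebra limits only: a map \<open>D \<times> D \<rightarrow> X\<close> that is
  constant on the axes factors uniquely through the multiplication \<open>D \<times> D \<rightarrow> D\<close>, and a map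
  \<open>D(2) \<rightarrow> X\<close> is determined by its restrictions to the axes. The second gives, for tangents \<open>s\<close>, \<open>t\<close>
  of a group bundle and \<open>d e = 0\<close>, that \<open>s\<close> and \<open>t\<close> add pointwise, \<open>t\<^sub>d\<^sub>+\<^sub>e = t\<^sub>d t\<^sub>e\<close>, and that \<open>s\<^sub>d\<close> commutes
  with \<open>t\<^sub>e\<close>. By the first, the transported sides \<open>A(d\<^sub>1)\<close> and \<open>B(d\<^sub>2)\<close> of the square \<open>\<gamma>\<close> have the form
  \<open>A(d\<^sub>1)\<^sub>e = v\<^sub>e a\<close> with \<open>a\<close> taken at \<open>d\<^sub>1 e\<close>, and \<open>B(d\<^sub>2)\<^sub>e = u\<^sub>e b\<close> with \<open>b\<close> taken at \<open>d\<^sub>2 e\<close>, where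
  \<open>v = \<omega>(\<gamma>\<^sup>1\<^sub>0)\<close> and \<open>u = \<omega>(\<gamma>\<^sup>2\<^sub>0)\<close>. Hence the multiplicative coboundary is \<open>a - b\<close>, and in the contour
  product \<open>a\<close> and \<open>b\<close>, which have parameter \<open>d\<^sub>1 d\<^sub>2\<close>, commute with everything and can be collected,
  which leaves the commutator of \<open>v\<close> and \<open>u\<close>. That the coboundary is a form at all follows from the
  behaviour of its defining product: scaling \<open>\<gamma>\<close> scales \<open>d\<^sub>1\<close> or \<open>d\<^sub>2\<close>, and exchanging the two
  variables of \<open>\<gamma>\<close> exchanges \<open>d\<^sub>1\<close> and \<open>d\<^sub>2\<close> and inverts the product.
\<close>

text \<open>Coboundary, contour derivative, bracket and fibre sum are definite descriptions, so
  nothing can be said about them before the objects described are shown to exist and to be unique.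
  The first three are prescribed only at products d e with d, e in D, and an element of D need not
  be such a product. So uniqueness cannot be read off pointwise; it is the uniqueness in the
  factorisation through D x D -> D. Existence comes from the same factorisation: an expression in d
  and e that is the unit for d = 0 and for e = 0 is a function of d e. It must also be natural in
  the stage, hence a restriction lemma for every construction. The factors a and b commute with the
  other letters because (d e) d = (d e) e = 0. In the coboundary, A(d) is taken at -e and then
  inverted, B(e) is taken at -d; in the contour product A(d) is taken at e, B(e) at -d. Both ways
  give a at d e and b at -(d e), which is why the two operators differ by a commutator only. Second
  sides of a square are treated as first sides of the square with its variables exchanged.\<close>

section \<open>Weil algebras\<close>

text \<open>
  The Weil algebras of \<open>D\<close>, \<open>D(2)\<close> and \<open>D \<times> D\<close> are \<open>wD R 2\<close>, \<open>wD R 3\<close> and \<open>wD R 4\<close>: the product of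
  \<open>e\<^sub>i\<close> and \<open>e\<^sub>j\<close> is \<open>e\<^sub>i\<^sub>+\<^sub>j\<close>, except that \<open>e\<^sub>1 e\<^sub>1 = 0\<close>, where a basis vector is \<open>0\<close> if its index is out of
  range. The same convention applies to \<open>selmat R xs\<close>, which maps \<open>e\<^sub>i\<close> to the basis vector of index \<open>xs ! i\<close>.
\<close>

definition wD :: "'r ring \<Rightarrow> nat \<Rightarrow> 'r weil" where
  "wD R n = (n, \<lambda>i j k. if k = (if i = 1 \<and> j = 1 then n else i + j) then \<one>\<^bsub>R\<^esub> else \<zero>\<^bsub>R\<^esub>)"

definition selmat :: "'r ring \<Rightarrow> nat list \<Rightarrow> nat \<Rightarrow> nat \<Rightarrow> 'r" where
  "selmat R xs = (\<lambda>i j. if j = xs ! i then \<one>\<^bsub>R\<^esub> else \<zero>\<^bsub>R\<^esub>)"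

text \<open>Vectors of rank 2, 3 and 4 are written by their entries, so that an identity between
  extensional functions becomes a conjunction of ring equations.\<close>

definition vec :: "'r list \<Rightarrow> nat \<Rightarrow> 'r" where
  "vec xs = (\<lambda>k\<in>{..<length xs}. xs ! k)"

lemma fst_wD [simp]: "fst (wD R n) = n"
  by (simp add: wD_def)

lemma less_2: "(k::nat) < 2 \<longleftrightarrow> k = 0 \<or> k = 1" by auto
lemma less_3: "(k::nat) < 3 \<longleftrightarrow> k = 0 \<or> k = 1 \<or> k = 2" by auto
lemma less_4: "(k::nat) < 4 \<longleftrightarrow> k = 0 \<or> k = 1 \<or> k = 2 \<or> k = 3" by auto

lemma vec_apply [simp]:
  "vec [a, b] 0 = a" "vec [a, b] 1 = b" "vec [a, b] (Suc 0) = b"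
  "vec [a, b, c] 0 = a" "vec [a, b, c] 1 = b" "vec [a, b, c] (Suc 0) = b" "vec [a, b, c] 2 = c"
  "vec [a, b, c, d] 0 = a" "vec [a, b, c, d] 1 = b" "vec [a, b, c, d] (Suc 0) = b"
  "vec [a, b, c, d] 2 = c" "vec [a, b, c, d] 3 = d"
  by (simp_all add: vec_def numeral_3_eq_3)

lemma vec_eq [simp]:
  "vec [a, b] = vec [a', b'] \<longleftrightarrow> a = a' \<and> b = b'"
  "vec [a, b, c] = vec [a', b', c'] \<longleftrightarrow> a = a' \<and> b = b' \<and> c = c'"
  "vec [a, b, c, d] = vec [a', b', c', d'] \<longleftrightarrow> a = a' \<and> b = b' \<and> c = c' \<and> d = d'"
  by (metis vec_apply)+

lemma restrict_vec:
  fixes F :: "nat \<Rightarrow> 'r"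
  shows "(\<lambda>k\<in>{..<2}. F k) = vec [F 0, F 1]"
    and "(\<lambda>k\<in>{..<3}. F k) = vec [F 0, F 1, F 2]"
    and "(\<lambda>k\<in>{..<4}. F k) = vec [F 0, F 1, F 2, F 3]"
  unfolding fun_eq_iff vec_def restrict_def
  by (simp_all add: less_Suc_eq numeral_2_eq_2 numeral_3_eq_3 eval_nat_numeral)

lemma wvec_cases:
  "v \<in> wvec R 2 \<longleftrightarrow> (\<exists>a b. v = vec [a, b] \<and> {a, b} \<subseteq> carrier R)"
  "v \<in> wvec R 3 \<longleftrightarrow> (\<exists>a b c. v = vec [a, b, c] \<and> {a, b, c} \<subseteq> carrier R)"
  "v \<in> wvec R 4 \<longleftrightarrow> (\<exists>a b c d. v = vec [a, b, c, d] \<and> {a, b, c, d} \<subseteq> carrier R)"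
proof -
  have *: "v \<in> wvec R n \<longleftrightarrow> v = restrict v {..<n} \<and> (\<forall>k<n. v k \<in> carrier R)" for n
    by (auto simp: wvec_def PiE_def extensional_def restrict_def fun_eq_iff)
  show "v \<in> wvec R 2 \<longleftrightarrow> (\<exists>a b. v = vec [a, b] \<and> {a, b} \<subseteq> carrier R)"
    unfolding * restrict_vec less_2 by (auto; metis vec_apply)
  show "v \<in> wvec R 3 \<longleftrightarrow> (\<exists>a b c. v = vec [a, b, c] \<and> {a, b, c} \<subseteq> carrier R)"
    unfolding * restrict_vec less_3 by (auto; metis vec_apply)
  show "v \<in> wvec R 4 \<longleftrightarrow> (\<exists>a b c d. v = vec [a, b, c, d] \<and> {a, b, c, d} \<subseteq> carrier R)"
    unfolding * restrict_vec less_4 by (auto; metis vec_apply)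
qed

locale base_ring = cring R for R :: "'r ring" (structure)
begin

lemma sum2:
  fixes F :: "nat \<Rightarrow> 'r"
  shows "\<lbrakk>F 0 \<in> carrier R; F 1 \<in> carrier R\<rbrakk> \<Longrightarrow> finsum R F {..<2} = F 0 \<oplus> F 1"
  by (simp add: eval_nat_numeral lessThan_Suc a_comm)

lemma sum3:
  fixes F :: "nat \<Rightarrow> 'r"
  shows "\<lbrakk>F 0 \<in> carrier R; F 1 \<in> carrier R; F 2 \<in> carrier R\<rbrakk> \<Longrightarrow>
    finsum R F {..<3} = F 0 \<oplus> F 1 \<oplus> F 2"
  by (simp add: eval_nat_numeral lessThan_Suc a_ac)

lemma sum4:
  fixes F :: "nat \<Rightarrow> 'r"
  shows "\<lbrakk>F 0 \<in> carrier R; F 1 \<in> carrier R; F 2 \<in> carrier R; F 3 \<in> carrier R\<rbrakk> \<Longrightarrow>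
    finsum R F {..<4} = F 0 \<oplus> F 1 \<oplus> F 2 \<oplus> F 3"
  by (simp add: eval_nat_numeral lessThan_Suc a_ac)

text \<open>In coordinates the algebras are R[x]/(x^2), R[x,y]/(x^2, xy, y^2), and R[x,y]/(x^2, y^2)
  with basis 1, x, y, xy.\<close>

lemma wmul_wD:
  "\<lbrakk>a \<in> carrier R; b \<in> carrier R; a' \<in> carrier R; b' \<in> carrier R\<rbrakk> \<Longrightarrow>
     wmul R (wD R 2) (vec [a, b]) (vec [a', b']) = vec [a \<otimes> a', a \<otimes> b' \<oplus> b \<otimes> a']"
  "\<lbrakk>a \<in> carrier R; b \<in> carrier R; c \<in> carrier R; a' \<in> carrier R; b' \<in> carrier R; c' \<in> carrier R\<rbrakk> \<Longrightarrow>
     wmul R (wD R 3) (vec [a, b, c]) (vec [a', b', c']) =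
       vec [a \<otimes> a', a \<otimes> b' \<oplus> b \<otimes> a', a \<otimes> c' \<oplus> c \<otimes> a']"
  "\<lbrakk>a \<in> carrier R; b \<in> carrier R; c \<in> carrier R; d \<in> carrier R;
    a' \<in> carrier R; b' \<in> carrier R; c' \<in> carrier R; d' \<in> carrier R\<rbrakk> \<Longrightarrow>
     wmul R (wD R 4) (vec [a, b, c, d]) (vec [a', b', c', d']) =
       vec [a \<otimes> a', a \<otimes> b' \<oplus> b \<otimes> a', a \<otimes> c' \<oplus> c \<otimes> a',
            a \<otimes> d' \<oplus> b \<otimes> c' \<oplus> c \<otimes> b' \<oplus> d \<otimes> a']"
  by (simp_all add: wmul_def wD_def restrict_vec sum2 sum3 sum4)

lemma wone_vec:
  "wone R 2 = vec [\<one>, \<zero>]" "wone R 3 = vec [\<one>, \<zero>, \<zero>]" "wone R 4 = vec [\<one>, \<zero>, \<zero>, \<zero>]"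
  by (simp_all add: wone_def restrict_vec)

lemma wapp_selmat:
  "\<lbrakk>a \<in> carrier R; b \<in> carrier R\<rbrakk> \<Longrightarrow> wapp R 2 m (selmat R [i, j]) (vec [a, b]) =
     (\<lambda>k\<in>{..<m}. (if k = i then a else \<zero>) \<oplus> (if k = j then b else \<zero>))"
  "\<lbrakk>a \<in> carrier R; b \<in> carrier R; c \<in> carrier R\<rbrakk> \<Longrightarrow>
     wapp R 3 m (selmat R [i, j, k]) (vec [a, b, c]) =
     (\<lambda>q\<in>{..<m}. (if q = i then a else \<zero>) \<oplus> (if q = j then b else \<zero>) \<oplus> (if q = k then c else \<zero>))"
  "\<lbrakk>a \<in> carrier R; b \<in> carrier R; c \<in> carrier R; d \<in> carrier R\<rbrakk> \<Longrightarrow>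
     wapp R 4 m (selmat R [i, j, k, l]) (vec [a, b, c, d]) =
     (\<lambda>q\<in>{..<m}. (if q = i then a else \<zero>) \<oplus> (if q = j then b else \<zero>) \<oplus>
        (if q = k then c else \<zero>) \<oplus> (if q = l then d else \<zero>))"
  by (rule ext, simp add: wapp_def selmat_def sum2 sum3 sum4)+

lemma list_len2: "length vs = 2 \<longleftrightarrow> (\<exists>a b. vs = [a, b])"
  by (auto simp: length_Suc_conv numeral_2_eq_2)

lemma list_len3: "length vs = 3 \<longleftrightarrow> (\<exists>a b c. vs = [a, b, c])"
  by (auto simp: length_Suc_conv numeral_3_eq_3)

lemma weil_wD2: "weil_algebra R (wD R 2)"
proof -
  have "foldr (wmul R (wD R 2)) vs (wone R 2) = (\<lambda>k\<in>{..<2}. \<zero>)"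
    if "length vs = 2" "set vs \<subseteq> {v \<in> wvec R 2. v 0 = \<zero>}" for vs
    using that by (auto simp: list_len2 wvec_cases wone_vec wmul_wD restrict_vec)
  then have N: "\<exists>N. \<forall>vs. length vs = N \<and> set vs \<subseteq> {v \<in> wvec R 2. v 0 = \<zero>} \<longrightarrow>
    foldr (wmul R (wD R 2)) vs (wone R 2) = (\<lambda>k\<in>{..<2}. \<zero>)" by blast
  show ?thesis unfolding weil_algebra_def fst_wD
    by (intro conjI N ballI; (auto simp: wvec_cases wone_vec wmul_wD; (simp add: wD_def)?; algebra?)[1])
qed

lemma weil_wD3: "weil_algebra R (wD R 3)"
proof -
  have "foldr (wmul R (wD R 3)) vs (wone R 3) = (\<lambda>k\<in>{..<3}. \<zero>)"
    if "length vs = 2" "set vs \<subseteq> {v \<in> wvec R 3. v 0 = \<zero>}" for vs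
    using that by (auto simp: list_len2 wvec_cases wone_vec wmul_wD restrict_vec)
  then have N: "\<exists>N. \<forall>vs. length vs = N \<and> set vs \<subseteq> {v \<in> wvec R 3. v 0 = \<zero>} \<longrightarrow>
    foldr (wmul R (wD R 3)) vs (wone R 3) = (\<lambda>k\<in>{..<3}. \<zero>)" by blast
  show ?thesis unfolding weil_algebra_def fst_wD
    by (intro conjI N ballI; (auto simp: wvec_cases wone_vec wmul_wD; (simp add: wD_def)?; algebra?)[1])
qed

lemma weil_wD4: "weil_algebra R (wD R 4)"
proof -
  \<comment> \<open>The monomial xy survives here, so the nilpotency exponent is 3 and not 2: a
    monomial of degree 3 in x and y contains a square.\<close>
  have "foldr (wmul R (wD R 4)) vs (wone R 4) = (\<lambda>k\<in>{..<4}. \<zero>)"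
    if "length vs = 3" "set vs \<subseteq> {v \<in> wvec R 4. v 0 = \<zero>}" for vs
    using that by (auto simp: list_len3 wvec_cases wone_vec wmul_wD restrict_vec)
  then have N: "\<exists>N. \<forall>vs. length vs = N \<and> set vs \<subseteq> {v \<in> wvec R 4. v 0 = \<zero>} \<longrightarrow>
    foldr (wmul R (wD R 4)) vs (wone R 4) = (\<lambda>k\<in>{..<4}. \<zero>)" by blast
  show ?thesis unfolding weil_algebra_def fst_wD
    by (intro conjI N ballI; (auto simp: wvec_cases wone_vec wmul_wD; (simp add: wD_def)?; algebra?)[1])
qed

lemma selmat_carrier: "\<forall>i<n. \<forall>j<m. selmat R xs i j \<in> carrier R"
  by (simp add: selmat_def)

text \<open>On spectra these are, in this order: the constant map 0 of D; the multiplication D x D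
  -> D; the two axes of D(2) and the constant map D -> D(2); the two axes of D x D and the constant
  map D -> D x D. An index 2 in rank 2 is out of range and kills the generator.\<close>

lemma weil_hom_selmat:
  "weil_hom R (wD R 2) (wD R 2) (selmat R [0, 2])"
  "weil_hom R (wD R 2) (wD R 4) (selmat R [0, 3])"
  "weil_hom R (wD R 3) (wD R 2) (selmat R [0, 1, 2])"
  "weil_hom R (wD R 3) (wD R 2) (selmat R [0, 2, 1])"
  "weil_hom R (wD R 3) (wD R 2) (selmat R [0, 2, 2])"
  "weil_hom R (wD R 4) (wD R 2) (selmat R [0, 1, 2, 2])"
  "weil_hom R (wD R 4) (wD R 2) (selmat R [0, 2, 1, 2])"
  "weil_hom R (wD R 4) (wD R 2) (selmat R [0, 2, 2, 2])"
  unfolding weil_hom_def Let_def fst_wD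
  by (intro conjI ballI selmat_carrier;
      auto simp: wvec_cases wone_vec wmul_wD wapp_selmat restrict_vec)+

end

section \<open>The line at a stage: restriction, infinitesimals and spectra\<close>

locale line_obj =
  fixes S :: "('o, 'a, 'r) line"
  assumes ring_obj: "ring_object S"
begin

lemma cat: "category S"
  using ring_obj by (simp add: ring_object_def)

lemma into_iff: "f \<in> into S c \<longleftrightarrow> f \<in> Ar S \<and> cd S f = c"
  by (auto simp: into_def)

lemma ar_ob [simp]: "f \<in> Ar S \<Longrightarrow> dm S f \<in> Ob S" "f \<in> Ar S \<Longrightarrow> cd S f \<in> Ob S"
  using cat by (auto simp: category_def)

lemma into_ob [simp]: "f \<in> into S c \<Longrightarrow> dm S f \<in> Ob S" "f \<in> into S c \<Longrightarrow> c \<in> Ob S"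
  by (auto simp: into_iff)

lemma idt_into [simp]: "c \<in> Ob S \<Longrightarrow> idt S c \<in> into S c" "c \<in> Ob S \<Longrightarrow> dm S (idt S c) = c"
  using cat by (auto simp: category_def into_iff)

lemma cmp_idt [simp]: "f \<in> into S c \<Longrightarrow> cmp S f (idt S (dm S f)) = f"
    "f \<in> into S c \<Longrightarrow> cmp S (idt S c) f = f"
  using cat by (auto simp: category_def into_iff)

lemma cmp_into [simp]:
  assumes "f \<in> into S c" "g \<in> into S (dm S f)"
  shows "cmp S f g \<in> into S c" "dm S (cmp S f g) = dm S g"
  using assms cat by (auto simp: category_def into_iff)

lemma cmp_assoc:
  assumes "f \<in> into S c" "g \<in> into S (dm S f)" "h \<in> into S (dm S g)"
  shows "cmp S (cmp S f g) h = cmp S f (cmp S g h)"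
  using assms cat by (simp add: category_def into_def)

lemma ring_at: "c \<in> Ob S \<Longrightarrow> base_ring (rg S c)"
  using ring_obj by (simp add: ring_object_def base_ring_def)

lemma cring_at: "c \<in> Ob S \<Longrightarrow> cring (rg S c)"
  using ring_obj by (simp add: ring_object_def)

lemma rr_hom: "f \<in> into S c \<Longrightarrow> ring_hom_cring (rg S c) (rg S (dm S f)) (rr S f)"
  using ring_obj
  by (auto simp: ring_object_def into_iff ring_hom_cring_def ring_hom_cring_axioms_def)

lemma rr_simps [simp]:
  assumes "f \<in> into S c"
  shows "rr S f \<zero>\<^bsub>rg S c\<^esub> = \<zero>\<^bsub>rg S (dm S f)\<^esub>" "rr S f \<one>\<^bsub>rg S c\<^esub> = \<one>\<^bsub>rg S (dm S f)\<^esub>"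
    and "a \<in> carrier (rg S c) \<Longrightarrow> rr S f a \<in> carrier (rg S (dm S f))"
    and "a \<in> carrier (rg S c) \<Longrightarrow> rr S f (\<ominus>\<^bsub>rg S c\<^esub> a) = \<ominus>\<^bsub>rg S (dm S f)\<^esub> rr S f a"
    and "\<lbrakk>a \<in> carrier (rg S c); b \<in> carrier (rg S c)\<rbrakk> \<Longrightarrow>
      rr S f (a \<otimes>\<^bsub>rg S c\<^esub> b) = rr S f a \<otimes>\<^bsub>rg S (dm S f)\<^esub> rr S f b"
    and "\<lbrakk>a \<in> carrier (rg S c); b \<in> carrier (rg S c)\<rbrakk> \<Longrightarrow>
      rr S f (a \<oplus>\<^bsub>rg S c\<^esub> b) = rr S f a \<oplus>\<^bsub>rg S (dm S f)\<^esub> rr S f b"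
proof -
  interpret ring_hom_cring "rg S c" "rg S (dm S f)" "rr S f" by (rule rr_hom[OF assms])
  show "rr S f \<zero>\<^bsub>rg S c\<^esub> = \<zero>\<^bsub>rg S (dm S f)\<^esub>" "rr S f \<one>\<^bsub>rg S c\<^esub> = \<one>\<^bsub>rg S (dm S f)\<^esub>"
    "a \<in> carrier (rg S c) \<Longrightarrow> rr S f a \<in> carrier (rg S (dm S f))"
    "a \<in> carrier (rg S c) \<Longrightarrow> rr S f (\<ominus>\<^bsub>rg S c\<^esub> a) = \<ominus>\<^bsub>rg S (dm S f)\<^esub> rr S f a"
    "\<lbrakk>a \<in> carrier (rg S c); b \<in> carrier (rg S c)\<rbrakk> \<Longrightarrow>
      rr S f (a \<otimes>\<^bsub>rg S c\<^esub> b) = rr S f a \<otimes>\<^bsub>rg S (dm S f)\<^esub> rr S f b"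
    "\<lbrakk>a \<in> carrier (rg S c); b \<in> carrier (rg S c)\<rbrakk> \<Longrightarrow>
      rr S f (a \<oplus>\<^bsub>rg S c\<^esub> b) = rr S f a \<oplus>\<^bsub>rg S (dm S f)\<^esub> rr S f b" by simp_all
qed

lemma rr_cmp: "\<lbrakk>f \<in> into S c; g \<in> into S (dm S f); a \<in> carrier (rg S c)\<rbrakk> \<Longrightarrow>
    rr S (cmp S f g) a = rr S g (rr S f a)"
  and rr_idt: "\<lbrakk>c \<in> Ob S; a \<in> carrier (rg S c)\<rbrakk> \<Longrightarrow> rr S (idt S c) a = a"
  using ring_obj by (auto simp: ring_object_def presheaf_def line_psh_def into_def)

lemma Dset_iff: "d \<in> Dset S c \<longleftrightarrow> d \<in> carrier (rg S c) \<and> d \<otimes>\<^bsub>rg S c\<^esub> d = \<zero>\<^bsub>rg S c\<^esub>"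
  by (simp add: Dset_def)

lemma Dset_carrier: "d \<in> Dset S c \<Longrightarrow> d \<in> carrier (rg S c)"
  by (simp add: Dset_iff)

lemma Dset_zero [simp]: "c \<in> Ob S \<Longrightarrow> \<zero>\<^bsub>rg S c\<^esub> \<in> Dset S c"
  using cring_at[of c] by (simp add: Dset_iff cring.cring_simprules)

lemma Dset_mult [simp]:
  assumes "c \<in> Ob S" "d \<in> Dset S c" "a \<in> carrier (rg S c)"
  shows "a \<otimes>\<^bsub>rg S c\<^esub> d \<in> Dset S c" "d \<otimes>\<^bsub>rg S c\<^esub> a \<in> Dset S c"
proof -
  interpret cring "rg S c" by (rule cring_at[OF assms(1)])
  have "d \<otimes>\<^bsub>rg S c\<^esub> a \<otimes>\<^bsub>rg S c\<^esub> (d \<otimes>\<^bsub>rg S c\<^esub> a) =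
      (d \<otimes>\<^bsub>rg S c\<^esub> d) \<otimes>\<^bsub>rg S c\<^esub> (a \<otimes>\<^bsub>rg S c\<^esub> a)"
    using assms by (simp add: Dset_iff m_ac del: )
  also have "\<dots> = \<zero>\<^bsub>rg S c\<^esub>" using assms by (simp add: Dset_iff)
  finally show "d \<otimes>\<^bsub>rg S c\<^esub> a \<in> Dset S c" using assms by (simp add: Dset_iff)
  then show "a \<otimes>\<^bsub>rg S c\<^esub> d \<in> Dset S c" using assms by (simp add: Dset_iff m_comm)
qed

lemma Dset_uminus [simp]: "\<lbrakk>c \<in> Ob S; d \<in> Dset S c\<rbrakk> \<Longrightarrow> \<ominus>\<^bsub>rg S c\<^esub> d \<in> Dset S c"
  using cring_at[of c] by (simp add: Dset_iff cring.cring_simprules)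

lemma Dset_rr [simp]: "\<lbrakk>f \<in> into S c; d \<in> Dset S c\<rbrakk> \<Longrightarrow> rr S f d \<in> Dset S (dm S f)"
  by (simp add: Dset_iff) (metis rr_simps(1,5))

lemma Dset_add [simp]:
  assumes "c \<in> Ob S" "d \<in> Dset S c" "e \<in> Dset S c" "d \<otimes>\<^bsub>rg S c\<^esub> e = \<zero>\<^bsub>rg S c\<^esub>"
  shows "d \<oplus>\<^bsub>rg S c\<^esub> e \<in> Dset S c"
proof -
  interpret cring "rg S c" by (rule cring_at[OF assms(1)])
  have "e \<otimes>\<^bsub>rg S c\<^esub> d = \<zero>\<^bsub>rg S c\<^esub>" using assms by (simp add: Dset_iff m_comm)
  then show ?thesis using assms by (simp add: Dset_iff l_distr r_distr)
qed

text \<open>These are D, D(2) and D x D. In rank 4 the relation e1 e2 = e3 forces the last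
  coordinate to be the product of the middle two; in rank 3 the same product falls out of range,
  which forces d e = 0.\<close>

lemma weil_spec_wD:
  assumes f: "f \<in> into S c"
  shows "weil_spec S (wD (rg S c) 2) f = {vec [\<one>\<^bsub>rg S (dm S f)\<^esub>, d] |d. d \<in> Dset S (dm S f)}"
    and "weil_spec S (wD (rg S c) 3) f = {vec [\<one>\<^bsub>rg S (dm S f)\<^esub>, d, e] |d e.
      d \<in> Dset S (dm S f) \<and> e \<in> Dset S (dm S f) \<and> d \<otimes>\<^bsub>rg S (dm S f)\<^esub> e = \<zero>\<^bsub>rg S (dm S f)\<^esub>}"
    and "weil_spec S (wD (rg S c) 4) f = {vec [\<one>\<^bsub>rg S (dm S f)\<^esub>, d, e, d \<otimes>\<^bsub>rg S (dm S f)\<^esub> e] |d e.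
      d \<in> Dset S (dm S f) \<and> e \<in> Dset S (dm S f)}"
proof -
  interpret base_ring "rg S (dm S f)" using f by (intro ring_at) simp
  show "weil_spec S (wD (rg S c) 2) f = {vec [\<one>\<^bsub>rg S (dm S f)\<^esub>, d] |d. d \<in> Dset S (dm S f)}"
    using f by (auto simp: weil_spec_def Let_def wvec_cases less_2 wD_def sum2 Dset_iff)
  show "weil_spec S (wD (rg S c) 3) f = {vec [\<one>\<^bsub>rg S (dm S f)\<^esub>, d, e] |d e.
      d \<in> Dset S (dm S f) \<and> e \<in> Dset S (dm S f) \<and> d \<otimes>\<^bsub>rg S (dm S f)\<^esub> e = \<zero>\<^bsub>rg S (dm S f)\<^esub>}"
    using f by (auto simp: weil_spec_def Let_def wvec_cases less_3 wD_def sum3 Dset_iff m_comm)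
  have *: "x \<otimes>\<^bsub>rg S (dm S f)\<^esub> x = \<zero>\<^bsub>rg S (dm S f)\<^esub> \<Longrightarrow>
      x \<in> carrier (rg S (dm S f)) \<Longrightarrow> y \<in> carrier (rg S (dm S f)) \<Longrightarrow>
      x \<otimes>\<^bsub>rg S (dm S f)\<^esub> (x \<otimes>\<^bsub>rg S (dm S f)\<^esub> y) = \<zero>\<^bsub>rg S (dm S f)\<^esub>" for x y
    by (metis m_assoc l_null)
  show "weil_spec S (wD (rg S c) 4) f = {vec [\<one>\<^bsub>rg S (dm S f)\<^esub>, d, e, d \<otimes>\<^bsub>rg S (dm S f)\<^esub> e] |d e.
      d \<in> Dset S (dm S f) \<and> e \<in> Dset S (dm S f)}"
    using f by (auto simp: weil_spec_def Let_def wvec_cases less_4 wD_def sum4 Dset_iff m_ac *)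
qed

lemma vrs_vec:
  "vrs S 2 f (vec [a, b]) = vec [rr S f a, rr S f b]"
  "vrs S 3 f (vec [a, b, c]) = vec [rr S f a, rr S f b, rr S f c]"
  "vrs S 4 f (vec [a, b, c, d]) = vec [rr S f a, rr S f b, rr S f c, rr S f d]"
  by (simp_all add: vrs_def restrict_vec)

text \<open>Row i of the matrix has its only 1 in column \<open>xs ! i\<close>, so the sum collapses
  to one coordinate of p. If that column does not exist the row is zero, which is how the constant
  maps arise.\<close>

lemma spec_pull_selmat:
  assumes f: "f \<in> into S c" and p: "p \<in> wvec (rg S (dm S f)) m"
  shows "spec_pull S n m (selmat (rg S c) xs) f p =
    (\<lambda>i\<in>{..<n}. if xs ! i < m then p (xs ! i) else \<zero>\<^bsub>rg S (dm S f)\<^esub>)"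
proof -
  interpret base_ring "rg S (dm S f)" using f by (intro ring_at) simp
  have p': "p j \<in> carrier (rg S (dm S f))" if "j < m" for j
    using p that by (auto simp: wvec_def)
  have "finsum (rg S (dm S f)) (\<lambda>j. rr S f (selmat (rg S c) xs i j) \<otimes>\<^bsub>rg S (dm S f)\<^esub> p j) {..<m} =
      finsum (rg S (dm S f)) (\<lambda>j. if xs ! i = j then p j else \<zero>\<^bsub>rg S (dm S f)\<^esub>) {..<m}" for i
    using f p' by (intro finsum_cong') (auto simp: selmat_def)
  moreover have "\<dots> i = (if xs ! i < m then p (xs ! i) else \<zero>\<^bsub>rg S (dm S f)\<^esub>)" for i
  proof (cases "xs ! i < m")
    case True
    then show ?thesis using p' by (simp add: add.finprod_singleton)
  next
    case False
    then have "finsum (rg S (dm S f)) (\<lambda>j. if xs ! i = j then p j else \<zero>\<^bsub>rg S (dm S f)\<^esub>) {..<m} =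
      finsum (rg S (dm S f)) (\<lambda>j. \<zero>\<^bsub>rg S (dm S f)\<^esub>) {..<m}"
      by (intro finsum_cong') auto
    with False show ?thesis by simp
  qed
  ultimately show ?thesis by (simp add: spec_pull_def)
qed

end

section \<open>Internal maps and microlinearity\<close>

context line_obj begin

lemma ilam_apply [simp]: "\<lbrakk>f \<in> into S c; x \<in> el X (dm S f)\<rbrakk> \<Longrightarrow> ilam S X c F f x = F f x"
  by (simp add: ilam_def dlam_def)

lemma expo_iff: "\<phi> \<in> el (expo S X Y) c \<longleftrightarrow> ilam S X c \<phi> = \<phi> \<and>
    (\<forall>f\<in>into S c. \<forall>x\<in>el X (dm S f). \<phi> f x \<in> el Y (dm S f) \<and>
      (\<forall>g\<in>into S (dm S f). \<phi> (cmp S f g) (rs X g x) = rs Y g (\<phi> f x)))"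
  by (simp add: expo_def dmaps_def ilam_def)

lemma expo_el: "\<lbrakk>\<phi> \<in> el (expo S X Y) c; f \<in> into S c; x \<in> el X (dm S f)\<rbrakk> \<Longrightarrow> \<phi> f x \<in> el Y (dm S f)"
  by (simp add: expo_iff)

lemma expo_nat: "\<lbrakk>\<phi> \<in> el (expo S X Y) c; f \<in> into S c; g \<in> into S (dm S f); x \<in> el X (dm S f)\<rbrakk>
    \<Longrightarrow> \<phi> (cmp S f g) (rs X g x) = rs Y g (\<phi> f x)"
  by (simp add: expo_iff)

lemma ilam_cong:
  "(\<And>f x. \<lbrakk>f \<in> into S c; x \<in> el X (dm S f)\<rbrakk> \<Longrightarrow> F f x = F' f x) \<Longrightarrow> ilam S X c F = ilam S X c F'"
  by (auto simp: ilam_def dlam_def fun_eq_iff)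

lemma expo_eta: "\<phi> \<in> el (expo S X Y) c \<Longrightarrow> ilam S X c \<phi> = \<phi>"
  by (simp add: expo_iff)

lemma expo_ext:
  assumes "\<phi> \<in> el (expo S X Y) c" "\<psi> \<in> el (expo S X Y') c"
    and "\<And>f x. \<lbrakk>f \<in> into S c; x \<in> el X (dm S f)\<rbrakk> \<Longrightarrow> \<phi> f x = \<psi> f x"
  shows "\<phi> = \<psi>"
  using ilam_cong[of c X \<phi> \<psi>] assms by (simp add: expo_eta)

lemma psh_el: "\<lbrakk>presheaf S X; f \<in> into S c; x \<in> el X c\<rbrakk> \<Longrightarrow> rs X f x \<in> el X (dm S f)"
  by (auto simp: presheaf_def into_iff)

lemma psh_idt: "\<lbrakk>presheaf S X; c \<in> Ob S; x \<in> el X c\<rbrakk> \<Longrightarrow> rs X (idt S c) x = x"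
  by (auto simp: presheaf_def)

lemma psh_cmp: "\<lbrakk>presheaf S X; f \<in> into S c; g \<in> into S (dm S f); x \<in> el X c\<rbrakk> \<Longrightarrow>
    rs X (cmp S f g) x = rs X g (rs X f x)"
  by (auto simp: presheaf_def into_iff)

lemma ilam_expo:
  assumes "presheaf S X"
    and "\<And>f x. \<lbrakk>f \<in> into S c; x \<in> el X (dm S f)\<rbrakk> \<Longrightarrow> F f x \<in> el Y (dm S f)"
    and "\<And>f x g. \<lbrakk>f \<in> into S c; x \<in> el X (dm S f); g \<in> into S (dm S f)\<rbrakk> \<Longrightarrow>
      F (cmp S f g) (rs X g x) = rs Y g (F f x)"
  shows "ilam S X c F \<in> el (expo S X Y) c"
  using assms psh_el[OF assms(1)] by (auto simp: expo_iff intro!: ilam_cong)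

lemma rsf_apply [simp]: "\<lbrakk>f \<in> into S c; g \<in> into S (dm S f); x \<in> el X (dm S g)\<rbrakk> \<Longrightarrow>
    rsf S X f \<phi> g x = \<phi> (cmp S f g) x"
  by (simp add: rsf_def)

lemma rsf_idt:
  assumes "\<phi> \<in> el (expo S X Y) c" "c \<in> Ob S"
  shows "rsf S X (idt S c) \<phi> = \<phi>"
proof -
  have "rsf S X (idt S c) \<phi> = ilam S X c \<phi>"
    unfolding rsf_def idt_into(2)[OF assms(2)] by (rule ilam_cong) (use assms(2) in simp)
  with expo_eta[OF assms(1)] show ?thesis by simp
qed

lemma rsf_cmp:
  assumes "f \<in> into S c" "g \<in> into S (dm S f)"
  shows "rsf S X (cmp S f g) \<phi> = rsf S X g (rsf S X f \<phi>)"
proof -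
  have "rsf S X (cmp S f g) \<phi> = ilam S X (dm S g) (\<lambda>h. \<phi> (cmp S (cmp S f g) h))"
    using assms by (simp add: rsf_def)
  also have "\<dots> = ilam S X (dm S g) (\<lambda>h. rsf S X f \<phi> (cmp S g h))"
    by (rule ilam_cong) (use assms in \<open>simp add: cmp_assoc[OF assms]\<close>)
  finally show ?thesis by (simp add: rsf_def)
qed

lemma Dn_psh [simp]: "presheaf S (Dn S n)"
proof -
  have C: "Dset S c \<subseteq> carrier (rg S c)" for c by (auto simp: Dset_iff)
  have 1: "map (rr S f) ds \<in> el (Dn S n) (dm S f)"
    if "f \<in> into S c" "ds \<in> el (Dn S n) c" for f c ds
    using that by (auto simp: Dn_def)
  have 2: "map (rr S (idt S c)) ds = ds" if "c \<in> Ob S" "ds \<in> el (Dn S n) c" for c ds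
    using that C[of c] by (auto simp: Dn_def rr_idt subset_iff intro!: map_idI)
  have 3: "map (rr S (cmp S f g)) ds = map (rr S g) (map (rr S f) ds)"
    if "f \<in> into S c" "g \<in> into S (dm S f)" "ds \<in> el (Dn S n) c" for f g c ds
    using that C[of c] by (auto simp: Dn_def rr_cmp subset_iff)
  show ?thesis
    unfolding presheaf_def
  proof (intro conjI ballI)
    fix f x assume "f \<in> Ar S" "x \<in> el (Dn S n) (cd S f)"
    then show "rs (Dn S n) f x \<in> el (Dn S n) (dm S f)"
      using 1[of f "cd S f" x] by (simp add: Dn_def into_def)
  next
    fix c x assume "c \<in> Ob S" "x \<in> el (Dn S n) c"
    then show "rs (Dn S n) (idt S c) x = x" using 2 by (simp add: Dn_def)
  next
    fix f g x assume "f \<in> Ar S" "g \<in> into S (dm S f)" "x \<in> el (Dn S n) (cd S f)"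
    then show "rs (Dn S n) (cmp S f g) x = rs (Dn S n) g (rs (Dn S n) f x)"
      using 3[of f "cd S f" g x] by (simp add: Dn_def into_def)
  qed
qed

lemma Dn_1 [simp]: "ds \<in> el (Dn S 1) c \<longleftrightarrow> (\<exists>d. ds = [d] \<and> d \<in> Dset S c)"
    "ds \<in> el (Dn S (Suc 0)) c \<longleftrightarrow> (\<exists>d. ds = [d] \<and> d \<in> Dset S c)"
  by (auto simp: Dn_def length_Suc_conv)

lemma Dn_2 [simp]: "ds \<in> el (Dn S 2) c \<longleftrightarrow> (\<exists>d e. ds = [d, e] \<and> d \<in> Dset S c \<and> e \<in> Dset S c)"
  by (auto simp: Dn_def length_Suc_conv numeral_2_eq_2)

lemma rs_Dn [simp]: "rs (Dn S n) f ds = map (rr S f) ds"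
  by (simp add: Dn_def)

lemma D2n_1 [simp]: "q \<in> el (D2n S (Suc 0) 0) c \<longleftrightarrow> (\<exists>d e. q = (e, [d]) \<and> d \<in> Dset S c \<and> e \<in> Dset S c \<and>
     d \<otimes>\<^bsub>rg S c\<^esub> e = \<zero>\<^bsub>rg S c\<^esub>)"
  by (auto simp: D2n_def)

lemmas D2n_1' [simp] = D2n_1[folded One_nat_def]

lemma rs_D2n [simp]: "rs (D2n S n i) f (e, ds) = (rr S f e, map (rr S f) ds)"
  by (simp add: D2n_def)

lemma Dset_rr0:
  assumes "f \<in> into S c" "d \<in> Dset S c" "e \<in> Dset S c" "d \<otimes>\<^bsub>rg S c\<^esub> e = \<zero>\<^bsub>rg S c\<^esub>"
  shows "rr S f d \<otimes>\<^bsub>rg S (dm S f)\<^esub> rr S f e = \<zero>\<^bsub>rg S (dm S f)\<^esub>"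
  using assms by (metis Dset_carrier rr_simps(1,5))

lemma D2n_psh [simp]: "presheaf S (D2n S 1 0)"
  unfolding presheaf_def
proof (intro conjI ballI)
  fix f x assume "f \<in> Ar S" "x \<in> el (D2n S 1 0) (cd S f)"
  moreover from this have "f \<in> into S (cd S f)" by (simp add: into_def)
  ultimately show "rs (D2n S 1 0) f x \<in> el (D2n S 1 0) (dm S f)"
    by (auto simp: Dset_rr0)
next
  fix c x assume "c \<in> Ob S" "x \<in> el (D2n S 1 0) c"
  then show "rs (D2n S 1 0) (idt S c) x = x" by (auto simp: rr_idt Dset_carrier)
next
  fix f g x assume "f \<in> Ar S" "g \<in> into S (dm S f)" "x \<in> el (D2n S 1 0) (cd S f)"
  moreover from this have "f \<in> into S (cd S f)" by (simp add: into_def)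
  ultimately show "rs (D2n S 1 0) (cmp S f g) x = rs (D2n S 1 0) g (rs (D2n S 1 0) f x)"
    by (auto simp: rr_cmp Dset_carrier)
qed

lemma mrs_selmat: "f \<in> into S c \<Longrightarrow> mrs S f (selmat (rg S c) xs) = selmat (rg S (dm S f)) xs"
  by (auto simp: mrs_def selmat_def fun_eq_iff)

text \<open>
  On spectra, the following two limits say that the multiplication \<open>D \<times> D \<rightarrow> D\<close> is the joint coequalizer
  of the two axes \<open>D \<rightarrow> D \<times> D\<close> and the constant map, and that \<open>D(2)\<close> is the pushout of its axes.
\<close>

lemma weil_limit_mult:
  assumes c: "c \<in> Ob S"
  defines "R \<equiv> rg S c"
  shows "weil_limit S c [wD R 4, wD R 2]
    [(0, 1, selmat R [0, 1, 2, 2]), (0, 1, selmat R [0, 2, 1, 2]), (0, 1, selmat R [0, 2, 2, 2])]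
    (wD R 2) [selmat R [0, 3], selmat R [0, 2]]"
proof -
  interpret base_ring R unfolding R_def by (rule ring_at[OF c])
  \<comment> \<open>Stated for an arbitrary ring R', because \<open>weil_limit\<close> asks that the
    limit persist after restriction to every later stage.\<close>
  have U: "\<exists>!w. w \<in> wvec R' 2 \<and> wapp R' 2 4 (selmat R' [0, 3]) w = v0 \<and>
      wapp R' 2 2 (selmat R' [0, 2]) w = v1"
    if R': "base_ring R'" and vs: "v0 \<in> wvec R' 4" "v1 \<in> wvec R' 2"
      "wapp R' 4 2 (selmat R' [0, 1, 2, 2]) v0 = v1"
      "wapp R' 4 2 (selmat R' [0, 2, 1, 2]) v0 = v1"
      "wapp R' 4 2 (selmat R' [0, 2, 2, 2]) v0 = v1" for R' v0 v1
  proof -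
    interpret R': base_ring R' by (rule R')
    obtain a x y z where v0: "v0 = vec [a, x, y, z]" and C: "{a, x, y, z} \<subseteq> carrier R'"
      using vs(1)[unfolded wvec_cases] by (elim exE conjE)
    obtain b w where v1: "v1 = vec [b, w]" and C1: "{b, w} \<subseteq> carrier R'"
      using vs(2)[unfolded wvec_cases] by (elim exE conjE)
    \<comment> \<open>The three edges send v0 to (a, x), (a, y) and (a, 0), and all of these equal
      v1. Only z, the coefficient of xy, stays free, and it becomes the linear coefficient of the
      factorisation.\<close>
    have e: "b = a" "x = \<zero>\<^bsub>R'\<^esub>" "y = \<zero>\<^bsub>R'\<^esub>" "w = \<zero>\<^bsub>R'\<^esub>"
      using vs(3-5) C C1 by (auto simp: v0 v1 R'.wapp_selmat restrict_vec)
    show ?thesis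
    proof (rule ex1I[of _ "vec [a, z]"])
      show "vec [a, z] \<in> wvec R' 2 \<and> wapp R' 2 4 (selmat R' [0, 3]) (vec [a, z]) = v0 \<and>
          wapp R' 2 2 (selmat R' [0, 2]) (vec [a, z]) = v1"
        using C by (simp add: v0 v1 e wvec_cases R'.wapp_selmat restrict_vec)
      fix u assume u: "u \<in> wvec R' 2 \<and> wapp R' 2 4 (selmat R' [0, 3]) u = v0 \<and>
          wapp R' 2 2 (selmat R' [0, 2]) u = v1"
      then obtain p q where "u = vec [p, q]" "{p, q} \<subseteq> carrier R'"
        unfolding wvec_cases by (elim exE conjE)
      then show "u = vec [a, z]"
        using u C by (simp add: v0 v1 e R'.wapp_selmat restrict_vec)
    qed
  qed
  have E: "\<forall>(i, j, h)\<in>set [(0, 1, selmat R [0, 1, 2, 2]), (0, 1, selmat R [0, 2, 1, 2]),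
      (0, 1, selmat R [0, 2, 2, 2])]. \<forall>w\<in>wvec R 2.
        wapp R (fst ([wD R 4, wD R 2] ! i)) (fst ([wD R 4, wD R 2] ! j)) h
          (wapp R 2 (fst ([wD R 4, wD R 2] ! i)) ([selmat R [0, 3], selmat R [0, 2]] ! i) w) =
        wapp R 2 (fst ([wD R 4, wD R 2] ! j)) ([selmat R [0, 3], selmat R [0, 2]] ! j) w"
  proof -
    have "\<forall>w\<in>wvec R 2. wapp R 4 2 (selmat R xs) (wapp R 2 4 (selmat R [0, 3]) w) =
       wapp R 2 2 (selmat R [0, 2]) w" if "xs \<in> {[0, 1, 2, 2], [0, 2, 1, 2], [0, 2, 2, 2]}" for xs
      using that by (auto simp: wvec_cases wapp_selmat restrict_vec)
    then show ?thesis by simp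
  qed
  show ?thesis
    unfolding weil_limit_def R_def[symmetric] fst_wD
  proof (intro conjI E)
    show "\<forall>V\<in>set [wD R 4, wD R 2]. weil_algebra R V"
      by (simp add: weil_wD2 weil_wD4)
    show "\<forall>(i, j, h)\<in>set [(0, 1, selmat R [0, 1, 2, 2]), (0, 1, selmat R [0, 2, 1, 2]),
      (0, 1, selmat R [0, 2, 2, 2])]. i < length [wD R 4, wD R 2] \<and> j < length [wD R 4, wD R 2] \<and>
      weil_hom R ([wD R 4, wD R 2] ! i) ([wD R 4, wD R 2] ! j) h"
      using weil_hom_selmat by simp
    show "weil_algebra R (wD R 2)" by (rule weil_wD2)
    show "\<forall>i<length [wD R 4, wD R 2]. weil_hom R (wD R 2) ([wD R 4, wD R 2] ! i)
        ([selmat R [0, 3], selmat R [0, 2]] ! i)"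
      using weil_hom_selmat by (auto simp: less_Suc_eq)
    show "\<forall>f\<in>into S c. let R' = rg S (dm S f) in
        \<forall>vs. length vs = length [wD R 4, wD R 2] \<and>
          (\<forall>i<length [wD R 4, wD R 2]. vs ! i \<in> wvec R' (fst ([wD R 4, wD R 2] ! i))) \<and>
          (\<forall>(i, j, h)\<in>set [(0, 1, selmat R [0, 1, 2, 2]), (0, 1, selmat R [0, 2, 1, 2]),
             (0, 1, selmat R [0, 2, 2, 2])].
             wapp R' (fst ([wD R 4, wD R 2] ! i)) (fst ([wD R 4, wD R 2] ! j)) (mrs S f h) (vs ! i) = vs ! j) \<longrightarrow>
          (\<exists>!w. w \<in> wvec R' 2 \<and>
             (\<forall>i<length [wD R 4, wD R 2]. wapp R' 2 (fst ([wD R 4, wD R 2] ! i))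
               (mrs S f ([selmat R [0, 3], selmat R [0, 2]] ! i)) w = vs ! i))"
      (is "\<forall>f\<in>into S c. let R' = rg S (dm S f) in \<forall>vs. ?Q f R' vs \<longrightarrow> ?C f R' vs")
    proof
      fix f assume f: "f \<in> into S c"
      define R' where "R' = rg S (dm S f)"
      have m: "mrs S f (selmat R xs) = selmat R' xs" for xs
        unfolding R_def R'_def by (rule mrs_selmat[OF f])
      have R': "base_ring R'" unfolding R'_def using f by (intro ring_at) simp
      show "let R' = rg S (dm S f) in \<forall>vs. ?Q f R' vs \<longrightarrow> ?C f R' vs"
        unfolding Let_def R'_def[symmetric]
      proof (intro allI impI)
        fix vs assume H: "?Q f R' vs"
        then obtain v0 v1 where vs: "vs = [v0, v1]" by (auto simp: length_Suc_conv)
        show "?C f R' vs"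
          using U[OF R', of v0 v1] H unfolding vs m by (simp add: All_less_Suc m conj_ac)
      qed
    qed
  qed simp
qed

lemma weil_limit_axes:
  assumes c: "c \<in> Ob S"
  defines "R \<equiv> rg S c"
  shows "weil_limit S c [wD R 2, wD R 2, wD R 2]
    [(0, 2, selmat R [0, 2]), (1, 2, selmat R [0, 2])]
    (wD R 3) [selmat R [0, 1, 2], selmat R [0, 2, 1], selmat R [0, 2, 2]]"
proof -
  interpret base_ring R unfolding R_def by (rule ring_at[OF c])
  have U: "\<exists>!w. w \<in> wvec R' 3 \<and> wapp R' 3 2 (selmat R' [0, 1, 2]) w = v0 \<and>
      wapp R' 3 2 (selmat R' [0, 2, 1]) w = v1 \<and> wapp R' 3 2 (selmat R' [0, 2, 2]) w = v2"
    if R': "base_ring R'" and vs: "v0 \<in> wvec R' 2" "v1 \<in> wvec R' 2" "v2 \<in> wvec R' 2"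
      "wapp R' 2 2 (selmat R' [0, 2]) v0 = v2" "wapp R' 2 2 (selmat R' [0, 2]) v1 = v2" for R' v0 v1 v2
  proof -
    interpret R': base_ring R' by (rule R')
    obtain a x where v0: "v0 = vec [a, x]" and C: "{a, x} \<subseteq> carrier R'"
      using vs(1)[unfolded wvec_cases] by (elim exE conjE)
    obtain b y where v1: "v1 = vec [b, y]" and C1: "{b, y} \<subseteq> carrier R'"
      using vs(2)[unfolded wvec_cases] by (elim exE conjE)
    obtain z w where v2: "v2 = vec [z, w]" and C2: "{z, w} \<subseteq> carrier R'"
      using vs(3)[unfolded wvec_cases] by (elim exE conjE)
    \<comment> \<open>The third vertex stands for the common origin of the axes: both edges into it
      keep the constant term and kill the linear one. So v0 and v1 share their constant term, while
      x and y remain free.\<close>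
    have e: "b = a" "z = a" "w = \<zero>\<^bsub>R'\<^esub>"
      using vs(4,5) C C1 C2 by (auto simp: v0 v1 v2 R'.wapp_selmat restrict_vec)
    show ?thesis
    proof (rule ex1I[of _ "vec [a, x, y]"])
      show "vec [a, x, y] \<in> wvec R' 3 \<and> wapp R' 3 2 (selmat R' [0, 1, 2]) (vec [a, x, y]) = v0 \<and>
          wapp R' 3 2 (selmat R' [0, 2, 1]) (vec [a, x, y]) = v1 \<and>
          wapp R' 3 2 (selmat R' [0, 2, 2]) (vec [a, x, y]) = v2"
        using C C1 by (simp add: v0 v1 v2 e wvec_cases R'.wapp_selmat restrict_vec)
      fix u assume u: "u \<in> wvec R' 3 \<and> wapp R' 3 2 (selmat R' [0, 1, 2]) u = v0 \<and>
          wapp R' 3 2 (selmat R' [0, 2, 1]) u = v1 \<and> wapp R' 3 2 (selmat R' [0, 2, 2]) u = v2"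
      then obtain p q r where "u = vec [p, q, r]" "{p, q, r} \<subseteq> carrier R'"
        unfolding wvec_cases by (elim exE conjE)
      then show "u = vec [a, x, y]"
        using u C C1 by (simp add: v0 v1 v2 e R'.wapp_selmat restrict_vec)
    qed
  qed
  have E: "\<forall>(i, j, h)\<in>set [(0, 2, selmat R [0, 2]), (1, 2, selmat R [0, 2])]. \<forall>w\<in>wvec R 3.
        wapp R (fst ([wD R 2, wD R 2, wD R 2] ! i)) (fst ([wD R 2, wD R 2, wD R 2] ! j)) h
          (wapp R 3 (fst ([wD R 2, wD R 2, wD R 2] ! i)) ([selmat R [0, 1, 2], selmat R [0, 2, 1], selmat R [0, 2, 2]] ! i) w) =
        wapp R 3 (fst ([wD R 2, wD R 2, wD R 2] ! j)) ([selmat R [0, 1, 2], selmat R [0, 2, 1], selmat R [0, 2, 2]] ! j) w"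
    by (auto simp: wvec_cases wapp_selmat restrict_vec)
  show ?thesis
    unfolding weil_limit_def R_def[symmetric] fst_wD
  proof (intro conjI E)
    show "\<forall>V\<in>set [wD R 2, wD R 2, wD R 2]. weil_algebra R V"
      by (simp add: weil_wD2)
    show "\<forall>(i, j, h)\<in>set [(0, 2, selmat R [0, 2]), (1, 2, selmat R [0, 2])]. i < length [wD R 2, wD R 2, wD R 2] \<and> j < length [wD R 2, wD R 2, wD R 2] \<and>
      weil_hom R ([wD R 2, wD R 2, wD R 2] ! i) ([wD R 2, wD R 2, wD R 2] ! j) h"
      using weil_hom_selmat by simp
    show "weil_algebra R (wD R 3)" by (rule weil_wD3)
    show "\<forall>i<length [wD R 2, wD R 2, wD R 2]. weil_hom R (wD R 3) ([wD R 2, wD R 2, wD R 2] ! i)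
        ([selmat R [0, 1, 2], selmat R [0, 2, 1], selmat R [0, 2, 2]] ! i)"
      using weil_hom_selmat by (auto simp: less_Suc_eq numeral_2_eq_2)
    show "\<forall>f\<in>into S c. let R' = rg S (dm S f) in
        \<forall>vs. length vs = length [wD R 2, wD R 2, wD R 2] \<and>
          (\<forall>i<length [wD R 2, wD R 2, wD R 2]. vs ! i \<in> wvec R' (fst ([wD R 2, wD R 2, wD R 2] ! i))) \<and>
          (\<forall>(i, j, h)\<in>set [(0, 2, selmat R [0, 2]), (1, 2, selmat R [0, 2])].
             wapp R' (fst ([wD R 2, wD R 2, wD R 2] ! i)) (fst ([wD R 2, wD R 2, wD R 2] ! j)) (mrs S f h) (vs ! i) = vs ! j) \<longrightarrow>
          (\<exists>!w. w \<in> wvec R' 3 \<and>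
             (\<forall>i<length [wD R 2, wD R 2, wD R 2]. wapp R' 3 (fst ([wD R 2, wD R 2, wD R 2] ! i))
               (mrs S f ([selmat R [0, 1, 2], selmat R [0, 2, 1], selmat R [0, 2, 2]] ! i)) w = vs ! i))"
      (is "\<forall>f\<in>into S c. let R' = rg S (dm S f) in \<forall>vs. ?Q f R' vs \<longrightarrow> ?C f R' vs")
    proof
      fix f assume f: "f \<in> into S c"
      define R' where "R' = rg S (dm S f)"
      have m: "mrs S f (selmat R xs) = selmat R' xs" for xs
        unfolding R_def R'_def by (rule mrs_selmat[OF f])
      have R': "base_ring R'" unfolding R'_def using f by (intro ring_at) simp
      show "let R' = rg S (dm S f) in \<forall>vs. ?Q f R' vs \<longrightarrow> ?C f R' vs"
        unfolding Let_def R'_def[symmetric]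
      proof (intro allI impI)
        fix vs assume H: "?Q f R' vs"
        then obtain v0 v1 v2 where vs: "vs = [v0, v1, v2]" by (auto simp: length_Suc_conv)
        show "?C f R' vs"
          using U[OF R', of v0 v1 v2] H unfolding vs m by (simp add: All_less_Suc m conj_ac)
      qed
    qed
  qed simp
qed

section \<open>Maps out of D, D(2) and D x D as maps out of spectra\<close>

lemma spec_maps_iff: "\<phi> \<in> spec_maps S W X c \<longleftrightarrow> dlam S (weil_spec S W) c \<phi> = \<phi> \<and>
    (\<forall>f\<in>into S c. \<forall>p\<in>weil_spec S W f. \<phi> f p \<in> el X (dm S f) \<and>
      (\<forall>g\<in>into S (dm S f). \<phi> (cmp S f g) (vrs S (fst W) g p) = rs X g (\<phi> f p)))"
  by (simp add: spec_maps_def dmaps_def)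

lemma ball_spec:
  assumes "f \<in> into S c"
  shows "(\<forall>p\<in>weil_spec S (wD (rg S c) 2) f. A p) \<longleftrightarrow>
      (\<forall>d\<in>Dset S (dm S f). A (vec [\<one>\<^bsub>rg S (dm S f)\<^esub>, d]))"
    and "(\<forall>p\<in>weil_spec S (wD (rg S c) 4) f. A p) \<longleftrightarrow>
      (\<forall>d\<in>Dset S (dm S f). \<forall>e\<in>Dset S (dm S f). A (vec [\<one>\<^bsub>rg S (dm S f)\<^esub>, d, e, d \<otimes>\<^bsub>rg S (dm S f)\<^esub> e]))"
  using assms by (auto simp: weil_spec_wD)

lemma vrs_spec:
  assumes "f \<in> into S c" "g \<in> into S (dm S f)" "p \<in> weil_spec S (wD (rg S c) n) f" "n \<in> {2, 3, 4}"
  shows "vrs S n g p \<in> weil_spec S (wD (rg S c) n) (cmp S f g)"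
  using assms by (auto simp: weil_spec_wD vrs_vec Dset_rr0 Dset_carrier)

lemma dlam_spec_maps:
  assumes n: "n \<in> {2, 3, 4}"
    and F: "\<And>f p. \<lbrakk>f \<in> into S c; p \<in> weil_spec S (wD (rg S c) n) f\<rbrakk> \<Longrightarrow> F f p \<in> el X (dm S f)"
    and N: "\<And>f g p. \<lbrakk>f \<in> into S c; g \<in> into S (dm S f); p \<in> weil_spec S (wD (rg S c) n) f\<rbrakk> \<Longrightarrow>
      F (cmp S f g) (vrs S n g p) = rs X g (F f p)"
  shows "dlam S (weil_spec S (wD (rg S c) n)) c F \<in> spec_maps S (wD (rg S c) n) X c"
  unfolding spec_maps_iff fst_wD
proof (intro conjI ballI)
  fix f p assume f: "f \<in> into S c" and p: "p \<in> weil_spec S (wD (rg S c) n) f"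
  show "dlam S (weil_spec S (wD (rg S c) n)) c F f p \<in> el X (dm S f)"
    using F[OF f p] f p by (simp add: dlam_def)
  fix g assume g: "g \<in> into S (dm S f)"
  show "dlam S (weil_spec S (wD (rg S c) n)) c F (cmp S f g) (vrs S n g p) =
      rs X g (dlam S (weil_spec S (wD (rg S c) n)) c F f p)"
    using N[OF f g p] f g p vrs_spec[OF f g p n] by (simp add: dlam_def)
qed (auto simp: dlam_def fun_eq_iff)

lemma microlinearD:
  assumes "microlinear S X" "weil_limit S c Ws es W ps" "c \<in> Ob S" "length \<phi>s = length Ws"
    and "\<forall>i<length Ws. \<phi>s ! i \<in> spec_maps S (Ws ! i) X c"
    and "\<forall>(i, j, h)\<in>set es. \<forall>f\<in>into S c. \<forall>p\<in>weil_spec S (Ws ! j) f.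
      (\<phi>s ! i) f (spec_pull S (fst (Ws ! i)) (fst (Ws ! j)) h f p) = (\<phi>s ! j) f p"
  shows "\<exists>!\<phi>. \<phi> \<in> spec_maps S W X c \<and>
    (\<forall>i<length Ws. \<forall>f\<in>into S c. \<forall>p\<in>weil_spec S (Ws ! i) f.
       \<phi> f (spec_pull S (fst W) (fst (Ws ! i)) (ps ! i) f p) = (\<phi>s ! i) f p)"
  using assms unfolding microlinear_def by blast

lemma spec_wvec: "p \<in> weil_spec S W f \<Longrightarrow> p \<in> wvec (rg S (dm S f)) (fst W)"
  by (simp add: weil_spec_def Let_def)

lemma Dset_mult_zero [simp]:
  assumes "c \<in> Ob S" "d \<in> Dset S c"
  shows "d \<otimes>\<^bsub>rg S c\<^esub> \<zero>\<^bsub>rg S c\<^esub> = \<zero>\<^bsub>rg S c\<^esub>" "\<zero>\<^bsub>rg S c\<^esub> \<otimes>\<^bsub>rg S c\<^esub> d = \<zero>\<^bsub>rg S c\<^esub>"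
proof -
  interpret cring "rg S c" by (rule cring_at[OF assms(1)])
  show "d \<otimes>\<^bsub>rg S c\<^esub> \<zero>\<^bsub>rg S c\<^esub> = \<zero>\<^bsub>rg S c\<^esub>" "\<zero>\<^bsub>rg S c\<^esub> \<otimes>\<^bsub>rg S c\<^esub> d = \<zero>\<^bsub>rg S c\<^esub>"
    using assms by (simp_all add: Dset_carrier)
qed

text \<open>Microlinearity is applied to the cone over \<open>weil_limit_mult\<close> formed by
  \<psi> and the constant map at the value of \<psi> in the origin; compatibility along the three
  edges is the assumption on the axes. The existence part becomes \<open>product_factor\<close>, the
  uniqueness part \<open>product_unique\<close>.\<close>

lemma product_factor_spec:
  assumes X: "microlinear S X" and c: "c \<in> Ob S" and \<psi>: "\<psi> \<in> el (expo S (Dn S 2) X) c"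
    and ax: "\<And>f d. \<lbrakk>f \<in> into S c; d \<in> Dset S (dm S f)\<rbrakk> \<Longrightarrow>
      \<psi> f [d, \<zero>\<^bsub>rg S (dm S f)\<^esub>] = \<psi> f [\<zero>\<^bsub>rg S (dm S f)\<^esub>, \<zero>\<^bsub>rg S (dm S f)\<^esub>] \<and>
      \<psi> f [\<zero>\<^bsub>rg S (dm S f)\<^esub>, d] = \<psi> f [\<zero>\<^bsub>rg S (dm S f)\<^esub>, \<zero>\<^bsub>rg S (dm S f)\<^esub>]"
  shows "\<exists>!\<phi>. \<phi> \<in> spec_maps S (wD (rg S c) 2) X c \<and>
    (\<forall>f\<in>into S c. \<forall>d\<in>Dset S (dm S f). \<forall>e\<in>Dset S (dm S f).
      \<phi> f (vec [\<one>\<^bsub>rg S (dm S f)\<^esub>, d \<otimes>\<^bsub>rg S (dm S f)\<^esub> e]) = \<psi> f [d, e])"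
proof -
  let ?R = "rg S c" and ?z = "\<lambda>f. \<zero>\<^bsub>rg S (dm S f)\<^esub>"
  define \<psi>0 where "\<psi>0 f = \<psi> f [?z f, ?z f]" for f
  have ax: "\<psi> f [d, ?z f] = \<psi>0 f" "\<psi> f [?z f, d] = \<psi>0 f"
    if "f \<in> into S c" "d \<in> Dset S (dm S f)" for f d
    using ax[OF that] by (simp_all add: \<psi>0_def)
  define P where "P = dlam S (weil_spec S (wD ?R 4)) c (\<lambda>f p. \<psi> f [p 1, p 2])"
  define Q where "Q = dlam S (weil_spec S (wD ?R 2)) c (\<lambda>f p. \<psi>0 f)"
  have P: "P f (vec [\<one>\<^bsub>rg S (dm S f)\<^esub>, d, e, x]) = \<psi> f [d, e]"
    if "f \<in> into S c" "d \<in> Dset S (dm S f)" "e \<in> Dset S (dm S f)" "x = d \<otimes>\<^bsub>rg S (dm S f)\<^esub> e" for f d e x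
    using that by (auto simp: P_def dlam_def weil_spec_wD)
  have Q: "Q f (vec [\<one>\<^bsub>rg S (dm S f)\<^esub>, d]) = \<psi>0 f"
    if "f \<in> into S c" "d \<in> Dset S (dm S f)" for f d
    using that by (auto simp: Q_def dlam_def weil_spec_wD)
  have Pm: "P \<in> spec_maps S (wD ?R 4) X c"
    unfolding P_def
  proof (rule dlam_spec_maps)
    fix f g p assume f: "f \<in> into S c" and "p \<in> weil_spec S (wD ?R 4) f"
    then obtain d e where d: "[d, e] \<in> el (Dn S 2) (dm S f)" and
      p: "p = vec [\<one>\<^bsub>rg S (dm S f)\<^esub>, d, e, d \<otimes>\<^bsub>rg S (dm S f)\<^esub> e]"
      by (auto simp: weil_spec_wD)
    show "\<psi> f [p 1, p 2] \<in> el X (dm S f)" using expo_el[OF \<psi> f d] by (simp add: p)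
    assume g: "g \<in> into S (dm S f)"
    show "\<psi> (cmp S f g) [vrs S 4 g p 1, vrs S 4 g p 2] = rs X g (\<psi> f [p 1, p 2])"
      using expo_nat[OF \<psi> f g d] by (simp add: p vrs_vec)
  qed simp
  have Qm: "Q \<in> spec_maps S (wD ?R 2) X c"
    unfolding Q_def
  proof (rule dlam_spec_maps)
    fix f g p assume f: "f \<in> into S c"
    then have d: "[?z f, ?z f] \<in> el (Dn S 2) (dm S f)" by simp
    show "\<psi>0 f \<in> el X (dm S f)" using expo_el[OF \<psi> f d] by (simp add: \<psi>0_def)
    assume g: "g \<in> into S (dm S f)"
    show "\<psi>0 (cmp S f g) = rs X g (\<psi>0 f)"
      using expo_nat[OF \<psi> f g d] f g by (simp add: \<psi>0_def)
  qed simp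
  let ?Ws = "[wD ?R 4, wD ?R 2]"
  let ?ps = "[selmat ?R [0, 3], selmat ?R [0, 2]]"
  have pull: "spec_pull S 4 2 (selmat ?R [0, 1, 2, 2]) f (vec [a, d]) = vec [a, d, ?z f, ?z f]"
    "spec_pull S 4 2 (selmat ?R [0, 2, 1, 2]) f (vec [a, d]) = vec [a, ?z f, d, ?z f]"
    "spec_pull S 4 2 (selmat ?R [0, 2, 2, 2]) f (vec [a, d]) = vec [a, ?z f, ?z f, ?z f]"
    "spec_pull S 2 2 (selmat ?R [0, 2]) f (vec [a, d]) = vec [a, ?z f]"
    if "f \<in> into S c" "vec [a, d] \<in> wvec (rg S (dm S f)) 2" for f a d
    using that by (simp_all add: spec_pull_selmat restrict_vec)
  have pull4: "spec_pull S 2 4 (selmat ?R [0, 3]) f (vec [a, d, e, x]) = vec [a, x]"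
    if "f \<in> into S c" "vec [a, d, e, x] \<in> wvec (rg S (dm S f)) 4" for f a d e x
    using that by (simp add: spec_pull_selmat restrict_vec)
  have w2: "vec [\<one>\<^bsub>rg S (dm S f)\<^esub>, d] \<in> wvec (rg S (dm S f)) 2"
    if "f \<in> into S c" "d \<in> Dset S (dm S f)" for f d
    using that spec_wvec[of _ "wD ?R 2" f] by (auto simp: weil_spec_wD)
  have w4: "vec [\<one>\<^bsub>rg S (dm S f)\<^esub>, d, e, d \<otimes>\<^bsub>rg S (dm S f)\<^esub> e] \<in> wvec (rg S (dm S f)) 4"
    if "f \<in> into S c" "d \<in> Dset S (dm S f)" "e \<in> Dset S (dm S f)" for f d e
    using that spec_wvec[of _ "wD ?R 4" f] by (auto simp: weil_spec_wD)
  have "\<exists>!\<phi>. \<phi> \<in> spec_maps S (wD ?R 2) X c \<and> (\<forall>i<length ?Ws. \<forall>f\<in>into S c. \<forall>p\<in>weil_spec S (?Ws ! i) f.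
       \<phi> f (spec_pull S (fst (wD ?R 2)) (fst (?Ws ! i)) (?ps ! i) f p) = ([P, Q] ! i) f p)"
    by (rule microlinearD[OF X weil_limit_mult[OF c] c])
      (use Pm Qm in \<open>auto simp: All_less_Suc weil_spec_wD pull[unfolded One_nat_def] w2 P Q ax\<close>)
  \<comment> \<open>The condition at the second vertex only fixes \<phi> at 0, and this is the case
    d = e = 0 of the condition at the first vertex.\<close>
  moreover have "(\<forall>i<length ?Ws. \<forall>f\<in>into S c. \<forall>p\<in>weil_spec S (?Ws ! i) f.
       \<phi> f (spec_pull S (fst (wD ?R 2)) (fst (?Ws ! i)) (?ps ! i) f p) = ([P, Q] ! i) f p) \<longleftrightarrow>
    (\<forall>f\<in>into S c. \<forall>d\<in>Dset S (dm S f). \<forall>e\<in>Dset S (dm S f).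
      \<phi> f (vec [\<one>\<^bsub>rg S (dm S f)\<^esub>, d \<otimes>\<^bsub>rg S (dm S f)\<^esub> e]) = \<psi> f [d, e])" (is "?l \<longleftrightarrow> ?r") for \<phi>
  proof -
    have "?l \<longleftrightarrow> ?r \<and> (\<forall>f\<in>into S c. \<forall>d\<in>Dset S (dm S f).
        \<phi> f (vec [\<one>\<^bsub>rg S (dm S f)\<^esub>, ?z f]) = \<psi>0 f)"
      by (auto simp: All_less_Suc ball_spec pull pull4 w2 w4 P Q)
    moreover have "\<phi> f (vec [\<one>\<^bsub>rg S (dm S f)\<^esub>, ?z f]) = \<psi>0 f"
      if ?r "f \<in> into S c" for f
      using bspec[OF bspec[OF bspec[OF that], of "?z f"], of "?z f"] that(2) by (simp add: \<psi>0_def)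
    ultimately show ?thesis by blast
  qed
  ultimately show ?thesis by simp
qed

lemma ex1_conj_eq: "\<lbrakk>\<exists>!x. P x \<and> Q x; P a; Q a; P b; Q b\<rbrakk> \<Longrightarrow> a = b"
  by blast

lemma dlam_spec2_expo:
  assumes "t \<in> el (expo S (Dn S 1) X) c"
  shows "dlam S (weil_spec S (wD (rg S c) 2)) c (\<lambda>f p. t f [p 1]) \<in> spec_maps S (wD (rg S c) 2) X c"
proof (rule dlam_spec_maps)
  fix f g p assume f: "f \<in> into S c" and "p \<in> weil_spec S (wD (rg S c) 2) f"
  then obtain d where d: "[d] \<in> el (Dn S 1) (dm S f)" and p: "p = vec [\<one>\<^bsub>rg S (dm S f)\<^esub>, d]"
    by (auto simp: weil_spec_wD)
  show "t f [p 1] \<in> el X (dm S f)" using expo_el[OF assms f d] by (simp add: p)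
  assume g: "g \<in> into S (dm S f)"
  show "t (cmp S f g) [vrs S 2 g p 1] = rs X g (t f [p 1])"
    using expo_nat[OF assms f g d] by (simp add: p vrs_vec)
qed simp

lemma product_factor:
  assumes X: "microlinear S X" and c: "c \<in> Ob S" and \<psi>: "\<psi> \<in> el (expo S (Dn S 2) X) c"
    and ax: "\<And>f d. \<lbrakk>f \<in> into S c; d \<in> Dset S (dm S f)\<rbrakk> \<Longrightarrow>
      \<psi> f [d, \<zero>\<^bsub>rg S (dm S f)\<^esub>] = \<psi> f [\<zero>\<^bsub>rg S (dm S f)\<^esub>, \<zero>\<^bsub>rg S (dm S f)\<^esub>] \<and>
      \<psi> f [\<zero>\<^bsub>rg S (dm S f)\<^esub>, d] = \<psi> f [\<zero>\<^bsub>rg S (dm S f)\<^esub>, \<zero>\<^bsub>rg S (dm S f)\<^esub>]"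
  obtains t where "t \<in> el (expo S (Dn S 1) X) c"
    and "\<And>f d e. \<lbrakk>f \<in> into S c; d \<in> Dset S (dm S f); e \<in> Dset S (dm S f)\<rbrakk> \<Longrightarrow>
      t f [d \<otimes>\<^bsub>rg S (dm S f)\<^esub> e] = \<psi> f [d, e]"
proof -
  obtain \<phi> where \<phi>: "\<phi> \<in> spec_maps S (wD (rg S c) 2) X c" "\<forall>f\<in>into S c. \<forall>d\<in>Dset S (dm S f).
      \<forall>e\<in>Dset S (dm S f). \<phi> f (vec [\<one>\<^bsub>rg S (dm S f)\<^esub>, d \<otimes>\<^bsub>rg S (dm S f)\<^esub> e]) = \<psi> f [d, e]"
    using product_factor_spec[OF assms] by blast
  let ?t = "ilam S (Dn S 1) c (\<lambda>f ds. \<phi> f (vec [\<one>\<^bsub>rg S (dm S f)\<^esub>, ds ! 0]))"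
  have "\<phi> f (vec [\<one>\<^bsub>rg S (dm S f)\<^esub>, d]) \<in> el X (dm S f)" if "f \<in> into S c" "d \<in> Dset S (dm S f)" for f d
    using \<phi>(1) that by (auto simp: spec_maps_iff weil_spec_wD)
  moreover have "\<phi> (cmp S f g) (vec [\<one>\<^bsub>rg S (dm S g)\<^esub>, rr S g d]) = rs X g (\<phi> f (vec [\<one>\<^bsub>rg S (dm S f)\<^esub>, d]))"
    if "f \<in> into S c" "d \<in> Dset S (dm S f)" "g \<in> into S (dm S f)" for f d g
  proof -
    have "vec [\<one>\<^bsub>rg S (dm S f)\<^esub>, d] \<in> weil_spec S (wD (rg S c) 2) f"
      using that by (auto simp: weil_spec_wD)
    then have "\<phi> (cmp S f g) (vrs S 2 g (vec [\<one>\<^bsub>rg S (dm S f)\<^esub>, d])) = rs X g (\<phi> f (vec [\<one>\<^bsub>rg S (dm S f)\<^esub>, d]))"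
      using \<phi>(1) that by (simp add: spec_maps_iff)
    then show ?thesis using that by (simp add: vrs_vec)
  qed
  ultimately have "?t \<in> el (expo S (Dn S 1) X) c"
    by (intro ilam_expo) auto
  moreover have "?t f [d \<otimes>\<^bsub>rg S (dm S f)\<^esub> e] = \<psi> f [d, e]"
    if "f \<in> into S c" "d \<in> Dset S (dm S f)" "e \<in> Dset S (dm S f)" for f d e
    using \<phi>(2) that by (simp add: Dset_carrier)
  ultimately show ?thesis using that by blast
qed

text \<open>The map (d, e) |-> t(d e) is constant on the axes, and both t and t' factor it through
  the multiplication. This replaces the pointwise argument that would require every element of D to
  be a product.\<close>

lemma product_unique:
  assumes X: "microlinear S X" and c: "c \<in> Ob S"
    and t: "t \<in> el (expo S (Dn S 1) X) c" "t' \<in> el (expo S (Dn S 1) X) c"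
    and eq: "\<And>f d e. \<lbrakk>f \<in> into S c; d \<in> Dset S (dm S f); e \<in> Dset S (dm S f)\<rbrakk> \<Longrightarrow>
      t f [d \<otimes>\<^bsub>rg S (dm S f)\<^esub> e] = t' f [d \<otimes>\<^bsub>rg S (dm S f)\<^esub> e]"
  shows "t = t'"
proof (rule expo_ext[OF t])
  fix f x assume f: "f \<in> into S c" and "x \<in> el (Dn S 1) (dm S f)"
  then obtain d where d: "x = [d]" "d \<in> Dset S (dm S f)" by auto
  let ?\<psi> = "ilam S (Dn S 2) c (\<lambda>f ds. t f [ds ! 0 \<otimes>\<^bsub>rg S (dm S f)\<^esub> ds ! 1])"
  have \<psi>: "?\<psi> \<in> el (expo S (Dn S 2) X) c"
  proof (rule ilam_expo[OF Dn_psh])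
    fix f x g assume f: "f \<in> into S c" and "x \<in> el (Dn S 2) (dm S f)"
    then obtain d e where x: "x = [d, e]" and d: "d \<in> Dset S (dm S f)" "e \<in> Dset S (dm S f)" by auto
    then have m: "[d \<otimes>\<^bsub>rg S (dm S f)\<^esub> e] \<in> el (Dn S 1) (dm S f)" using f by (simp add: Dset_carrier)
    show "t f [x ! 0 \<otimes>\<^bsub>rg S (dm S f)\<^esub> x ! 1] \<in> el X (dm S f)"
      using expo_el[OF t(1) f m] by (simp add: x)
    assume g: "g \<in> into S (dm S f)"
    show "t (cmp S f g) [rs (Dn S 2) g x ! 0 \<otimes>\<^bsub>rg S (dm S (cmp S f g))\<^esub> rs (Dn S 2) g x ! 1] =
        rs X g (t f [x ! 0 \<otimes>\<^bsub>rg S (dm S f)\<^esub> x ! 1])"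
      using expo_nat[OF t(1) f g m] f g d by (simp add: x Dset_carrier)
  qed
  let ?T = "\<lambda>t :: 'a \<Rightarrow> 'r list \<Rightarrow> _. dlam S (weil_spec S (wD (rg S c) 2)) c (\<lambda>f p. t f [p 1])"
  have "\<exists>!\<phi>. \<phi> \<in> spec_maps S (wD (rg S c) 2) X c \<and>
    (\<forall>f\<in>into S c. \<forall>d\<in>Dset S (dm S f). \<forall>e\<in>Dset S (dm S f).
      \<phi> f (vec [\<one>\<^bsub>rg S (dm S f)\<^esub>, d \<otimes>\<^bsub>rg S (dm S f)\<^esub> e]) = ?\<psi> f [d, e])"
    by (rule product_factor_spec[OF X c \<psi>]) simp
  note u = ex1_conj_eq[OF this]
  have m: "\<forall>f\<in>into S c. \<forall>d\<in>Dset S (dm S f). \<forall>e\<in>Dset S (dm S f).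
      ?T m f (vec [\<one>\<^bsub>rg S (dm S f)\<^esub>, d \<otimes>\<^bsub>rg S (dm S f)\<^esub> e]) = ?\<psi> f [d, e]" if "m = t \<or> m = t'" for m
    using that by (auto simp: dlam_def weil_spec_wD Dset_carrier eq)
  have "?T t = ?T t'"
    by (rule u[OF dlam_spec2_expo[OF t(1)] m dlam_spec2_expo[OF t(2)] m]) simp_all
  then have "?T t f (vec [\<one>\<^bsub>rg S (dm S f)\<^esub>, d]) = ?T t' f (vec [\<one>\<^bsub>rg S (dm S f)\<^esub>, d])" by simp
  then show "t f x = t' f x"
    using f d by (auto simp: dlam_def weil_spec_wD)
qed

text \<open>Both maps solve the factorisation problem of \<open>weil_limit_axes\<close> for the cone
  formed by the restrictions of l, since l' has the same restrictions. The pairs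
  \<open>(e, [d])\<close> follow the encoding of \<open>D2n\<close>, so that the result applies to
  \<open>sum_map\<close>.\<close>

lemma axes_unique:
  assumes X: "microlinear S X" and c: "c \<in> Ob S"
    and l: "l \<in> el (expo S (D2n S 1 0) X) c" "l' \<in> el (expo S (D2n S 1 0) X) c"
    and eq: "\<And>f d. \<lbrakk>f \<in> into S c; d \<in> Dset S (dm S f)\<rbrakk> \<Longrightarrow>
      l f (\<zero>\<^bsub>rg S (dm S f)\<^esub>, [d]) = l' f (\<zero>\<^bsub>rg S (dm S f)\<^esub>, [d]) \<and>
      l f (d, [\<zero>\<^bsub>rg S (dm S f)\<^esub>]) = l' f (d, [\<zero>\<^bsub>rg S (dm S f)\<^esub>])"
  shows "l = l'"
proof (rule expo_ext[OF l])
  fix f x assume f: "f \<in> into S c" and "x \<in> el (D2n S 1 0) (dm S f)"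
  then obtain d e where d: "x = (e, [d])" "d \<in> Dset S (dm S f)" "e \<in> Dset S (dm S f)"
    "d \<otimes>\<^bsub>rg S (dm S f)\<^esub> e = \<zero>\<^bsub>rg S (dm S f)\<^esub>" by auto
  let ?R = "rg S c" and ?z = "\<lambda>f. \<zero>\<^bsub>rg S (dm S f)\<^esub>"
  let ?T = "\<lambda>l :: 'a \<Rightarrow> 'r \<times> 'r list \<Rightarrow> _. dlam S (weil_spec S (wD ?R 3)) c (\<lambda>f p. l f (p 2, [p 1]))"
  let ?P = "dlam S (weil_spec S (wD ?R 2)) c (\<lambda>f p. l f (?z f, [p 1]))"
  let ?Q = "dlam S (weil_spec S (wD ?R 2)) c (\<lambda>f p. l f (p 1, [?z f]))"
  let ?C = "dlam S (weil_spec S (wD ?R 2)) c (\<lambda>f p. l f (?z f, [?z f]))"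
  have T: "?T l \<in> spec_maps S (wD ?R 3) X c" if l: "l \<in> el (expo S (D2n S 1 0) X) c" for l
  proof (rule dlam_spec_maps)
    fix f g p assume f: "f \<in> into S c" and "p \<in> weil_spec S (wD ?R 3) f"
    then obtain d e where d: "(e, [d]) \<in> el (D2n S 1 0) (dm S f)" and p: "p = vec [\<one>\<^bsub>rg S (dm S f)\<^esub>, d, e]"
      by (auto simp: weil_spec_wD)
    show "l f (p 2, [p 1]) \<in> el X (dm S f)" using expo_el[OF l f d] by (simp add: p)
    assume g: "g \<in> into S (dm S f)"
    show "l (cmp S f g) (vrs S 3 g p 2, [vrs S 3 g p 1]) = rs X g (l f (p 2, [p 1]))"
      using expo_nat[OF l f g d] by (simp add: p vrs_vec)
  qed simp
  \<comment> \<open>One argument for the three legs of the cone: q selects the first axis, the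
    second axis or the origin.\<close>
  have PQ: "dlam S (weil_spec S (wD ?R 2)) c (\<lambda>f p. l f (q f p)) \<in> spec_maps S (wD ?R 2) X c"
    if q: "(\<forall>f p. q f p = (?z f, [p 1])) \<or> (\<forall>f p. q f p = (p 1, [?z f])) \<or> (\<forall>f p. q f p = (?z f, [?z f]))" for q
  proof (rule dlam_spec_maps)
    fix f g p assume f: "f \<in> into S c" and "p \<in> weil_spec S (wD ?R 2) f"
    then obtain d where d: "d \<in> Dset S (dm S f)" and p: "p = vec [\<one>\<^bsub>rg S (dm S f)\<^esub>, d]"
      by (auto simp: weil_spec_wD)
    then have m: "q f p \<in> el (D2n S 1 0) (dm S f)" using q f by auto
    show "l f (q f p) \<in> el X (dm S f)" using expo_el[OF l(1) f m] .
    assume g: "g \<in> into S (dm S f)"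
    then have "q (cmp S f g) (vrs S 2 g p) = rs (D2n S 1 0) g (q f p)"
      using q f by (auto simp: p vrs_vec)
    then show "l (cmp S f g) (q (cmp S f g) (vrs S 2 g p)) = rs X g (l f (q f p))"
      using expo_nat[OF l(1) f g m] by simp
  qed simp
  have PQ: "?P \<in> spec_maps S (wD ?R 2) X c" "?Q \<in> spec_maps S (wD ?R 2) X c"
      "?C \<in> spec_maps S (wD ?R 2) X c"
    by (rule PQ, simp)+
  have w2: "vec [\<one>\<^bsub>rg S (dm S f)\<^esub>, d] \<in> wvec (rg S (dm S f)) 2"
    if "f \<in> into S c" "d \<in> Dset S (dm S f)" for f d
    using that spec_wvec[of _ "wD ?R 2" f] by (auto simp: weil_spec_wD)
  let ?Ws = "[wD ?R 2, wD ?R 2, wD ?R 2]"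
  let ?ps = "[selmat ?R [0, 1, 2], selmat ?R [0, 2, 1], selmat ?R [0, 2, 2]]"
  have pull: "spec_pull S 3 2 (selmat ?R [0, 1, 2]) f (vec [a, d]) = vec [a, d, ?z f]"
    "spec_pull S 3 2 (selmat ?R [0, 2, 1]) f (vec [a, d]) = vec [a, ?z f, d]"
    "spec_pull S 3 2 (selmat ?R [0, 2, 2]) f (vec [a, d]) = vec [a, ?z f, ?z f]"
    "spec_pull S 2 2 (selmat ?R [0, 2]) f (vec [a, d]) = vec [a, ?z f]"
    if "f \<in> into S c" "vec [a, d] \<in> wvec (rg S (dm S f)) 2" for f a d
    using that by (simp_all add: spec_pull_selmat restrict_vec)
  have "\<exists>!\<phi>. \<phi> \<in> spec_maps S (wD ?R 3) X c \<and> (\<forall>i<length ?Ws. \<forall>f\<in>into S c. \<forall>p\<in>weil_spec S (?Ws ! i) f.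
       \<phi> f (spec_pull S (fst (wD ?R 3)) (fst (?Ws ! i)) (?ps ! i) f p) = ([?P, ?Q, ?C] ! i) f p)"
    by (rule microlinearD[OF X weil_limit_axes[OF c] c])
      (use PQ in \<open>auto simp: All_less_Suc weil_spec_wD pull[unfolded One_nat_def] w2 dlam_def\<close>)
  note u = ex1_conj_eq[OF this]
  have m: "\<forall>i<length ?Ws. \<forall>f\<in>into S c. \<forall>p\<in>weil_spec S (?Ws ! i) f.
       ?T m f (spec_pull S (fst (wD ?R 3)) (fst (?Ws ! i)) (?ps ! i) f p) = ([?P, ?Q, ?C] ! i) f p"
    if "m = l \<or> m = l'" for m
    using that by (auto simp: All_less_Suc weil_spec_wD pull[unfolded One_nat_def] w2 dlam_def eq)
  have "?T l = ?T l'"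
    by (rule u[OF T[OF l(1)] m T[OF l(2)] m]) simp_all
  then have "?T l f (vec [\<one>\<^bsub>rg S (dm S f)\<^esub>, d, e]) = ?T l' f (vec [\<one>\<^bsub>rg S (dm S f)\<^esub>, d, e])" by simp
  then show "l f x = l' f x"
    using f d by (auto simp: dlam_def weil_spec_wD)
qed

end

section \<open>Groupoids and group bundles\<close>

declare One_nat_def [simp del]

lemma nth_1 [simp]: "(x # y # zs) ! 1 = y"
  by (simp add: One_nat_def)

lemma replicate_1_2 [simp]: "replicate 1 x = [x]" "replicate 2 x = [x, x]"
  by (simp_all add: One_nat_def numeral_2_eq_2)

locale grpd_obj = line_obj S
  for S :: "('o, 'a, 'r) line" +
  fixes M :: "('o, 'a, 'p) psh" and G :: "('o, 'a, 'p, 'g) grpd"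
  assumes grpd: "groupoid S M G"
begin

lemma M_psh: "presheaf S M" and G_psh: "presheaf S G"
  using grpd by (simp_all add: groupoid_def)

lemma grpd_at:
  assumes "c \<in> Ob S" "g \<in> el G c"
  shows src_el: "src G c g \<in> el M c" and tgt_el: "tgt G c g \<in> el M c"
    and mul_unt: "mul G c g (unt G c (src G c g)) = g" "mul G c (unt G c (tgt G c g)) g = g"
    and inv_ex: "\<exists>h\<in>el G c. src G c h = tgt G c g \<and> tgt G c h = src G c g \<and>
      mul G c g h = unt G c (tgt G c g) \<and> mul G c h g = unt G c (src G c g)"
  using assms grpd by (simp_all add: groupoid_def)

lemma unt_at [simp]:
  assumes "c \<in> Ob S" "x \<in> el M c"
  shows "unt G c x \<in> el G c" "src G c (unt G c x) = x" "tgt G c (unt G c x) = x"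
  using assms grpd by (simp_all add: groupoid_def)

lemma mul_at:
  assumes "c \<in> Ob S" "g \<in> el G c" "h \<in> el G c" "src G c g = tgt G c h"
  shows mul_el: "mul G c g h \<in> el G c" and src_mul: "src G c (mul G c g h) = src G c h"
    and tgt_mul: "tgt G c (mul G c g h) = tgt G c g"
  using assms grpd by (simp_all add: groupoid_def)

lemma mul_assoc:
  assumes "c \<in> Ob S" "g \<in> el G c" "h \<in> el G c" "k \<in> el G c" "src G c g = tgt G c h" "src G c h = tgt G c k"
  shows "mul G c (mul G c g h) k = mul G c g (mul G c h k)"
  using assms grpd by (simp add: groupoid_def)

lemma rs_grpd:
  assumes "f \<in> into S c" "g \<in> el G c"
  shows src_rs: "src G (dm S f) (rs G f g) = rs M f (src G c g)"
    and tgt_rs: "tgt G (dm S f) (rs G f g) = rs M f (tgt G c g)"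
    and mul_rs: "\<lbrakk>h \<in> el G c; src G c g = tgt G c h\<rbrakk> \<Longrightarrow>
      rs G f (mul G c g h) = mul G (dm S f) (rs G f g) (rs G f h)"
  using assms grpd unfolding groupoid_def into_iff by blast+

lemma unt_rs: "\<lbrakk>f \<in> into S c; x \<in> el M c\<rbrakk> \<Longrightarrow> rs G f (unt G c x) = unt G (dm S f) (rs M f x)"
  using grpd unfolding groupoid_def into_iff by blast

lemma rs_G: "\<lbrakk>f \<in> into S c; g \<in> el G c\<rbrakk> \<Longrightarrow> rs G f g \<in> el G (dm S f)"
  by (rule psh_el[OF G_psh])

lemma rs_M: "\<lbrakk>f \<in> into S c; x \<in> el M c\<rbrakk> \<Longrightarrow> rs M f x \<in> el M (dm S f)"
  by (rule psh_el[OF M_psh])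

lemma ginv_eqI:
  assumes "c \<in> Ob S" "g \<in> el G c" "h \<in> el G c" "src G c h = tgt G c g" "tgt G c h = src G c g"
    "mul G c g h = unt G c (tgt G c g)" "mul G c h g = unt G c (src G c g)"
  shows "ginv G c g = h"
  unfolding ginv_def
proof (rule the_equality)
  fix k assume k: "k \<in> el G c \<and> src G c k = tgt G c g \<and> tgt G c k = src G c g \<and>
     mul G c g k = unt G c (tgt G c g) \<and> mul G c k g = unt G c (src G c g)"
  have "k = mul G c (mul G c h g) k" using k assms mul_unt(2)[of c k] by simp
  also have "\<dots> = mul G c h (mul G c g k)" using k assms by (intro mul_assoc) auto
  also have "\<dots> = h" using k assms mul_unt(1)[of c h] by simp
  finally show "k = h" .
qed (use assms in simp)

lemma ginv_at:
  assumes "c \<in> Ob S" "g \<in> el G c"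
  shows ginv_el: "ginv G c g \<in> el G c" and src_ginv: "src G c (ginv G c g) = tgt G c g"
    and tgt_ginv: "tgt G c (ginv G c g) = src G c g"
    and mul_ginv: "mul G c g (ginv G c g) = unt G c (tgt G c g)"
    and ginv_mul: "mul G c (ginv G c g) g = unt G c (src G c g)"
proof -
  obtain h where h: "h \<in> el G c" "src G c h = tgt G c g" "tgt G c h = src G c g"
     "mul G c g h = unt G c (tgt G c g)" "mul G c h g = unt G c (src G c g)"
    using inv_ex[OF assms] by blast
  with ginv_eqI[OF assms h] show "ginv G c g \<in> el G c" "src G c (ginv G c g) = tgt G c g"
    "tgt G c (ginv G c g) = src G c g" "mul G c g (ginv G c g) = unt G c (tgt G c g)"
    "mul G c (ginv G c g) g = unt G c (src G c g)" by simp_all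
qed

lemma ginv_rs:
  assumes "f \<in> into S c" "g \<in> el G c"
  shows "rs G f (ginv G c g) = ginv G (dm S f) (rs G f g)"
proof -
  have c: "c \<in> Ob S" using assms by simp
  note i = ginv_at[OF c assms(2)]
  show ?thesis
    by (rule sym, rule ginv_eqI)
      (use assms i in \<open>simp_all add: rs_G src_rs tgt_rs src_el tgt_el flip: mul_rs unt_rs\<close>)
qed

lemma ginv_unt [simp]:
  assumes "c \<in> Ob S" "x \<in> el M c"
  shows "ginv G c (unt G c x) = unt G c x"
  using assms mul_unt[of c "unt G c x"] by (intro ginv_eqI) simp_all

lemma An_iff: "\<gamma> \<in> el (An S M G n) c \<longleftrightarrow> \<gamma> \<in> el (expo S (Dn S n) G) c \<and>
    \<gamma> (idt S c) (replicate n \<zero>\<^bsub>rg S c\<^esub>) = unt G c (bpt S G n c \<gamma>) \<and>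
    (\<forall>f\<in>into S c. \<forall>ds\<in>el (Dn S n) (dm S f). src G (dm S f) (\<gamma> f ds) = rs M f (bpt S G n c \<gamma>))"
  by (simp add: An_def)

lemma rs_An [simp]: "rs (An S M G n) f = rsf S (Dn S n) f"
  by (simp add: An_def)

lemma An_expo: "\<gamma> \<in> el (An S M G n) c \<Longrightarrow> \<gamma> \<in> el (expo S (Dn S n) G) c"
  by (simp add: An_iff)

lemma An_el: "\<lbrakk>\<gamma> \<in> el (An S M G n) c; f \<in> into S c; ds \<in> el (Dn S n) (dm S f)\<rbrakk> \<Longrightarrow> \<gamma> f ds \<in> el G (dm S f)"
  by (rule expo_el[OF An_expo])

lemma An_nat: "\<lbrakk>\<gamma> \<in> el (An S M G n) c; f \<in> into S c; g \<in> into S (dm S f); ds \<in> el (Dn S n) (dm S f)\<rbrakk> \<Longrightarrow>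
    \<gamma> (cmp S f g) (map (rr S g) ds) = rs G g (\<gamma> f ds)"
  using expo_nat[OF An_expo, of \<gamma> n c f g ds] by simp

lemma An_src: "\<lbrakk>\<gamma> \<in> el (An S M G n) c; f \<in> into S c; ds \<in> el (Dn S n) (dm S f)\<rbrakk> \<Longrightarrow>
    src G (dm S f) (\<gamma> f ds) = rs M f (bpt S G n c \<gamma>)"
  by (simp add: An_iff)

lemma zeros_Dn [simp]: "c \<in> Ob S \<Longrightarrow> replicate n \<zero>\<^bsub>rg S c\<^esub> \<in> el (Dn S n) c"
  by (auto simp: Dn_def)

lemma bpt_el: "\<lbrakk>c \<in> Ob S; \<gamma> \<in> el (An S M G n) c\<rbrakk> \<Longrightarrow> bpt S G n c \<gamma> \<in> el M c"
  using An_el[of \<gamma> n c "idt S c" "replicate n \<zero>\<^bsub>rg S c\<^esub>"] by (simp add: bpt_def src_el)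

text \<open>Membership in \<open>An\<close> prescribes the value at the origin at the present stage
  only; naturality carries it to all later stages.\<close>

lemma An_zero:
  assumes \<gamma>: "\<gamma> \<in> el (An S M G n) c" and f: "f \<in> into S c"
  shows "\<gamma> f (replicate n \<zero>\<^bsub>rg S (dm S f)\<^esub>) = unt G (dm S f) (rs M f (bpt S G n c \<gamma>))"
proof -
  have c: "c \<in> Ob S" using f by simp
  have "\<gamma> (cmp S (idt S c) f) (map (rr S f) (replicate n \<zero>\<^bsub>rg S c\<^esub>)) = rs G f (unt G c (bpt S G n c \<gamma>))"
    using An_nat[OF \<gamma>, of "idt S c" f "replicate n \<zero>\<^bsub>rg S c\<^esub>"] \<gamma> c f by (simp add: An_iff)
  then show ?thesis using f c by (simp add: unt_rs bpt_el[OF c \<gamma>])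
qed

lemma An_I:
  assumes c: "c \<in> Ob S" and x: "x \<in> el M c"
    and F: "\<And>f ds. \<lbrakk>f \<in> into S c; ds \<in> el (Dn S n) (dm S f)\<rbrakk> \<Longrightarrow> F f ds \<in> el G (dm S f) \<and>
      src G (dm S f) (F f ds) = rs M f x"
    and N: "\<And>f ds g. \<lbrakk>f \<in> into S c; ds \<in> el (Dn S n) (dm S f); g \<in> into S (dm S f)\<rbrakk> \<Longrightarrow>
      F (cmp S f g) (map (rr S g) ds) = rs G g (F f ds)"
    and Z: "F (idt S c) (replicate n \<zero>\<^bsub>rg S c\<^esub>) = unt G c x"
  shows "ilam S (Dn S n) c F \<in> el (An S M G n) c \<and> bpt S G n c (ilam S (Dn S n) c F) = x"
proof -
  have Z': "ilam S (Dn S n) c F (idt S c) (replicate n \<zero>\<^bsub>rg S c\<^esub>) = unt G c x"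
    using Z c by simp
  then have b: "bpt S G n c (ilam S (Dn S n) c F) = x" unfolding bpt_def using c x by simp
  have "ilam S (Dn S n) c F \<in> el (expo S (Dn S n) G) c"
    using F N by (intro ilam_expo) auto
  then show ?thesis
    unfolding An_iff b using Z' F by simp
qed

lemma rsf_An:
  assumes \<gamma>: "\<gamma> \<in> el (An S M G n) c" and f: "f \<in> into S c"
  shows "rsf S (Dn S n) f \<gamma> \<in> el (An S M G n) (dm S f)"
    and "bpt S G n (dm S f) (rsf S (Dn S n) f \<gamma>) = rs M f (bpt S G n c \<gamma>)"
proof -
  have c: "c \<in> Ob S" using f by simp
  have x: "bpt S G n c \<gamma> \<in> el M c" by (rule bpt_el[OF c \<gamma>])
  have "ilam S (Dn S n) (dm S f) (\<lambda>g. \<gamma> (cmp S f g)) \<in> el (An S M G n) (dm S f) \<and>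
    bpt S G n (dm S f) (ilam S (Dn S n) (dm S f) (\<lambda>g. \<gamma> (cmp S f g))) = rs M f (bpt S G n c \<gamma>)"
  proof (rule An_I)
    show "dm S f \<in> Ob S" using f by simp
    show "rs M f (bpt S G n c \<gamma>) \<in> el M (dm S f)" by (rule rs_M[OF f x])
    show "\<gamma> (cmp S f (idt S (dm S f))) (replicate n \<zero>\<^bsub>rg S (dm S f)\<^esub>) = unt G (dm S f) (rs M f (bpt S G n c \<gamma>))"
      using An_zero[OF \<gamma> f] f by simp
    fix g ds assume g: "g \<in> into S (dm S f)" and ds: "ds \<in> el (Dn S n) (dm S g)"
    show "\<gamma> (cmp S f g) ds \<in> el G (dm S g) \<and> src G (dm S g) (\<gamma> (cmp S f g) ds) = rs M g (rs M f (bpt S G n c \<gamma>))"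
      using An_el[OF \<gamma>, of "cmp S f g" ds] An_src[OF \<gamma>, of "cmp S f g" ds] f g ds
      by (simp add: psh_cmp[OF M_psh f g x])
    fix h assume h: "h \<in> into S (dm S g)"
    show "\<gamma> (cmp S f (cmp S g h)) (map (rr S h) ds) = rs G h (\<gamma> (cmp S f g) ds)"
      using An_nat[OF \<gamma>, of "cmp S f g" h ds] f g h ds by (simp add: cmp_assoc[OF f g h])
  qed
  then show "rsf S (Dn S n) f \<gamma> \<in> el (An S M G n) (dm S f)"
    "bpt S G n (dm S f) (rsf S (Dn S n) f \<gamma>) = rs M f (bpt S G n c \<gamma>)"
    by (simp_all add: rsf_def)
qed

lemma An_psh: "presheaf S (An S M G n)"
  unfolding presheaf_def
proof (intro conjI ballI)
  fix f \<gamma> assume "f \<in> Ar S" "\<gamma> \<in> el (An S M G n) (cd S f)"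
  then show "rs (An S M G n) f \<gamma> \<in> el (An S M G n) (dm S f)"
    using rsf_An(1)[of \<gamma> n "cd S f" f] by (simp add: into_iff)
next
  fix c \<gamma> assume "c \<in> Ob S" "\<gamma> \<in> el (An S M G n) c"
  then show "rs (An S M G n) (idt S c) \<gamma> = \<gamma>" using rsf_idt[OF An_expo] by simp
next
  fix f g \<gamma> assume "f \<in> Ar S" "g \<in> into S (dm S f)" "\<gamma> \<in> el (An S M G n) (cd S f)"
  then show "rs (An S M G n) (cmp S f g) \<gamma> = rs (An S M G n) g (rs (An S M G n) f \<gamma>)"
    using rsf_cmp[of f "cd S f" g] by (simp add: into_iff)
qed

lemma An_ext:
  assumes "s \<in> el (An S M G n) c" "t \<in> el (An S M G n) c"
    and "\<And>f ds. \<lbrakk>f \<in> into S c; ds \<in> el (Dn S n) (dm S f)\<rbrakk> \<Longrightarrow> s f ds = t f ds"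
  shows "s = t"
  using assms by (blast intro: expo_ext[OF An_expo An_expo])

end

section \<open>Fibres of a group bundle as groups, and their tangents at the unit\<close>

locale gbundle = grpd_obj S M L
  for S :: "('o, 'a, 'r) line" and M :: "('o, 'a, 'p) psh" and L :: "('o, 'a, 'p, 'l) grpd" +
  assumes src_tgt: "\<And>c g. \<lbrakk>c \<in> Ob S; g \<in> el L c\<rbrakk> \<Longrightarrow> tgt L c g = src L c g"
    and ml: "microlinear S L"
begin

text \<open>The fibre over x at one stage as a group in the sense of HOL-Algebra, in which products
  of values of tangents are computed.\<close>

definition fgrp :: "'o \<Rightarrow> 'p \<Rightarrow> 'l monoid" where
  "fgrp c x = \<lparr>carrier = {g \<in> el L c. src L c g = x}, monoid.mult = mul L c, one = unt L c x\<rparr>"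

lemma fgrp_simps [simp]:
  "g \<in> carrier (fgrp c x) \<longleftrightarrow> g \<in> el L c \<and> src L c g = x"
  "g \<otimes>\<^bsub>fgrp c x\<^esub> h = mul L c g h" "\<one>\<^bsub>fgrp c x\<^esub> = unt L c x"
  by (simp_all add: fgrp_def)

lemma fgrp_group:
  assumes "c \<in> Ob S" "x \<in> el M c"
  shows "group (fgrp c x)"
proof (rule groupI)
  fix g assume "g \<in> carrier (fgrp c x)"
  then show "\<exists>h\<in>carrier (fgrp c x). h \<otimes>\<^bsub>fgrp c x\<^esub> g = \<one>\<^bsub>fgrp c x\<^esub>" "\<one>\<^bsub>fgrp c x\<^esub> \<otimes>\<^bsub>fgrp c x\<^esub> g = g"
    using assms inv_ex[of c g] mul_unt[of c g] by (auto simp: src_tgt)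
qed (use assms in \<open>auto simp: src_tgt mul_el src_mul mul_assoc\<close>)

lemma fgrp_inv:
  assumes "c \<in> Ob S" "x \<in> el M c" "g \<in> carrier (fgrp c x)"
  shows "inv\<^bsub>fgrp c x\<^esub> g = ginv L c g"
proof -
  interpret group "fgrp c x" by (rule fgrp_group[OF assms(1,2)])
  show ?thesis
    using assms by (intro inv_equality) (simp_all add: src_tgt ginv_at)
qed

text \<open>This turns \<open>axes_unique\<close> into a rule for pointwise equations: a law on D(2)
  is reduced to the cases d = 0 and e = 0, once both sides are known to be natural in the
  stage.\<close>

lemma axes_eq:
  assumes c: "c \<in> Ob S"
    and F: "\<And>f d e. \<lbrakk>f \<in> into S c; d \<in> Dset S (dm S f); e \<in> Dset S (dm S f); d \<otimes>\<^bsub>rg S (dm S f)\<^esub> e = \<zero>\<^bsub>rg S (dm S f)\<^esub>\<rbrakk> \<Longrightarrow>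
      F f d e \<in> el L (dm S f) \<and> F' f d e \<in> el L (dm S f)"
    and N: "\<And>f d e g. \<lbrakk>f \<in> into S c; d \<in> Dset S (dm S f); e \<in> Dset S (dm S f); d \<otimes>\<^bsub>rg S (dm S f)\<^esub> e = \<zero>\<^bsub>rg S (dm S f)\<^esub>;
       g \<in> into S (dm S f)\<rbrakk> \<Longrightarrow>
      F (cmp S f g) (rr S g d) (rr S g e) = rs L g (F f d e) \<and> F' (cmp S f g) (rr S g d) (rr S g e) = rs L g (F' f d e)"
    and Z: "\<And>f d. \<lbrakk>f \<in> into S c; d \<in> Dset S (dm S f)\<rbrakk> \<Longrightarrow>
      F f d \<zero>\<^bsub>rg S (dm S f)\<^esub> = F' f d \<zero>\<^bsub>rg S (dm S f)\<^esub> \<and> F f \<zero>\<^bsub>rg S (dm S f)\<^esub> d = F' f \<zero>\<^bsub>rg S (dm S f)\<^esub> d"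
    and f: "f \<in> into S c" "d \<in> Dset S (dm S f)" "e \<in> Dset S (dm S f)" "d \<otimes>\<^bsub>rg S (dm S f)\<^esub> e = \<zero>\<^bsub>rg S (dm S f)\<^esub>"
  shows "F f d e = F' f d e"
proof -
  let ?l = "\<lambda>F. ilam S (D2n S 1 0) c (\<lambda>f (e, ds). F f (ds ! 0) e)"
  have "?l F \<in> el (expo S (D2n S 1 0) L) c" "?l F' \<in> el (expo S (D2n S 1 0) L) c"
    using F N by (auto intro!: ilam_expo)
  then have "?l F = ?l F'"
    by (rule axes_unique[OF ml c]) (use Z in simp)
  then have "?l F f (e, [d]) = ?l F' f (e, [d])" by simp
  then show ?thesis using f by simp
qed

lemma A1_at:
  assumes t: "t \<in> el (An S M L 1) c" and f: "f \<in> into S c"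
  shows "d \<in> Dset S (dm S f) \<Longrightarrow> t f [d] \<in> el L (dm S f)"
    and "d \<in> Dset S (dm S f) \<Longrightarrow> src L (dm S f) (t f [d]) = rs M f (bpt S L 1 c t)"
    and "t f [\<zero>\<^bsub>rg S (dm S f)\<^esub>] = unt L (dm S f) (rs M f (bpt S L 1 c t))"
    and "\<lbrakk>d \<in> Dset S (dm S f); g \<in> into S (dm S f)\<rbrakk> \<Longrightarrow> rs L g (t f [d]) = t (cmp S f g) [rr S g d]"
  using An_el[OF t f] An_src[OF t f] An_zero[OF t f] An_nat[OF t f, of g "[d]"] by auto

text \<open>For e = 0 both sides are t(d) and for d = 0 both are t(e), because t(0) is the
  unit.\<close>

lemma A1_add:
  assumes t: "t \<in> el (An S M L 1) c" and f: "f \<in> into S c" "d \<in> Dset S (dm S f)" "e \<in> Dset S (dm S f)"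
    and de: "d \<otimes>\<^bsub>rg S (dm S f)\<^esub> e = \<zero>\<^bsub>rg S (dm S f)\<^esub>"
  shows "t f [d \<oplus>\<^bsub>rg S (dm S f)\<^esub> e] = mul L (dm S f) (t f [d]) (t f [e])"
proof -
  have c: "c \<in> Ob S" using f by simp
  have x: "bpt S L 1 c t \<in> el M c" by (rule bpt_el[OF c t])
  note [simp] = A1_at(1,2)[OF t] src_tgt
  show ?thesis
  proof (rule axes_eq[where F = "\<lambda>f d e. t f [d \<oplus>\<^bsub>rg S (dm S f)\<^esub> e]"
        and F' = "\<lambda>f d e. mul L (dm S f) (t f [d]) (t f [e])", OF c _ _ _ f de])
    fix f d e assume f: "f \<in> into S c" "d \<in> Dset S (dm S f)" "e \<in> Dset S (dm S f)"
      and de: "d \<otimes>\<^bsub>rg S (dm S f)\<^esub> e = \<zero>\<^bsub>rg S (dm S f)\<^esub>"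
    show "t f [d \<oplus>\<^bsub>rg S (dm S f)\<^esub> e] \<in> el L (dm S f) \<and> mul L (dm S f) (t f [d]) (t f [e]) \<in> el L (dm S f)"
      using f de by (simp add: mul_el)
    fix g assume g: "g \<in> into S (dm S f)"
    show "t (cmp S f g) [rr S g d \<oplus>\<^bsub>rg S (dm S (cmp S f g))\<^esub> rr S g e] = rs L g (t f [d \<oplus>\<^bsub>rg S (dm S f)\<^esub> e]) \<and>
      mul L (dm S (cmp S f g)) (t (cmp S f g) [rr S g d]) (t (cmp S f g) [rr S g e]) =
      rs L g (mul L (dm S f) (t f [d]) (t f [e]))"
      using f de g by (simp add: A1_at(4)[OF t] mul_rs[OF g] Dset_carrier)
  next
    fix f d assume f: "f \<in> into S c" "d \<in> Dset S (dm S f)"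
    interpret R: cring "rg S (dm S f)" using f by (intro cring_at) simp
    interpret U: group "fgrp (dm S f) (rs M f (bpt S L 1 c t))" using f x by (intro fgrp_group rs_M) auto
    show "t f [d \<oplus>\<^bsub>rg S (dm S f)\<^esub> \<zero>\<^bsub>rg S (dm S f)\<^esub>] = mul L (dm S f) (t f [d]) (t f [\<zero>\<^bsub>rg S (dm S f)\<^esub>]) \<and>
      t f [\<zero>\<^bsub>rg S (dm S f)\<^esub> \<oplus>\<^bsub>rg S (dm S f)\<^esub> d] = mul L (dm S f) (t f [\<zero>\<^bsub>rg S (dm S f)\<^esub>]) (t f [d])"
      using f U.r_one[of "t f [d]"] U.l_one[of "t f [d]"] by (simp add: A1_at(3)[OF t] Dset_carrier)
  qed
qed

text \<open>On each axis of D(2) one of the two factors is the unit, so the order does not matter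
  there, and hence not on all of D(2).\<close>

lemma A1_commute:
  assumes s: "s \<in> el (An S M L 1) c" and t: "t \<in> el (An S M L 1) c" and st: "bpt S L 1 c s = bpt S L 1 c t"
    and f: "f \<in> into S c" "d \<in> Dset S (dm S f)" "e \<in> Dset S (dm S f)"
    and de: "d \<otimes>\<^bsub>rg S (dm S f)\<^esub> e = \<zero>\<^bsub>rg S (dm S f)\<^esub>"
  shows "mul L (dm S f) (s f [d]) (t f [e]) = mul L (dm S f) (t f [e]) (s f [d])"
proof -
  have c: "c \<in> Ob S" using f by simp
  have x: "bpt S L 1 c t \<in> el M c" by (rule bpt_el[OF c t])
  note [simp] = A1_at(1,2)[OF t] A1_at(1,2)[OF s] src_tgt st
  show ?thesis
  proof (rule axes_eq[where F = "\<lambda>f d e. mul L (dm S f) (s f [d]) (t f [e])"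
        and F' = "\<lambda>f d e. mul L (dm S f) (t f [e]) (s f [d])", OF c _ _ _ f de])
    fix f d e assume f: "f \<in> into S c" "d \<in> Dset S (dm S f)" "e \<in> Dset S (dm S f)"
      and de: "d \<otimes>\<^bsub>rg S (dm S f)\<^esub> e = \<zero>\<^bsub>rg S (dm S f)\<^esub>"
    show "mul L (dm S f) (s f [d]) (t f [e]) \<in> el L (dm S f) \<and> mul L (dm S f) (t f [e]) (s f [d]) \<in> el L (dm S f)"
      using f de by (simp add: mul_el)
    fix g assume g: "g \<in> into S (dm S f)"
    show "mul L (dm S (cmp S f g)) (s (cmp S f g) [rr S g d]) (t (cmp S f g) [rr S g e]) =
      rs L g (mul L (dm S f) (s f [d]) (t f [e])) \<and>
      mul L (dm S (cmp S f g)) (t (cmp S f g) [rr S g e]) (s (cmp S f g) [rr S g d]) =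
      rs L g (mul L (dm S f) (t f [e]) (s f [d]))"
      using f de g by (simp add: A1_at(4)[OF t] A1_at(4)[OF s] mul_rs[OF g] Dset_carrier)
  next
    fix f d assume f: "f \<in> into S c" "d \<in> Dset S (dm S f)"
    interpret U: group "fgrp (dm S f) (rs M f (bpt S L 1 c t))" using f x by (intro fgrp_group rs_M) auto
    show "mul L (dm S f) (s f [d]) (t f [\<zero>\<^bsub>rg S (dm S f)\<^esub>]) = mul L (dm S f) (t f [\<zero>\<^bsub>rg S (dm S f)\<^esub>]) (s f [d]) \<and>
      mul L (dm S f) (s f [\<zero>\<^bsub>rg S (dm S f)\<^esub>]) (t f [d]) = mul L (dm S f) (t f [d]) (s f [\<zero>\<^bsub>rg S (dm S f)\<^esub>])"
      using f U.r_one[of "t f [d]"] U.l_one[of "t f [d]"] U.r_one[of "s f [d]"] U.l_one[of "s f [d]"]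
      by (simp add: A1_at(3)[OF t] A1_at(3)[OF s] Dset_carrier)
  qed
qed

text \<open>Since d d = 0, the pair (-d, d) lies in D(2), and additivity applies to -d + d =
  0.\<close>

lemma A1_uminus:
  assumes t: "t \<in> el (An S M L 1) c" and f: "f \<in> into S c" "d \<in> Dset S (dm S f)"
  shows "t f [\<ominus>\<^bsub>rg S (dm S f)\<^esub> d] = ginv L (dm S f) (t f [d])"
proof -
  have c: "c \<in> Ob S" using f by simp
  have x: "rs M f (bpt S L 1 c t) \<in> el M (dm S f)" by (rule rs_M[OF f(1) bpt_el[OF c t]])
  interpret R: cring "rg S (dm S f)" using f by (intro cring_at) simp
  interpret U: group "fgrp (dm S f) (rs M f (bpt S L 1 c t))" using f x by (intro fgrp_group) auto
  note [simp] = A1_at(1,2)[OF t f(1)]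
  have "\<ominus>\<^bsub>rg S (dm S f)\<^esub> d \<otimes>\<^bsub>rg S (dm S f)\<^esub> d = \<zero>\<^bsub>rg S (dm S f)\<^esub>"
    using f by (simp add: Dset_iff R.l_minus)
  then have "mul L (dm S f) (t f [\<ominus>\<^bsub>rg S (dm S f)\<^esub> d]) (t f [d]) = t f [\<zero>\<^bsub>rg S (dm S f)\<^esub>]"
    using A1_add[OF t f(1), of "\<ominus>\<^bsub>rg S (dm S f)\<^esub> d" d] f by (simp add: Dset_carrier R.l_neg)
  then have "inv\<^bsub>fgrp (dm S f) (rs M f (bpt S L 1 c t))\<^esub> (t f [d]) = t f [\<ominus>\<^bsub>rg S (dm S f)\<^esub> d]"
    using f by (intro U.inv_equality) (simp_all add: A1_at(3)[OF t])
  moreover have "inv\<^bsub>fgrp (dm S f) (rs M f (bpt S L 1 c t))\<^esub> (t f [d]) = ginv L (dm S f) (t f [d])"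
    using f x by (intro fgrp_inv) simp_all
  ultimately show ?thesis by simp
qed

lemma A1_unique:
  assumes st: "s \<in> el (An S M L 1) c" "t \<in> el (An S M L 1) c" and c: "c \<in> Ob S"
    and eq: "\<And>f d e. \<lbrakk>f \<in> into S c; d \<in> Dset S (dm S f); e \<in> Dset S (dm S f)\<rbrakk> \<Longrightarrow>
      s f [d \<otimes>\<^bsub>rg S (dm S f)\<^esub> e] = t f [d \<otimes>\<^bsub>rg S (dm S f)\<^esub> e]"
  shows "s = t"
  by (rule product_unique[OF ml c An_expo[OF st(1)] An_expo[OF st(2)] eq])

text \<open>The existence principle for elements of the Lie algebra bundle: it yields the factors of
  the transported sides and the bracket.\<close>

lemma A1_factor:
  assumes c: "c \<in> Ob S" and x: "x \<in> el M c"
    and F: "\<And>f d e. \<lbrakk>f \<in> into S c; d \<in> Dset S (dm S f); e \<in> Dset S (dm S f)\<rbrakk> \<Longrightarrow>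
      F f d e \<in> el L (dm S f) \<and> src L (dm S f) (F f d e) = rs M f x"
    and N: "\<And>f d e g. \<lbrakk>f \<in> into S c; d \<in> Dset S (dm S f); e \<in> Dset S (dm S f); g \<in> into S (dm S f)\<rbrakk> \<Longrightarrow>
      F (cmp S f g) (rr S g d) (rr S g e) = rs L g (F f d e)"
    and Z: "\<And>f d. \<lbrakk>f \<in> into S c; d \<in> Dset S (dm S f)\<rbrakk> \<Longrightarrow>
      F f d \<zero>\<^bsub>rg S (dm S f)\<^esub> = unt L (dm S f) (rs M f x) \<and> F f \<zero>\<^bsub>rg S (dm S f)\<^esub> d = unt L (dm S f) (rs M f x)"
  obtains t where "t \<in> el (An S M L 1) c" "bpt S L 1 c t = x"
    and "\<And>f d e. \<lbrakk>f \<in> into S c; d \<in> Dset S (dm S f); e \<in> Dset S (dm S f)\<rbrakk> \<Longrightarrow>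
      t f [d \<otimes>\<^bsub>rg S (dm S f)\<^esub> e] = F f d e"
proof -
  let ?\<psi> = "ilam S (Dn S 2) c (\<lambda>f ds. F f (ds ! 0) (ds ! 1))"
  have \<psi>: "?\<psi> \<in> el (expo S (Dn S 2) L) c"
    using F N by (intro ilam_expo) auto
  obtain t where t: "t \<in> el (expo S (Dn S 1) L) c" and tF: "\<And>f d e. \<lbrakk>f \<in> into S c; d \<in> Dset S (dm S f); e \<in> Dset S (dm S f)\<rbrakk> \<Longrightarrow>
      t f [d \<otimes>\<^bsub>rg S (dm S f)\<^esub> e] = F f d e"
    by (rule product_factor[OF ml c \<psi>]) (use Z in auto)
  have tel: "t f [d] \<in> el L (dm S f)" if "f \<in> into S c" "d \<in> Dset S (dm S f)" for f d
    using expo_el[OF t that(1)] that by simp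
  have tnat: "t (cmp S f g) [rr S g d] = rs L g (t f [d])"
    if "f \<in> into S c" "d \<in> Dset S (dm S f)" "g \<in> into S (dm S f)" for f g d
    using expo_nat[OF t that(1,3), of "[d]"] that by simp
  \<comment> \<open>The factorisation is so far only a map from D to L, whose values are known to
    lie over x at products only. The units over these values and the units over x are two maps D ->
    L that agree at products, so they are equal by \<open>product_unique\<close>; taking sources
    gives the base point everywhere.\<close>
  let ?u = "ilam S (Dn S 1) c (\<lambda>f ds. unt L (dm S f) (src L (dm S f) (t f ds)))"
  let ?v = "ilam S (Dn S 1) c (\<lambda>f ds. unt L (dm S f) (rs M f x))"
  have u: "?u \<in> el (expo S (Dn S 1) L) c"
    by (rule ilam_expo) (auto simp: tel tnat src_el unt_rs src_rs)
  have v: "?v \<in> el (expo S (Dn S 1) L) c"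
    by (rule ilam_expo) (auto simp: rs_M[OF _ x] unt_rs psh_cmp[OF M_psh _ _ x])
  have uv: "?u = ?v"
    by (rule product_unique[OF ml c u v]) (use F in \<open>simp add: tF Dset_carrier\<close>)
  have src: "src L (dm S f) (t f [d]) = rs M f x" if "f \<in> into S c" "d \<in> Dset S (dm S f)" for f d
  proof -
    have "?u f [d] = ?v f [d]" by (simp only: uv)
    then have "unt L (dm S f) (src L (dm S f) (t f [d])) = unt L (dm S f) (rs M f x)" using that by simp
    then have "src L (dm S f) (unt L (dm S f) (src L (dm S f) (t f [d]))) = src L (dm S f) (unt L (dm S f) (rs M f x))"
      by simp
    moreover have "src L (dm S f) (t f [d]) \<in> el M (dm S f)" "rs M f x \<in> el M (dm S f)"
      using that by (auto intro: src_el tel rs_M[OF _ x])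
    ultimately show ?thesis using that by simp
  qed
  have b: "bpt S L 1 c t = x"
    using src[of "idt S c" "\<zero>\<^bsub>rg S c\<^esub>"] c x by (simp add: bpt_def psh_idt[OF M_psh])
  have "t (idt S c) [\<zero>\<^bsub>rg S c\<^esub>] = unt L c x"
    using tF[of "idt S c" "\<zero>\<^bsub>rg S c\<^esub>" "\<zero>\<^bsub>rg S c\<^esub>"] Z[of "idt S c" "\<zero>\<^bsub>rg S c\<^esub>"] c x
    by (simp add: psh_idt[OF M_psh])
  then have "t \<in> el (An S M L 1) c"
    unfolding An_iff b using t src by auto
  from that[OF this b tF] show ?thesis .
qed

lemma A1_mul:
  assumes s: "s \<in> el (An S M L 1) c" and t: "t \<in> el (An S M L 1) c" and st: "bpt S L 1 c s = bpt S L 1 c t"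
    and c: "c \<in> Ob S"
  defines "m \<equiv> ilam S (Dn S 1) c (\<lambda>f ds. mul L (dm S f) (s f ds) (t f ds))"
  shows "m \<in> el (An S M L 1) c \<and> bpt S L 1 c m = bpt S L 1 c t"
  unfolding m_def
proof (rule An_I[OF c bpt_el[OF c t]])
  have x: "bpt S L 1 c t \<in> el M c" by (rule bpt_el[OF c t])
  note [simp] = A1_at(1,2)[OF t] A1_at(1,2)[OF s] src_tgt st
  show "mul L (dm S (idt S c)) (s (idt S c) (replicate 1 \<zero>\<^bsub>rg S c\<^esub>)) (t (idt S c) (replicate 1 \<zero>\<^bsub>rg S c\<^esub>)) =
      unt L c (bpt S L 1 c t)"
    using c x A1_at(3)[OF t, of "idt S c"] A1_at(3)[OF s, of "idt S c"] mul_unt(1)[of c "unt L c (bpt S L 1 c t)"]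
    by (simp add: psh_idt[OF M_psh])
  fix f ds assume f: "f \<in> into S c" and ds: "ds \<in> el (Dn S 1) (dm S f)"
  show "mul L (dm S f) (s f ds) (t f ds) \<in> el L (dm S f) \<and>
      src L (dm S f) (mul L (dm S f) (s f ds) (t f ds)) = rs M f (bpt S L 1 c t)"
    using f ds by (auto simp: mul_el src_mul)
  fix g assume g: "g \<in> into S (dm S f)"
  show "mul L (dm S (cmp S f g)) (s (cmp S f g) (map (rr S g) ds)) (t (cmp S f g) (map (rr S g) ds)) =
      rs L g (mul L (dm S f) (s f ds) (t f ds))"
    using f ds g by (auto simp: A1_at(4)[OF t] A1_at(4)[OF s] mul_rs[OF g])
qed

text \<open>The map (d, e) |-> s(d) t(e) on D(2) restricts to s and t on the axes, so it is the map
  described by \<open>sum_map\<close>. The diagonal of D lies in D(2), and there it is the pointwise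
  product.\<close>

lemma A1_vadd:
  assumes s: "s \<in> el (An S M L 1) c" and t: "t \<in> el (An S M L 1) c" and st: "bpt S L 1 c s = bpt S L 1 c t"
    and c: "c \<in> Ob S"
  shows "add_at S M L 1 0 c s t = ilam S (Dn S 1) c (\<lambda>f ds. mul L (dm S f) (s f ds) (t f ds))"
proof -
  have x: "bpt S L 1 c t \<in> el M c" by (rule bpt_el[OF c t])
  note [simp] = A1_at(1,2)[OF t] A1_at(1,2)[OF s] src_tgt st
  let ?l = "ilam S (D2n S 1 0) c (\<lambda>f (e, ds). mul L (dm S f) (s f ds) (t f [e]))"
  have one: "mul L (dm S f) (unt L (dm S f) (rs M f (bpt S L 1 c t))) g = g" "mul L (dm S f) g (unt L (dm S f) (rs M f (bpt S L 1 c t))) = g"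
    if "f \<in> into S c" "g \<in> el L (dm S f)" "src L (dm S f) g = rs M f (bpt S L 1 c t)" for f g
    using that mul_unt[of "dm S f" g] by simp_all
  have l: "?l \<in> el (expo S (D2n S 1 0) L) c"
    by (rule ilam_expo) (auto simp: mul_el A1_at(4)[OF t] A1_at(4)[OF s] mul_rs)
  have "sum_map S M L 1 0 c s t = ?l"
    unfolding sum_map_def
  proof (rule the_equality)
    show "?l \<in> el (expo S (D2n S 1 0) L) c \<and> (\<forall>f\<in>into S c.
       (\<forall>q\<in>el (D2n S 1 0) (dm S f). src L (dm S f) (?l f q) = rs M f (bpt S L 1 c s)) \<and>
       (\<forall>ds\<in>el (Dn S 1) (dm S f). ?l f (\<zero>\<^bsub>rg S (dm S f)\<^esub>, ds) = s f ds \<and>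
         ?l f (ds ! 0, ds[0 := \<zero>\<^bsub>rg S (dm S f)\<^esub>]) = t f ds))"
      using l by (auto simp: src_mul one A1_at(3)[OF t] A1_at(3)[OF s])
    fix l' assume l': "l' \<in> el (expo S (D2n S 1 0) L) c \<and> (\<forall>f\<in>into S c.
       (\<forall>q\<in>el (D2n S 1 0) (dm S f). src L (dm S f) (l' f q) = rs M f (bpt S L 1 c s)) \<and>
       (\<forall>ds\<in>el (Dn S 1) (dm S f). l' f (\<zero>\<^bsub>rg S (dm S f)\<^esub>, ds) = s f ds \<and>
         l' f (ds ! 0, ds[0 := \<zero>\<^bsub>rg S (dm S f)\<^esub>]) = t f ds))"
    then have l'e: "l' \<in> el (expo S (D2n S 1 0) L) c" by blast
    have "l' f (\<zero>\<^bsub>rg S (dm S f)\<^esub>, [d]) = s f [d] \<and> l' f (d, [\<zero>\<^bsub>rg S (dm S f)\<^esub>]) = t f [d]"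
      if "f \<in> into S c" "d \<in> Dset S (dm S f)" for f d
    proof -
      have "\<forall>ds\<in>el (Dn S 1) (dm S f). l' f (\<zero>\<^bsub>rg S (dm S f)\<^esub>, ds) = s f ds \<and>
         l' f (ds ! 0, ds[0 := \<zero>\<^bsub>rg S (dm S f)\<^esub>]) = t f ds"
        using conjunct2[OF l'] that(1) by blast
      from bspec[OF this, of "[d]"] show ?thesis using that by simp
    qed
    then show "l' = ?l"
      by (intro axes_unique[OF ml c l'e l]) (simp add: one A1_at(3)[OF t] A1_at(3)[OF s])
  qed
  then show ?thesis
    unfolding add_at_def by (intro ilam_cong) (auto simp: Dset_iff)
qed

lemma A1_scl:
  assumes t: "t \<in> el (An S M L 1) c" and c: "c \<in> Ob S" and a: "a \<in> carrier (rg S c)"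
  shows "scl S 1 0 c a t \<in> el (An S M L 1) c \<and> bpt S L 1 c (scl S 1 0 c a t) = bpt S L 1 c t"
  unfolding scl_def
proof (rule An_I[OF c bpt_el[OF c t]])
  have x: "bpt S L 1 c t \<in> el M c" by (rule bpt_el[OF c t])
  note [simp] = A1_at(1,2)[OF t]
  interpret R: cring "rg S c" by (rule cring_at[OF c])
  show "t (idt S c) ((replicate 1 \<zero>\<^bsub>rg S c\<^esub>)[0 := rr S (idt S c) a \<otimes>\<^bsub>rg S (dm S (idt S c))\<^esub> replicate 1 \<zero>\<^bsub>rg S c\<^esub> ! 0]) =
      unt L c (bpt S L 1 c t)"
    using c x a A1_at(3)[OF t, of "idt S c"] by (simp add: psh_idt[OF M_psh] rr_idt)
  fix f ds assume f: "f \<in> into S c" and ds: "ds \<in> el (Dn S 1) (dm S f)"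
  show "t f (ds[0 := rr S f a \<otimes>\<^bsub>rg S (dm S f)\<^esub> ds ! 0]) \<in> el L (dm S f) \<and>
     src L (dm S f) (t f (ds[0 := rr S f a \<otimes>\<^bsub>rg S (dm S f)\<^esub> ds ! 0])) = rs M f (bpt S L 1 c t)"
    using f ds a by auto
  fix g assume g: "g \<in> into S (dm S f)"
  show "t (cmp S f g) ((map (rr S g) ds)[0 := rr S (cmp S f g) a \<otimes>\<^bsub>rg S (dm S (cmp S f g))\<^esub> map (rr S g) ds ! 0]) =
    rs L g (t f (ds[0 := rr S f a \<otimes>\<^bsub>rg S (dm S f)\<^esub> ds ! 0]))"
    using f ds g a by (auto simp: A1_at(4)[OF t] rr_cmp[OF f g] Dset_carrier)
qed

end

section \<open>Linear isomorphisms of the fibres\<close>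

context gbundle begin

abbreviation "E \<equiv> A1 S M L"

lemma A1_simps [simp]: "el E = el (An S M L 1)" "rs E f = rsf S (Dn S 1) f" "prj E = bpt S L 1"
    "vadd E = add_at S M L 1 0" "vsm E = scl S 1 0"
  by (simp_all add: A1_def An_def)

lemma fib_iff: "v \<in> fib E c x \<longleftrightarrow> v \<in> el (An S M L 1) c \<and> bpt S L 1 c v = x"
  by (simp add: fib_def)

lemma fam_iff: "v \<in> fam S M E x f \<longleftrightarrow> v \<in> el (An S M L 1) (dm S f) \<and> bpt S L 1 (dm S f) v = rs M f x"
  by (simp add: fam_def fib_iff)

lemma fam_idt: "\<lbrakk>c \<in> Ob S; x \<in> el M c\<rbrakk> \<Longrightarrow> fam S M E x (idt S c) = fib E c x"
  by (simp add: fam_def psh_idt[OF M_psh])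

lemma fam_closed:
  assumes f: "f \<in> into S c" and v: "v \<in> fam S M E x f"
  shows "w \<in> fam S M E x f \<Longrightarrow> vadd E (dm S f) v w \<in> fam S M E x f"
    and "a \<in> carrier (rg S (dm S f)) \<Longrightarrow> vsm E (dm S f) a v \<in> fam S M E x f"
    and "\<lbrakk>g \<in> into S (dm S f); x \<in> el M c\<rbrakk> \<Longrightarrow> rs E g v \<in> fam S M E x (cmp S f g)"
proof -
  have b: "dm S f \<in> Ob S" using f by simp
  show "vadd E (dm S f) v w \<in> fam S M E x f" if "w \<in> fam S M E x f"
    using that v b A1_vadd[of v "dm S f" w] A1_mul[of v "dm S f" w] by (simp add: fam_iff)
  show "vsm E (dm S f) a v \<in> fam S M E x f" if "a \<in> carrier (rg S (dm S f))"
    using that v b A1_scl[of v "dm S f" a] by (simp add: fam_iff)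
  show "rs E g v \<in> fam S M E x (cmp S f g)" if "g \<in> into S (dm S f)" "x \<in> el M c"
    using that v f rsf_An[of v 1 "dm S f" g] by (simp add: fam_iff psh_cmp[OF M_psh f])
qed

lemma Phi_iff: "(x, y, \<phi>) \<in> el (Phi_Lin S M E) c \<longleftrightarrow> x \<in> el M c \<and> y \<in> el M c \<and> \<phi> \<in> lin_iso S M E c x y"
  by (simp add: Phi_Lin_def)

lemma lin_isoD:
  assumes "\<phi> \<in> lin_iso S M E c x y" "f \<in> into S c"
  shows "bij_betw (\<phi> f) (fam S M E x f) (fam S M E y f)"
    and "\<lbrakk>v \<in> fam S M E x f; w \<in> fam S M E x f\<rbrakk> \<Longrightarrow> \<phi> f (vadd E (dm S f) v w) = vadd E (dm S f) (\<phi> f v) (\<phi> f w)"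
    and "\<lbrakk>v \<in> fam S M E x f; a \<in> carrier (rg S (dm S f))\<rbrakk> \<Longrightarrow> \<phi> f (vsm E (dm S f) a v) = vsm E (dm S f) a (\<phi> f v)"
    and "\<lbrakk>v \<in> fam S M E x f; g \<in> into S (dm S f)\<rbrakk> \<Longrightarrow> \<phi> (cmp S f g) (rs E g v) = rs E g (\<phi> f v)"
  using assms unfolding lin_iso_def dmaps_def by blast+

lemma lin_iso_eta: "\<phi> \<in> lin_iso S M E c x y \<Longrightarrow> dlam S (fam S M E x) c \<phi> = \<phi>"
  unfolding lin_iso_def dmaps_def by blast

text \<open>The description in \<open>ginv\<close> is evaluated by hand: the inverses of the
  bijections at the various stages form a natural and linear family, and any other candidate is a
  right inverse with values in the same fibres, hence equal to it.\<close>

lemma ginv_Phi: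
  assumes c: "c \<in> Ob S" and P: "(x, y, \<phi>) \<in> el (Phi_Lin S M E) c"
  shows "ginv (Phi_Lin S M E) c (x, y, \<phi>) =
    (y, x, dlam S (fam S M E y) c (\<lambda>f. inv_into (fam S M E x f) (\<phi> f)))"
proof -
  let ?X = "fam S M E x" and ?Y = "fam S M E y"
  define \<chi> where "\<chi> = dlam S ?Y c (\<lambda>f. inv_into (?X f) (\<phi> f))"
  have x: "x \<in> el M c" and y: "y \<in> el M c" and \<phi>: "\<phi> \<in> lin_iso S M E c x y"
    using P by (simp_all add: Phi_iff)
  note bij = lin_isoD(1)[OF \<phi>]
  have \<chi>: "\<chi> f w = inv_into (?X f) (\<phi> f) w" if "f \<in> into S c" "w \<in> ?Y f" for f w
    using that by (simp add: \<chi>_def dlam_def)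
  have \<chi>X: "\<chi> f w \<in> ?X f" "\<phi> f (\<chi> f w) = w" if "f \<in> into S c" "w \<in> ?Y f" for f w
    using that bij[OF that(1)] by (auto simp: \<chi> bij_betw_def inv_into_into f_inv_into_f)
  \<comment> \<open>The working rule for the inverse: naturality and linearity of \<chi> are
    obtained by applying \<phi> to the proposed value.\<close>
  have \<chi>I: "\<chi> f w = v" if "f \<in> into S c" "v \<in> ?X f" "\<phi> f v = w" for f v w
  proof -
    have "w \<in> ?Y f" using that bij[OF that(1)] by (auto simp: bij_betw_def)
    then show ?thesis using that bij[OF that(1)] by (auto simp: \<chi> bij_betw_def)
  qed
  have "\<chi> \<in> lin_iso S M E c y x"
    unfolding lin_iso_def dmaps_def
  proof (intro CollectI conjI ballI)
    show "dlam S ?Y c \<chi> = \<chi>" by (auto simp: \<chi>_def dlam_def fun_eq_iff)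
  next
    fix f w assume f: "f \<in> into S c" and w: "w \<in> ?Y f"
    note v = \<chi>X[OF f w]
    show "\<chi> f w \<in> el E (dm S f)" using v by (simp add: fam_iff)
    fix g assume g: "g \<in> into S (dm S f)"
    show "\<chi> (cmp S f g) (rs E g w) = rs E g (\<chi> f w)"
      using f g lin_isoD(4)[OF \<phi> f v(1) g] fam_closed(3)[OF f v(1) g x] v(2) by (intro \<chi>I) simp_all
  next
    fix f assume f: "f \<in> into S c"
    show "bij_betw (\<chi> f) (?Y f) (?X f)"
      using bij_betw_inv_into[OF bij[OF f]] by (simp add: \<chi>[OF f] cong: bij_betw_cong)
    fix w assume w: "w \<in> ?Y f"
    note v = \<chi>X[OF f w]
    show "\<chi> f (vadd E (dm S f) w w') = vadd E (dm S f) (\<chi> f w) (\<chi> f w')" if w': "w' \<in> ?Y f" for w'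
      using fam_closed(1)[OF f v(1) \<chi>X(1)[OF f w']] lin_isoD(2)[OF \<phi> f v(1) \<chi>X(1)[OF f w']] v(2) \<chi>X(2)[OF f w']
      by (intro \<chi>I f) simp_all
    show "\<chi> f (vsm E (dm S f) a w) = vsm E (dm S f) a (\<chi> f w)" if "a \<in> carrier (rg S (dm S f))" for a
      using fam_closed(2)[OF f v(1) that] lin_isoD(3)[OF \<phi> f v(1) that] v(2)
      by (intro \<chi>I f) simp_all
  qed
  then have Q: "(y, x, \<chi>) \<in> el (Phi_Lin S M E) c" using x y by (simp add: Phi_iff)
  have "ginv (Phi_Lin S M E) c (x, y, \<phi>) = (y, x, \<chi>)"
    unfolding ginv_def
  proof (rule the_equality)
    have "dlam S ?Y c (\<lambda>f v. \<phi> f (\<chi> f v)) = dlam S ?Y c (\<lambda>f v. v)"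
      "dlam S ?X c (\<lambda>f v. \<chi> f (\<phi> f v)) = dlam S ?X c (\<lambda>f v. v)"
      by (auto simp: dlam_def fun_eq_iff \<chi>X \<chi>I)
    then show "(y, x, \<chi>) \<in> el (Phi_Lin S M E) c \<and>
      src (Phi_Lin S M E) c (y, x, \<chi>) = tgt (Phi_Lin S M E) c (x, y, \<phi>) \<and>
      tgt (Phi_Lin S M E) c (y, x, \<chi>) = src (Phi_Lin S M E) c (x, y, \<phi>) \<and>
      mul (Phi_Lin S M E) c (x, y, \<phi>) (y, x, \<chi>) = unt (Phi_Lin S M E) c (tgt (Phi_Lin S M E) c (x, y, \<phi>)) \<and>
      mul (Phi_Lin S M E) c (y, x, \<chi>) (x, y, \<phi>) = unt (Phi_Lin S M E) c (src (Phi_Lin S M E) c (x, y, \<phi>))"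
      using Q by (simp add: Phi_Lin_def)
  next
    fix h assume h: "h \<in> el (Phi_Lin S M E) c \<and>
      src (Phi_Lin S M E) c h = tgt (Phi_Lin S M E) c (x, y, \<phi>) \<and>
      tgt (Phi_Lin S M E) c h = src (Phi_Lin S M E) c (x, y, \<phi>) \<and>
      mul (Phi_Lin S M E) c (x, y, \<phi>) h = unt (Phi_Lin S M E) c (tgt (Phi_Lin S M E) c (x, y, \<phi>)) \<and>
      mul (Phi_Lin S M E) c h (x, y, \<phi>) = unt (Phi_Lin S M E) c (src (Phi_Lin S M E) c (x, y, \<phi>))"
    obtain y' x' \<kappa> where h_eq: "h = (y', x', \<kappa>)" by (cases h) auto
    have yx: "y' = y" "x' = x" and \<kappa>: "\<kappa> \<in> lin_iso S M E c y x"
      and eq: "dlam S ?Y c (\<lambda>f v. \<phi> f (\<kappa> f v)) = dlam S ?Y c (\<lambda>f v. v)"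
      using h unfolding h_eq by (auto simp: Phi_Lin_def)
    have "\<kappa> f w = \<chi> f w" if f: "f \<in> into S c" and w: "w \<in> ?Y f" for f w
    proof -
      have "\<phi> f (\<kappa> f w) = w" using fun_cong[OF fun_cong[OF eq], of f w] f w by (simp add: dlam_def)
      moreover have "\<kappa> f w \<in> ?X f" using lin_isoD(1)[OF \<kappa> f] w by (auto simp: bij_betw_def)
      ultimately show ?thesis using \<chi>I[OF f] by simp
    qed
    then have "dlam S ?Y c \<kappa> = dlam S ?Y c \<chi>" by (auto simp: dlam_def fun_eq_iff)
    moreover have "dlam S ?Y c \<chi> = \<chi>" by (auto simp: \<chi>_def dlam_def fun_eq_iff)
    ultimately show "h = (y, x, \<chi>)" using lin_iso_eta[OF \<kappa>] by (simp add: h_eq yx)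
  qed
  then show ?thesis by (simp add: \<chi>_def)
qed

text \<open>The third clause is the way transported vectors are computed below: a vector of the
  source fibre is exhibited and pushed forward along \<phi>.\<close>

lemma lapp_ginv_Phi:
  assumes c: "c \<in> Ob S" and P: "(x, y, \<phi>) \<in> el (Phi_Lin S M E) c"
  shows "w \<in> fib E c y \<Longrightarrow> lapp S c (ginv (Phi_Lin S M E) c (x, y, \<phi>)) w \<in> fib E c x"
    and "w \<in> fib E c y \<Longrightarrow> \<phi> (idt S c) (lapp S c (ginv (Phi_Lin S M E) c (x, y, \<phi>)) w) = w"
    and "\<lbrakk>v \<in> fib E c x; \<phi> (idt S c) v = w\<rbrakk> \<Longrightarrow> lapp S c (ginv (Phi_Lin S M E) c (x, y, \<phi>)) w = v"
proof -
  have x: "x \<in> el M c" and y: "y \<in> el M c" and \<phi>: "\<phi> \<in> lin_iso S M E c x y"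
    using P by (simp_all add: Phi_iff)
  have bij: "bij_betw (\<phi> (idt S c)) (fib E c x) (fib E c y)"
    using lin_isoD(1)[OF \<phi>, of "idt S c"] c x y by (simp add: fam_idt)
  have e: "lapp S c (ginv (Phi_Lin S M E) c (x, y, \<phi>)) w = inv_into (fib E c x) (\<phi> (idt S c)) w"
    if "w \<in> fib E c y" for w
    using that c x y by (simp add: ginv_Phi[OF c P] lapp_def dlam_def fam_idt)
  show "lapp S c (ginv (Phi_Lin S M E) c (x, y, \<phi>)) w \<in> fib E c x"
    "\<phi> (idt S c) (lapp S c (ginv (Phi_Lin S M E) c (x, y, \<phi>)) w) = w" if "w \<in> fib E c y"
    using that bij by (auto simp: e bij_betw_def inv_into_into f_inv_into_f)
  show "lapp S c (ginv (Phi_Lin S M E) c (x, y, \<phi>)) w = v" if "v \<in> fib E c x" "\<phi> (idt S c) v = w"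
  proof -
    have "w \<in> fib E c y" using that bij by (auto simp: bij_betw_def)
    then show ?thesis using that bij by (auto simp: e bij_betw_def)
  qed
qed

end

section \<open>Squares in a groupoid and their sides\<close>

context grpd_obj begin

text \<open>The exchange of variables turns the second axis and the second sides of a square into
  the first ones, so only \<open>face S 1\<close> and \<open>side1\<close> have to be
  studied.\<close>

definition swap :: "'o \<Rightarrow> ('a \<Rightarrow> 'r list \<Rightarrow> 'g) \<Rightarrow> 'a \<Rightarrow> 'r list \<Rightarrow> 'g" where
  "swap b \<gamma> = ilam S (Dn S 2) b (\<lambda>f ds. \<gamma> f [ds ! 1, ds ! 0])"

lemma A2_at:
  assumes \<gamma>: "\<gamma> \<in> el (An S M G 2) b" and f: "f \<in> into S b" and d: "d \<in> Dset S (dm S f)" "e \<in> Dset S (dm S f)"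
  shows "\<gamma> f [d, e] \<in> el G (dm S f)" "src G (dm S f) (\<gamma> f [d, e]) = rs M f (bpt S G 2 b \<gamma>)"
    and "g \<in> into S (dm S f) \<Longrightarrow> rs G g (\<gamma> f [d, e]) = \<gamma> (cmp S f g) [rr S g d, rr S g e]"
  using An_el[OF \<gamma> f, of "[d, e]"] An_src[OF \<gamma> f, of "[d, e]"] An_nat[OF \<gamma> f, of g "[d, e]"] d by auto

lemma A2_zero:
  assumes "\<gamma> \<in> el (An S M G 2) b" "f \<in> into S b"
  shows "\<gamma> f [\<zero>\<^bsub>rg S (dm S f)\<^esub>, \<zero>\<^bsub>rg S (dm S f)\<^esub>] = unt G (dm S f) (rs M f (bpt S G 2 b \<gamma>))"
  using An_zero[OF assms] by simp

lemma swap_An: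
  assumes \<gamma>: "\<gamma> \<in> el (An S M G 2) b" and b: "b \<in> Ob S"
  shows "swap b \<gamma> \<in> el (An S M G 2) b \<and> bpt S G 2 b (swap b \<gamma>) = bpt S G 2 b \<gamma>"
  unfolding swap_def
proof (rule An_I[OF b bpt_el[OF b \<gamma>]])
  show "\<gamma> (idt S b) [replicate 2 \<zero>\<^bsub>rg S b\<^esub> ! 1, replicate 2 \<zero>\<^bsub>rg S b\<^esub> ! 0] = unt G b (bpt S G 2 b \<gamma>)"
    using A2_zero[OF \<gamma>, of "idt S b"] b by (simp add: psh_idt[OF M_psh] bpt_el[OF b \<gamma>])
qed (auto simp: A2_at[OF \<gamma>])

lemma swap_swap: "\<lbrakk>\<gamma> \<in> el (An S M G 2) b; b \<in> Ob S\<rbrakk> \<Longrightarrow> swap b (swap b \<gamma>) = \<gamma>"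
  by (rule An_ext[where n = 2 and c = b]) (auto simp: swap_An, auto simp: swap_def)

lemma swap_rs: "\<lbrakk>g \<in> into S b\<rbrakk> \<Longrightarrow> rsf S (Dn S 2) g (swap b \<gamma>) = swap (dm S g) (rsf S (Dn S 2) g \<gamma>)"
  unfolding swap_def rsf_def[of S _ g "ilam _ _ _ _"] by (rule ilam_cong) auto

lemma scl2_An:
  assumes \<gamma>: "\<gamma> \<in> el (An S M G 2) b" and b: "b \<in> Ob S" and a: "a \<in> carrier (rg S b)" and i: "i < 2"
  shows "scl S 2 i b a \<gamma> \<in> el (An S M G 2) b \<and> bpt S G 2 b (scl S 2 i b a \<gamma>) = bpt S G 2 b \<gamma>"
  unfolding scl_def
proof (rule An_I[OF b bpt_el[OF b \<gamma>]])
  interpret R: cring "rg S b" by (rule cring_at[OF b])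
  have i: "i = 0 \<or> i = 1" using i by auto
  show "\<gamma> (idt S b) ((replicate 2 \<zero>\<^bsub>rg S b\<^esub>)[i := rr S (idt S b) a \<otimes>\<^bsub>rg S (dm S (idt S b))\<^esub> replicate 2 \<zero>\<^bsub>rg S b\<^esub> ! i]) =
      unt G b (bpt S G 2 b \<gamma>)"
    using A2_zero[OF \<gamma>, of "idt S b"] b a i by (auto simp: psh_idt[OF M_psh] bpt_el[OF b \<gamma>] rr_idt One_nat_def)
  fix f ds assume f: "f \<in> into S b" and "ds \<in> el (Dn S 2) (dm S f)"
  then obtain d e where ds: "ds = [d, e]" "d \<in> Dset S (dm S f)" "e \<in> Dset S (dm S f)" by auto
  show "\<gamma> f (ds[i := rr S f a \<otimes>\<^bsub>rg S (dm S f)\<^esub> ds ! i]) \<in> el G (dm S f) \<and>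
      src G (dm S f) (\<gamma> f (ds[i := rr S f a \<otimes>\<^bsub>rg S (dm S f)\<^esub> ds ! i])) = rs M f (bpt S G 2 b \<gamma>)"
    using f ds a i by (auto simp: A2_at[OF \<gamma>] One_nat_def)
  fix g assume g: "g \<in> into S (dm S f)"
  show "\<gamma> (cmp S f g) ((map (rr S g) ds)[i := rr S (cmp S f g) a \<otimes>\<^bsub>rg S (dm S (cmp S f g))\<^esub> map (rr S g) ds ! i]) =
    rs G g (\<gamma> f (ds[i := rr S f a \<otimes>\<^bsub>rg S (dm S f)\<^esub> ds ! i]))"
    using f ds g a i by (auto simp: A2_at[OF \<gamma>] rr_cmp[OF f g] Dset_carrier One_nat_def)
qed

lemma scl2_apply:
  assumes "f \<in> into S b" "d \<in> Dset S (dm S f)" "e \<in> Dset S (dm S f)"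
  shows "scl S 2 0 b a \<gamma> f [d, e] = \<gamma> f [rr S f a \<otimes>\<^bsub>rg S (dm S f)\<^esub> d, e]"
    and "scl S 2 1 b a \<gamma> f [d, e] = \<gamma> f [d, rr S f a \<otimes>\<^bsub>rg S (dm S f)\<^esub> e]"
  using assms by (simp_all add: scl_def One_nat_def)

lemma swap_apply: "\<lbrakk>f \<in> into S b; d \<in> Dset S (dm S f); e \<in> Dset S (dm S f)\<rbrakk> \<Longrightarrow> swap b \<gamma> f [d, e] = \<gamma> f [e, d]"
  by (simp add: swap_def)

lemma face_apply: "\<lbrakk>f \<in> into S b; d \<in> Dset S (dm S f)\<rbrakk> \<Longrightarrow> face S 1 b \<gamma> f [d] = \<gamma> f [d, \<zero>\<^bsub>rg S (dm S f)\<^esub>]"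
  "\<lbrakk>f \<in> into S b; d \<in> Dset S (dm S f)\<rbrakk> \<Longrightarrow> face S 0 b \<gamma> f [d] = \<gamma> f [\<zero>\<^bsub>rg S (dm S f)\<^esub>, d]"
  by (simp_all add: face_def)

lemma swap_scl:
  assumes \<gamma>: "\<gamma> \<in> el (An S M G 2) b" and b: "b \<in> Ob S" and a: "a \<in> carrier (rg S b)"
  shows "swap b (scl S 2 0 b a \<gamma>) = scl S 2 1 b a (swap b \<gamma>)"
    and "swap b (scl S 2 1 b a \<gamma>) = scl S 2 0 b a (swap b \<gamma>)"
  using scl2_An[OF \<gamma> b a] scl2_An[OF conjunct1[OF swap_An[OF \<gamma> b]] b a] a
  by (auto intro!: An_ext[where n = 2 and c = b] simp: swap_An[OF _ b] swap_apply scl2_apply)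

lemma face_swap: "face S 0 b \<gamma> = face S 1 b (swap b \<gamma>)"
  unfolding face_def by (rule ilam_cong) (auto simp: swap_apply)

lemma side_swap: "e \<in> Dset S b \<Longrightarrow> side2 S G b \<gamma> e = side1 S G b (swap b \<gamma>) e"
  unfolding side1_def side2_def by (rule ilam_cong) (auto simp: swap_apply)

lemma face_An:
  assumes \<gamma>: "\<gamma> \<in> el (An S M G 2) b" and b: "b \<in> Ob S"
  shows "face S 1 b \<gamma> \<in> el (An S M G 1) b \<and> bpt S G 1 b (face S 1 b \<gamma>) = bpt S G 2 b \<gamma>"
  unfolding face_def
proof (rule An_I[OF b bpt_el[OF b \<gamma>]])
  show "\<gamma> (idt S b) (if (1::nat) = 0 then [\<zero>\<^bsub>rg S (dm S (idt S b))\<^esub>, replicate 1 \<zero>\<^bsub>rg S b\<^esub> ! 0]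
      else [replicate 1 \<zero>\<^bsub>rg S b\<^esub> ! 0, \<zero>\<^bsub>rg S (dm S (idt S b))\<^esub>]) = unt G b (bpt S G 2 b \<gamma>)"
    using A2_zero[OF \<gamma>, of "idt S b"] b by (simp add: psh_idt[OF M_psh] bpt_el[OF b \<gamma>])
qed (auto simp: A2_at[OF \<gamma>])

lemma face_rs: "g \<in> into S b \<Longrightarrow> rsf S (Dn S 1) g (face S i b \<gamma>) = face S i (dm S g) (rsf S (Dn S 2) g \<gamma>)"
  unfolding face_def rsf_def[of S _ g "ilam _ _ _ _"] by (rule ilam_cong) auto

text \<open>The side at e starts where the arrow \<gamma>(e, 0) ends, so its base point moves with
  e. This is why values of \<omega> on different sides lie in different fibres and have to be
  transported before they can be compared.\<close>

lemma side_An: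
  assumes \<gamma>: "\<gamma> \<in> el (An S M G 2) b" and b: "b \<in> Ob S" and e: "e \<in> Dset S b"
  shows "side1 S G b \<gamma> e \<in> el (An S M G 1) b \<and>
    bpt S G 1 b (side1 S G b \<gamma> e) = tgt G b (\<gamma> (idt S b) [e, \<zero>\<^bsub>rg S b\<^esub>])"
  unfolding side1_def
proof (rule An_I[OF b])
  let ?F = "\<lambda>f ds. mul G (dm S f) (\<gamma> f [rr S f e, ds ! 0]) (ginv G (dm S f) (\<gamma> f [rr S f e, \<zero>\<^bsub>rg S (dm S f)\<^esub>]))"
  let ?x = "tgt G b (\<gamma> (idt S b) [e, \<zero>\<^bsub>rg S b\<^esub>])"
  note [simp] = A2_at[OF \<gamma>] ginv_el src_ginv tgt_ginv
  have i: "\<gamma> (idt S b) [e, \<zero>\<^bsub>rg S b\<^esub>] \<in> el G b" using A2_at(1)[OF \<gamma>, of "idt S b" e "\<zero>\<^bsub>rg S b\<^esub>"] b e by simp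
  then show "?x \<in> el M b" by (rule tgt_el[OF b])
  show "?F (idt S b) (replicate 1 \<zero>\<^bsub>rg S b\<^esub>) = unt G b ?x"
    using mul_ginv[OF b i] b e by (simp add: rr_idt Dset_carrier)
  fix f ds assume f: "f \<in> into S b" and "ds \<in> el (Dn S 1) (dm S f)"
  then obtain d where ds: "ds = [d]" "d \<in> Dset S (dm S f)" by auto
  have "tgt G (dm S f) (\<gamma> f [rr S f e, \<zero>\<^bsub>rg S (dm S f)\<^esub>]) = rs M f ?x"
    using tgt_rs[OF f i] A2_at(3)[OF \<gamma>, of "idt S b" e "\<zero>\<^bsub>rg S b\<^esub>" f] f b e by simp
  then show "?F f ds \<in> el G (dm S f) \<and> src G (dm S f) (?F f ds) = rs M f ?x"
    using f ds e by (simp add: mul_el src_mul)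
  fix g assume g: "g \<in> into S (dm S f)"
  show "?F (cmp S f g) (map (rr S g) ds) = rs G g (?F f ds)"
    using f g ds e by (simp add: mul_rs[OF g] ginv_rs[OF g] rr_cmp[OF f g] Dset_carrier)
qed

lemma side_rs: "\<lbrakk>g \<in> into S b; e \<in> Dset S b\<rbrakk> \<Longrightarrow>
    rsf S (Dn S 1) g (side1 S G b \<gamma> e) = side1 S G (dm S g) (rsf S (Dn S 2) g \<gamma>) (rr S g e)"
  unfolding side1_def rsf_def[of S _ g "ilam _ _ _ _"] by (rule ilam_cong) (auto simp: rr_cmp Dset_carrier)

lemma side_scl0: "\<lbrakk>b \<in> Ob S; e \<in> Dset S b; a \<in> carrier (rg S b)\<rbrakk> \<Longrightarrow>
    side1 S G b (scl S 2 0 b a \<gamma>) e = side1 S G b \<gamma> (a \<otimes>\<^bsub>rg S b\<^esub> e)"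
  unfolding side1_def by (rule ilam_cong) (auto simp: scl2_apply Dset_carrier)

text \<open>As a 0 = 0, the factor \<gamma>(e, 0) by which the side is normalised is not affected by
  the scaling; the same reason keeps the first axis fixed in \<open>face_scl1\<close>.\<close>

lemma side_scl1: "\<lbrakk>b \<in> Ob S; e \<in> Dset S b; a \<in> carrier (rg S b)\<rbrakk> \<Longrightarrow>
    side1 S G b (scl S 2 1 b a \<gamma>) e = scl S 1 0 b a (side1 S G b \<gamma> e)"
  unfolding scl_def[of S 1] side1_def
proof (rule ilam_cong)
  fix f ds assume b: "b \<in> Ob S" "e \<in> Dset S b" "a \<in> carrier (rg S b)" and f: "f \<in> into S b" and "ds \<in> el (Dn S 1) (dm S f)"
  then obtain d where ds: "ds = [d]" "d \<in> Dset S (dm S f)" by auto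
  interpret R: cring "rg S (dm S f)" using f by (intro cring_at) simp
  show "mul G (dm S f) (scl S 2 1 b a \<gamma> f [rr S f e, ds ! 0]) (ginv G (dm S f) (scl S 2 1 b a \<gamma> f [rr S f e, \<zero>\<^bsub>rg S (dm S f)\<^esub>])) =
    ilam S (Dn S 1) b (\<lambda>f ds. mul G (dm S f) (\<gamma> f [rr S f e, ds ! 0]) (ginv G (dm S f) (\<gamma> f [rr S f e, \<zero>\<^bsub>rg S (dm S f)\<^esub>])))
      f (ds[0 := rr S f a \<otimes>\<^bsub>rg S (dm S f)\<^esub> ds ! 0])"
    using f ds b by (simp add: scl2_apply)
qed

lemma face_scl0: "\<lbrakk>b \<in> Ob S; a \<in> carrier (rg S b)\<rbrakk> \<Longrightarrow>
    face S 1 b (scl S 2 0 b a \<gamma>) = scl S 1 0 b a (face S 1 b \<gamma>)"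
  unfolding scl_def[of S 1] face_def by (rule ilam_cong) (auto simp: scl2_apply)

lemma face_scl1: 
  assumes "b \<in> Ob S" "a \<in> carrier (rg S b)"
  shows "face S 1 b (scl S 2 1 b a \<gamma>) = face S 1 b \<gamma>"
  unfolding face_def
proof (rule ilam_cong)
  fix f ds assume f: "f \<in> into S b" and "ds \<in> el (Dn S 1) (dm S f)"
  then obtain d where ds: "ds = [d]" "d \<in> Dset S (dm S f)" by auto
  interpret R: cring "rg S (dm S f)" using f by (intro cring_at) simp
  show "scl S 2 1 b a \<gamma> f (if (1::nat) = 0 then [\<zero>\<^bsub>rg S (dm S f)\<^esub>, ds ! 0] else [ds ! 0, \<zero>\<^bsub>rg S (dm S f)\<^esub>]) =
     \<gamma> f (if (1::nat) = 0 then [\<zero>\<^bsub>rg S (dm S f)\<^esub>, ds ! 0] else [ds ! 0, \<zero>\<^bsub>rg S (dm S f)\<^esub>])"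
    using f ds assms by (simp add: scl2_apply)
qed

end

section \<open>Transported sides\<close>

text \<open>The representation and the form are internal elements at the stage c, that is, families
  indexed by arrows into c. Each statement below therefore concerns an arrow f into c and squares at
  the domain of f.\<close>

locale rep_form = gbundle S M L + G: grpd_obj S M G
  for S :: "('o, 'a, 'r) line" and M :: "('o, 'a, 'p) psh" and L :: "('o, 'a, 'p, 'l) grpd"
    and G :: "('o, 'a, 'p, 'g) grpd" +
  fixes c :: 'o and \<rho>1 \<rho>2
    and \<omega> :: "'a \<Rightarrow> ('a \<Rightarrow> 'r list \<Rightarrow> 'g) \<Rightarrow> 'a \<Rightarrow> 'r list \<Rightarrow> 'l"
  assumes rep: "representation S M G E c \<rho>1 \<rho>2"
    and form: "\<omega> \<in> forms S M G E 1 c"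
begin

abbreviation "\<Phi> \<equiv> Phi_Lin S M E"

lemma Phi_fields: "src \<Phi> b (x, y, \<phi>) = x" "tgt \<Phi> b (x, y, \<phi>) = y"
    "unt \<Phi> b x = (x, x, dlam S (fam S M E x) b (\<lambda>f v. v))"
    "rs \<Phi> f (x, y, \<phi>) = (rs M f x, rs M f y, dlam S (fam S M E (rs M f x)) (dm S f) (\<lambda>g. \<phi> (cmp S f g)))"
  by (simp_all add: Phi_Lin_def)

lemma rho_expo:
  assumes f: "f \<in> into S c" and t: "t \<in> el (An S M G 1) (dm S f)"
  shows "\<rho>1 f t \<in> el (expo S (Dn S 1) \<Phi>) (dm S f)"
    and "\<rho>1 f t (idt S (dm S f)) [\<zero>\<^bsub>rg S (dm S f)\<^esub>] = unt \<Phi> (dm S f) (bpt S G 1 (dm S f) t)"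
    and "g \<in> into S (dm S f) \<Longrightarrow> \<rho>1 (cmp S f g) (rsf S (Dn S 1) g t) = rsf S (Dn S 1) g (\<rho>1 f t)"
    and "a \<in> carrier (rg S (dm S f)) \<Longrightarrow> \<rho>1 f (scl S 1 0 (dm S f) a t) = scl S 1 0 (dm S f) a (\<rho>1 f t)"
    and "d \<in> Dset S (dm S f) \<Longrightarrow> src \<Phi> (dm S f) (\<rho>1 f t (idt S (dm S f)) [d]) = bpt S G 1 (dm S f) t"
    and "d \<in> Dset S (dm S f) \<Longrightarrow> tgt \<Phi> (dm S f) (\<rho>1 f t (idt S (dm S f)) [d]) = tgt G (dm S f) (t (idt S (dm S f)) [d])"
proof -
  have b: "dm S f \<in> Ob S" using f by simp
  have anc: "anchored_hom S M G \<Phi> 1 c \<rho>1" and lin: "\<forall>f\<in>into S c. let b = dm S f in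
      \<forall>t\<in>el (An S M G 1) b. \<forall>a\<in>carrier (rg S b). \<rho>1 f (scl S 1 0 b a t) = scl S 1 0 b a (\<rho>1 f t)"
    using rep unfolding representation_def nishimura_hom_def Let_def by blast+
  have ex: "\<rho>1 \<in> el (expo S (An S M G 1) (An S M \<Phi> 1)) c"
    and bp: "bpt S \<Phi> 1 (dm S f) (\<rho>1 f t) = bpt S G 1 (dm S f) t"
    and tg: "\<forall>g\<in>into S (dm S f). \<forall>ds\<in>el (Dn S 1) (dm S g).
           tgt \<Phi> (dm S g) (\<rho>1 f t g ds) = tgt G (dm S g) (t g ds)"
    using anc f t unfolding anchored_hom_def by blast+
  have r: "\<rho>1 f t \<in> el (An S M \<Phi> 1) (dm S f)" by (rule expo_el[OF ex f t])
  then show "\<rho>1 f t \<in> el (expo S (Dn S 1) \<Phi>) (dm S f)"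
    "\<rho>1 f t (idt S (dm S f)) [\<zero>\<^bsub>rg S (dm S f)\<^esub>] = unt \<Phi> (dm S f) (bpt S G 1 (dm S f) t)"
    by (simp_all add: An_def bp)
  have m: "bpt S G 1 (dm S f) t \<in> el M (dm S f)" by (rule G.bpt_el[OF b t])
  show "src \<Phi> (dm S f) (\<rho>1 f t (idt S (dm S f)) [d]) = bpt S G 1 (dm S f) t" if "d \<in> Dset S (dm S f)"
  proof -
    have "\<forall>g\<in>into S (dm S f). \<forall>ds\<in>el (Dn S 1) (dm S g).
       src \<Phi> (dm S g) (\<rho>1 f t g ds) = rs M g (bpt S G 1 (dm S f) t)"
      using r by (simp add: An_def bp)
    from bspec[OF bspec[OF this, of "idt S (dm S f)"], of "[d]"] show ?thesis
      using b m that by (simp add: psh_idt[OF M_psh])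
  qed
  show "tgt \<Phi> (dm S f) (\<rho>1 f t (idt S (dm S f)) [d]) = tgt G (dm S f) (t (idt S (dm S f)) [d])"
    if "d \<in> Dset S (dm S f)"
    using bspec[OF bspec[OF tg, of "idt S (dm S f)"], of "[d]"] b that by simp
  show "\<rho>1 (cmp S f g) (rsf S (Dn S 1) g t) = rsf S (Dn S 1) g (\<rho>1 f t)" if g: "g \<in> into S (dm S f)"
    using expo_nat[OF ex f g t] by (simp add: An_def)
  show "\<rho>1 f (scl S 1 0 (dm S f) a t) = scl S 1 0 (dm S f) a (\<rho>1 f t)" if "a \<in> carrier (rg S (dm S f))"
    using lin f t that by (simp add: Let_def)
qed

lemma rho_at:
  assumes f: "f \<in> into S c" and t: "t \<in> el (An S M G 1) (dm S f)" and d: "d \<in> Dset S (dm S f)"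
  obtains \<phi> where "\<rho>1 f t (idt S (dm S f)) [d] =
      (bpt S G 1 (dm S f) t, tgt G (dm S f) (t (idt S (dm S f)) [d]), \<phi>)"
    and "(bpt S G 1 (dm S f) t, tgt G (dm S f) (t (idt S (dm S f)) [d]), \<phi>) \<in> el \<Phi> (dm S f)"
proof -
  have b: "dm S f \<in> Ob S" using f by simp
  have "\<rho>1 f t (idt S (dm S f)) [d] \<in> el \<Phi> (dm S f)"
    using expo_el[OF rho_expo(1)[OF f t], of "idt S (dm S f)" "[d]"] b d by simp
  moreover obtain x y \<phi> where P: "\<rho>1 f t (idt S (dm S f)) [d] = (x, y, \<phi>)"
    by (cases "\<rho>1 f t (idt S (dm S f)) [d]") auto
  moreover have "x = bpt S G 1 (dm S f) t" "y = tgt G (dm S f) (t (idt S (dm S f)) [d])"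
    using rho_expo(5,6)[OF f t d] by (simp_all add: P Phi_fields)
  ultimately show ?thesis using that by simp
qed

lemma rho_rs:
  assumes f: "f \<in> into S c" and t: "t \<in> el (An S M G 1) (dm S f)" and d: "d \<in> Dset S (dm S f)"
    and g: "g \<in> into S (dm S f)"
  shows "\<rho>1 (cmp S f g) (rsf S (Dn S 1) g t) (idt S (dm S g)) [rr S g d] = rs \<Phi> g (\<rho>1 f t (idt S (dm S f)) [d])"
proof -
  have b: "dm S f \<in> Ob S" using f by simp
  have "\<rho>1 (cmp S f g) (rsf S (Dn S 1) g t) (idt S (dm S g)) [rr S g d] = \<rho>1 f t g [rr S g d]"
    using g d by (simp add: rho_expo(3)[OF f t g])
  also have "\<dots> = rs \<Phi> g (\<rho>1 f t (idt S (dm S f)) [d])"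
    using expo_nat[OF rho_expo(1)[OF f t], of "idt S (dm S f)" g "[d]"] b g d by simp
  finally show ?thesis .
qed

lemma omega_at:
  assumes f: "f \<in> into S c" and t: "t \<in> el (An S M G 1) (dm S f)"
  shows "\<omega> f t \<in> el (An S M L 1) (dm S f)" "bpt S L 1 (dm S f) (\<omega> f t) = bpt S G 1 (dm S f) t"
    and "a \<in> carrier (rg S (dm S f)) \<Longrightarrow> \<omega> f (scl S 1 0 (dm S f) a t) = scl S 1 0 (dm S f) a (\<omega> f t)"
    and "g \<in> into S (dm S f) \<Longrightarrow> \<omega> (cmp S f g) (rsf S (Dn S 1) g t) = rsf S (Dn S 1) g (\<omega> f t)"
proof -
  have ex: "\<omega> \<in> el (expo S (An S M G 1) E) c" using form by (simp add: forms_def)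
  show "\<omega> f t \<in> el (An S M L 1) (dm S f)" using expo_el[OF ex f t] by simp
  show "\<omega> (cmp S f g) (rsf S (Dn S 1) g t) = rsf S (Dn S 1) g (\<omega> f t)" if "g \<in> into S (dm S f)"
    using expo_nat[OF ex f that t] by (simp add: An_def)
  show "bpt S L 1 (dm S f) (\<omega> f t) = bpt S G 1 (dm S f) t"
    "a \<in> carrier (rg S (dm S f)) \<Longrightarrow> \<omega> f (scl S 1 0 (dm S f) a t) = scl S 1 0 (dm S f) a (\<omega> f t)"
    using form f t by (simp_all add: forms_def Let_def)
qed

text \<open>\<open>tside f \<gamma> d\<close> is the transported side \<open>(\<rho>(\<gamma>\<^sub>1)\<^sub>d)\<^sup>-\<^sup>1 (\<omega>(\<gamma>\<^sup>1\<^sub>d))\<close>.\<close>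

definition tside :: "'a \<Rightarrow> ('a \<Rightarrow> 'r list \<Rightarrow> 'g) \<Rightarrow> 'r \<Rightarrow> 'a \<Rightarrow> 'r list \<Rightarrow> 'l" where
  "tside f \<gamma> d = transport S M E (dm S f) (\<rho>1 f (face S 1 (dm S f) \<gamma>)) d (\<omega> f (side1 S G (dm S f) \<gamma> d))"

text \<open>The interface to transport: with \<phi> the isomorphism given by \<rho> on the first
  axis at d, the transported side is the vector over the base point of \<gamma> that \<phi> sends to
  the value of \<omega>. Since transport undoes \<phi>, equations for \<open>tside\<close> are
  proved after applying \<phi>.\<close>

lemma tside_char:
  assumes f: "f \<in> into S c" and \<gamma>: "\<gamma> \<in> el (An S M G 2) (dm S f)" and d: "d \<in> Dset S (dm S f)"
  obtains y \<phi> where "\<rho>1 f (face S 1 (dm S f) \<gamma>) (idt S (dm S f)) [d] = (bpt S G 2 (dm S f) \<gamma>, y, \<phi>)"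
    and "\<phi> \<in> lin_iso S M E (dm S f) (bpt S G 2 (dm S f) \<gamma>) y"
    and "tside f \<gamma> d \<in> fib E (dm S f) (bpt S G 2 (dm S f) \<gamma>)"
    and "\<phi> (idt S (dm S f)) (tside f \<gamma> d) = \<omega> f (side1 S G (dm S f) \<gamma> d)"
    and "\<forall>v\<in>fib E (dm S f) (bpt S G 2 (dm S f) \<gamma>).
      transport S M E (dm S f) (\<rho>1 f (face S 1 (dm S f) \<gamma>)) d (\<phi> (idt S (dm S f)) v) = v"
proof -
  let ?b = "dm S f"
  have b: "?b \<in> Ob S" using f by simp
  note face = G.face_An[OF \<gamma> b] and side = G.side_An[OF \<gamma> b d]
  obtain \<phi> where P: "\<rho>1 f (face S 1 ?b \<gamma>) (idt S ?b) [d] =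
      (bpt S G 2 ?b \<gamma>, tgt G ?b (face S 1 ?b \<gamma> (idt S ?b) [d]), \<phi>)"
    and Q: "(bpt S G 2 ?b \<gamma>, tgt G ?b (face S 1 ?b \<gamma> (idt S ?b) [d]), \<phi>) \<in> el \<Phi> ?b"
    using rho_at[OF f conjunct1[OF face] d] face by metis
  \<comment> \<open>The first axis at d ends where the side at d begins, so the value of \<omega>
    does lie in the fibre on which the inverse isomorphism acts.\<close>
  have y: "tgt G ?b (face S 1 ?b \<gamma> (idt S ?b) [d]) = bpt S G 1 ?b (side1 S G ?b \<gamma> d)"
    using side G.face_apply(1)[of "idt S ?b" ?b d \<gamma>] b d by simp
  have w: "\<omega> f (side1 S G ?b \<gamma> d) \<in> fib E ?b (tgt G ?b (face S 1 ?b \<gamma> (idt S ?b) [d]))"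
    using side by (simp add: fib_iff omega_at[OF f] y)
  note l = lapp_ginv_Phi[OF b Q]
  show ?thesis
  proof (rule that[OF P])
    show "\<phi> \<in> lin_iso S M E ?b (bpt S G 2 ?b \<gamma>) (tgt G ?b (face S 1 ?b \<gamma> (idt S ?b) [d]))"
      using Q by (simp add: Phi_iff)
    show "tside f \<gamma> d \<in> fib E ?b (bpt S G 2 ?b \<gamma>)" "\<phi> (idt S ?b) (tside f \<gamma> d) = \<omega> f (side1 S G ?b \<gamma> d)"
      using l(1,2)[OF w] by (simp_all add: tside_def transport_def P)
    show "\<forall>v\<in>fib E ?b (bpt S G 2 ?b \<gamma>). transport S M E ?b (\<rho>1 f (face S 1 ?b \<gamma>)) d (\<phi> (idt S ?b) v) = v"
      using l(3) by (simp add: transport_def P)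
  qed
qed

lemma tside_A1:
  assumes "f \<in> into S c" "\<gamma> \<in> el (An S M G 2) (dm S f)" "d \<in> Dset S (dm S f)"
  shows "tside f \<gamma> d \<in> el (An S M L 1) (dm S f)" "bpt S L 1 (dm S f) (tside f \<gamma> d) = bpt S G 2 (dm S f) \<gamma>"
  using tside_char[OF assms] by (metis fib_iff)+

text \<open>By naturality of \<rho> the isomorphism at the later stage is the restriction of \<phi>,
  and by naturality of \<phi> it sends the restricted vector to the restricted value of
  \<omega>.\<close>

lemma tside_rs:
  assumes f: "f \<in> into S c" and \<gamma>: "\<gamma> \<in> el (An S M G 2) (dm S f)" and d: "d \<in> Dset S (dm S f)"
    and g: "g \<in> into S (dm S f)"
  shows "tside (cmp S f g) (rsf S (Dn S 2) g \<gamma>) (rr S g d) = rsf S (Dn S 1) g (tside f \<gamma> d)"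
proof -
  let ?b = "dm S f" and ?\<gamma> = "rsf S (Dn S 2) g \<gamma>"
  have b: "?b \<in> Ob S" and b': "dm S g \<in> Ob S" using f g by simp_all
  have fg: "cmp S f g \<in> into S c" "dm S (cmp S f g) = dm S g" using f g by simp_all
  have \<gamma>': "?\<gamma> \<in> el (An S M G 2) (dm S g)" "bpt S G 2 (dm S g) ?\<gamma> = rs M g (bpt S G 2 ?b \<gamma>)"
    using G.rsf_An[OF \<gamma> g] by simp_all
  have x: "bpt S G 2 ?b \<gamma> \<in> el M ?b" by (rule G.bpt_el[OF b \<gamma>])
  obtain y \<phi> where P: "\<rho>1 f (face S 1 ?b \<gamma>) (idt S ?b) [d] = (bpt S G 2 ?b \<gamma>, y, \<phi>)"
    and \<phi>: "\<phi> \<in> lin_iso S M E ?b (bpt S G 2 ?b \<gamma>) y"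
    and v: "tside f \<gamma> d \<in> fib E ?b (bpt S G 2 ?b \<gamma>)"
    and \<phi>v: "\<phi> (idt S ?b) (tside f \<gamma> d) = \<omega> f (side1 S G ?b \<gamma> d)"
    by (rule tside_char[OF f \<gamma> d])
  obtain y' \<phi>' where P': "\<rho>1 (cmp S f g) (face S 1 (dm S g) ?\<gamma>) (idt S (dm S g)) [rr S g d] =
      (bpt S G 2 (dm S g) ?\<gamma>, y', \<phi>')"
    and U: "\<forall>v\<in>fib E (dm S g) (bpt S G 2 (dm S g) ?\<gamma>).
      transport S M E (dm S g) (\<rho>1 (cmp S f g) (face S 1 (dm S g) ?\<gamma>)) (rr S g d) (\<phi>' (idt S (dm S g)) v) = v"
    using tside_char[OF fg(1), of ?\<gamma> "rr S g d"] \<gamma>'(1) g d unfolding fg(2) by (metis Dset_rr)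
  have "\<rho>1 (cmp S f g) (rsf S (Dn S 1) g (face S 1 ?b \<gamma>)) (idt S (dm S g)) [rr S g d] =
      rs \<Phi> g (bpt S G 2 ?b \<gamma>, y, \<phi>)"
    using rho_rs[OF f conjunct1[OF G.face_An[OF \<gamma> b]] d g] by (simp add: P)
  then have \<phi>': "\<phi>' = dlam S (fam S M E (rs M g (bpt S G 2 ?b \<gamma>))) (dm S g) (\<lambda>h. \<phi> (cmp S g h))"
    using P' by (simp add: G.face_rs[OF g] Phi_fields)
  have rv: "rsf S (Dn S 1) g (tside f \<gamma> d) \<in> fib E (dm S g) (rs M g (bpt S G 2 ?b \<gamma>))"
    using v rsf_An[OF _ g, of "tside f \<gamma> d" 1] by (simp add: fib_iff)
  have "\<phi>' (idt S (dm S g)) (rsf S (Dn S 1) g (tside f \<gamma> d)) = \<phi> g (rsf S (Dn S 1) g (tside f \<gamma> d))"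
    using rv g b' x by (simp add: \<phi>' dlam_def fam_idt rs_M)
  also have "\<dots> = rsf S (Dn S 1) g (\<phi> (idt S ?b) (tside f \<gamma> d))"
    using lin_isoD(4)[OF \<phi>, of "idt S ?b" "tside f \<gamma> d" g] b g v x by (simp add: fam_idt)
  also have "\<dots> = \<omega> (cmp S f g) (side1 S G (dm S g) ?\<gamma> (rr S g d))"
    using omega_at(4)[OF f conjunct1[OF G.side_An[OF \<gamma> b d]] g] by (simp add: \<phi>v G.side_rs[OF g d])
  finally show ?thesis
    using bspec[OF U, of "rsf S (Dn S 1) g (tside f \<gamma> d)"] rv by (simp add: tside_def[of "cmp S f g"] fg \<gamma>'(2))
qed

text \<open>At parameter 0 the representation gives the identity, so nothing is transported.\<close>

lemma tside_zero:
  assumes f: "f \<in> into S c" and \<gamma>: "\<gamma> \<in> el (An S M G 2) (dm S f)"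
  shows "tside f \<gamma> \<zero>\<^bsub>rg S (dm S f)\<^esub> = \<omega> f (side1 S G (dm S f) \<gamma> \<zero>\<^bsub>rg S (dm S f)\<^esub>)"
proof -
  let ?b = "dm S f"
  have b: "?b \<in> Ob S" using f by simp
  have z: "\<zero>\<^bsub>rg S ?b\<^esub> \<in> Dset S ?b" using b by simp
  have x: "bpt S G 2 ?b \<gamma> \<in> el M ?b" by (rule G.bpt_el[OF b \<gamma>])
  obtain y \<phi> where P: "\<rho>1 f (face S 1 ?b \<gamma>) (idt S ?b) [\<zero>\<^bsub>rg S ?b\<^esub>] = (bpt S G 2 ?b \<gamma>, y, \<phi>)"
    and v: "tside f \<gamma> \<zero>\<^bsub>rg S ?b\<^esub> \<in> fib E ?b (bpt S G 2 ?b \<gamma>)"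
    and \<phi>v: "\<phi> (idt S ?b) (tside f \<gamma> \<zero>\<^bsub>rg S ?b\<^esub>) = \<omega> f (side1 S G ?b \<gamma> \<zero>\<^bsub>rg S ?b\<^esub>)"
    by (rule tside_char[OF f \<gamma> z])
  have "\<phi> = dlam S (fam S M E (bpt S G 2 ?b \<gamma>)) ?b (\<lambda>f v. v)"
    using rho_expo(2)[OF f conjunct1[OF G.face_An[OF \<gamma> b]]] G.face_An[OF \<gamma> b] by (simp add: P Phi_fields)
  then have "\<phi> (idt S ?b) (tside f \<gamma> \<zero>\<^bsub>rg S ?b\<^esub>) = tside f \<gamma> \<zero>\<^bsub>rg S ?b\<^esub>"
    using v b x by (simp add: dlam_def fam_idt)
  then show ?thesis using \<phi>v by simp
qed

lemma tside_scl0: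
  assumes f: "f \<in> into S c" and \<gamma>: "\<gamma> \<in> el (An S M G 2) (dm S f)" and d: "d \<in> Dset S (dm S f)"
    and a: "a \<in> carrier (rg S (dm S f))"
  shows "tside f (scl S 2 0 (dm S f) a \<gamma>) d = tside f \<gamma> (a \<otimes>\<^bsub>rg S (dm S f)\<^esub> d)"
proof -
  have b: "dm S f \<in> Ob S" using f by simp
  show ?thesis
    using G.face_An[OF \<gamma> b] b d a
    by (simp add: tside_def G.face_scl0 G.side_scl0 transport_def rho_expo(4)[OF f])
      (simp add: scl_def rr_idt)
qed

text \<open>The first axis, hence the isomorphism, is the same for both squares; \<omega> and the
  isomorphism commute with scalars.\<close>

lemma tside_scl1:
  assumes f: "f \<in> into S c" and \<gamma>: "\<gamma> \<in> el (An S M G 2) (dm S f)" and d: "d \<in> Dset S (dm S f)"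
    and a: "a \<in> carrier (rg S (dm S f))"
  shows "tside f (scl S 2 1 (dm S f) a \<gamma>) d = scl S 1 0 (dm S f) a (tside f \<gamma> d)"
proof -
  let ?b = "dm S f"
  have b: "?b \<in> Ob S" using f by simp
  have x: "bpt S G 2 ?b \<gamma> \<in> el M ?b" by (rule G.bpt_el[OF b \<gamma>])
  obtain y \<phi> where "\<rho>1 f (face S 1 ?b \<gamma>) (idt S ?b) [d] = (bpt S G 2 ?b \<gamma>, y, \<phi>)"
    and \<phi>: "\<phi> \<in> lin_iso S M E ?b (bpt S G 2 ?b \<gamma>) y"
    and v: "tside f \<gamma> d \<in> fib E ?b (bpt S G 2 ?b \<gamma>)"
    and \<phi>v: "\<phi> (idt S ?b) (tside f \<gamma> d) = \<omega> f (side1 S G ?b \<gamma> d)"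
    and U: "\<forall>v\<in>fib E ?b (bpt S G 2 ?b \<gamma>).
      transport S M E ?b (\<rho>1 f (face S 1 ?b \<gamma>)) d (\<phi> (idt S ?b) v) = v"
    by (rule tside_char[OF f \<gamma> d])
  have "scl S 1 0 ?b a (tside f \<gamma> d) \<in> fib E ?b (bpt S G 2 ?b \<gamma>)"
    using v A1_scl[of "tside f \<gamma> d" ?b a] a b by (simp add: fib_iff)
  moreover have "\<phi> (idt S ?b) (scl S 1 0 ?b a (tside f \<gamma> d)) = \<omega> f (side1 S G ?b (scl S 2 1 ?b a \<gamma>) d)"
    using lin_isoD(3)[OF \<phi>, of "idt S ?b" "tside f \<gamma> d" a] v a b x omega_at(3)[OF f, of "side1 S G ?b \<gamma> d" a]
      G.side_An[OF \<gamma> b d] d by (simp add: fam_idt \<phi>v G.side_scl1)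
  ultimately show ?thesis
    unfolding tside_def[of f "scl S 2 1 ?b a \<gamma>"] G.face_scl1[OF b a] using U by metis
qed

end

section \<open>Linear dependence of a transported side on its parameter\<close>

context rep_form begin

text \<open>Let v be the transported side at 0. The inverse of v(e) times A(d)(e) is the unit for d
  = 0, since A(0) = v, and for e = 0, since all tangents start at the unit; so it depends on d e
  alone. Additively this reads A(d) = v + d a, which makes a the derivative of the transported
  side.\<close>

lemma tside_factor:
  assumes f: "f \<in> into S c" and \<gamma>: "\<gamma> \<in> el (An S M G 2) (dm S f)"
  obtains a where "a \<in> el (An S M L 1) (dm S f)" "bpt S L 1 (dm S f) a = bpt S G 2 (dm S f) \<gamma>"
    and "\<And>g d e. \<lbrakk>g \<in> into S (dm S f); d \<in> Dset S (dm S g); e \<in> Dset S (dm S g)\<rbrakk> \<Longrightarrow>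
      tside (cmp S f g) (rsf S (Dn S 2) g \<gamma>) d (idt S (dm S g)) [e] =
        mul L (dm S g) (tside f \<gamma> \<zero>\<^bsub>rg S (dm S f)\<^esub> g [e]) (a g [d \<otimes>\<^bsub>rg S (dm S g)\<^esub> e])"
proof -
  let ?b = "dm S f" and ?x = "bpt S G 2 (dm S f) \<gamma>"
  let ?v = "tside f \<gamma> \<zero>\<^bsub>rg S ?b\<^esub>"
  let ?T = "\<lambda>g d e. tside (cmp S f g) (rsf S (Dn S 2) g \<gamma>) d (idt S (dm S g)) [e]"
  let ?F = "\<lambda>g d e. mul L (dm S g) (ginv L (dm S g) (?v g [e])) (?T g d e)"
  have b: "?b \<in> Ob S" using f by simp
  have x: "?x \<in> el M ?b" by (rule G.bpt_el[OF b \<gamma>])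
  have v: "?v \<in> el (An S M L 1) ?b" "bpt S L 1 ?b ?v = ?x" using tside_A1[OF f \<gamma>] b by simp_all
  have TA: "tside (cmp S f g) (rsf S (Dn S 2) g \<gamma>) d \<in> el (An S M L 1) (dm S g)"
      "bpt S L 1 (dm S g) (tside (cmp S f g) (rsf S (Dn S 2) g \<gamma>) d) = rs M g ?x"
    if "g \<in> into S ?b" "d \<in> Dset S (dm S g)" for g d
    using tside_A1[of "cmp S f g" "rsf S (Dn S 2) g \<gamma>" d] G.rsf_An[OF \<gamma> that(1)] f that by simp_all
  have T: "?T g d e \<in> el L (dm S g)" "src L (dm S g) (?T g d e) = rs M g ?x"
      "?T g d \<zero>\<^bsub>rg S (dm S g)\<^esub> = unt L (dm S g) (rs M g ?x)"
    if g: "g \<in> into S ?b" "d \<in> Dset S (dm S g)" "e \<in> Dset S (dm S g)" for g d e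
    using A1_at(1-3)[OF TA(1)[OF g(1,2)], of "idt S (dm S g)"] g TA(2)[OF g(1,2)]
    by (simp_all add: psh_idt[OF M_psh] rs_M[OF _ x])
  have T0: "?T g \<zero>\<^bsub>rg S (dm S g)\<^esub> e = ?v g [e]" if g: "g \<in> into S ?b" "e \<in> Dset S (dm S g)" for g e
    using tside_rs[OF f \<gamma> _ g(1), of "\<zero>\<^bsub>rg S ?b\<^esub>"] g b by simp
  have TN: "?T (cmp S g h) (rr S h d) (rr S h e) = rs L h (?T g d e)"
    if g: "g \<in> into S ?b" "d \<in> Dset S (dm S g)" "e \<in> Dset S (dm S g)" "h \<in> into S (dm S g)" for g h d e
  proof -
    have fg: "cmp S f g \<in> into S c" "dm S (cmp S f g) = dm S g" using f g by simp_all
    have "tside (cmp S (cmp S f g) h) (rsf S (Dn S 2) h (rsf S (Dn S 2) g \<gamma>)) (rr S h d) =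
        rsf S (Dn S 1) h (tside (cmp S f g) (rsf S (Dn S 2) g \<gamma>) d)"
      using tside_rs[OF fg(1), of "rsf S (Dn S 2) g \<gamma>" d h] G.rsf_An[OF \<gamma> g(1)] g by (simp add: fg(2))
    then have "?T (cmp S g h) (rr S h d) (rr S h e) = tside (cmp S f g) (rsf S (Dn S 2) g \<gamma>) d h [rr S h e]"
      using f g by (simp add: cmp_assoc[OF f g(1,4)] rsf_cmp[OF g(1,4)])
    also have "\<dots> = rs L h (?T g d e)"
      using A1_at(4)[OF TA(1)[OF g(1,2)], of "idt S (dm S g)" e h] g by simp
    finally show ?thesis .
  qed
  note V = A1_at[OF v(1)]
  have grp: "group (fgrp (dm S g) (rs M g ?x))" if "g \<in> into S ?b" for g
    using that by (intro fgrp_group rs_M[OF _ x]) simp_all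
  have inv: "ginv L (dm S g) (?v g [e]) = inv\<^bsub>fgrp (dm S g) (rs M g ?x)\<^esub> (?v g [e])"
    if "g \<in> into S ?b" "e \<in> Dset S (dm S g)" for g e
    using that V(1,2) v(2) by (intro fgrp_inv[symmetric] rs_M[OF _ x]) simp_all
  obtain a where a: "a \<in> el (An S M L 1) ?b" "bpt S L 1 ?b a = ?x"
    and aF: "\<And>g d e. \<lbrakk>g \<in> into S ?b; d \<in> Dset S (dm S g); e \<in> Dset S (dm S g)\<rbrakk> \<Longrightarrow>
      a g [d \<otimes>\<^bsub>rg S (dm S g)\<^esub> e] = ?F g d e"
  proof (rule A1_factor[OF b x, of ?F])
    fix g d e assume g: "g \<in> into S ?b" "d \<in> Dset S (dm S g)" "e \<in> Dset S (dm S g)"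
    show "?F g d e \<in> el L (dm S g) \<and> src L (dm S g) (?F g d e) = rs M g ?x"
      using g V T[OF g] v(2) by (simp add: mul_el src_mul ginv_el src_ginv src_tgt)
    fix h assume h: "h \<in> into S (dm S g)"
    have gh: "cmp S g h \<in> into S ?b" "dm S (cmp S g h) = dm S h" using g h by simp_all
    show "?F (cmp S g h) (rr S h d) (rr S h e) = rs L h (?F g d e)"
      using g h V T[OF g] v(2) TN[OF g h]
      by (simp add: gh(2) mul_rs[OF h] ginv_rs[OF h] ginv_el src_ginv src_tgt)
  next
    fix g d assume g: "g \<in> into S ?b" "d \<in> Dset S (dm S g)"
    have z: "\<zero>\<^bsub>rg S (dm S g)\<^esub> \<in> Dset S (dm S g)" using g by simp
    show "?F g d \<zero>\<^bsub>rg S (dm S g)\<^esub> = unt L (dm S g) (rs M g ?x) \<and>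
      ?F g \<zero>\<^bsub>rg S (dm S g)\<^esub> d = unt L (dm S g) (rs M g ?x)"
      using g V T(3)[OF g z] T0[OF g] v(2) mul_unt(1)[of "dm S g" "unt L (dm S g) (rs M g ?x)"]
      by (simp add: ginv_mul rs_M[OF _ x])
  qed blast
  show ?thesis
  proof (rule that[OF a])
    fix g d e assume g: "g \<in> into S ?b" "d \<in> Dset S (dm S g)" "e \<in> Dset S (dm S g)"
    interpret U: group "fgrp (dm S g) (rs M g ?x)" by (rule grp[OF g(1)])
    have "mul L (dm S g) (?v g [e]) (?F g d e) = ?T g d e"
      using U.inv_solve_left'[of "?v g [e]" "?T g d e"] U.m_assoc[of "?v g [e]" "ginv L (dm S g) (?v g [e])" "?T g d e"]
        U.r_inv[of "?v g [e]"] U.l_one[of "?T g d e"] g V T[OF g] v(2) inv[OF g(1,3)] U.inv_closed[of "?v g [e]"]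
      by simp
    then show "?T g d e = mul L (dm S g) (?v g [e]) (a g [d \<otimes>\<^bsub>rg S (dm S g)\<^esub> e])"
      by (simp add: aF[OF g])
  qed
qed

end

section \<open>Computations in a single group\<close>

lemma (in group) commute_inv:
  assumes "x \<in> carrier G" "y \<in> carrier G" "x \<otimes> y = y \<otimes> x"
  shows "x \<otimes> inv y = inv y \<otimes> x"
proof -
  have "x \<otimes> inv y = inv y \<otimes> (y \<otimes> x) \<otimes> inv y"
    using assms(1,2) by (simp add: m_assoc[symmetric])
  also have "\<dots> = inv y \<otimes> (x \<otimes> y) \<otimes> inv y" by (simp add: assms(3))
  also have "\<dots> = inv y \<otimes> x" using assms(1,2) by (simp add: m_assoc)
  finally show ?thesis .
qed

text \<open>Used with u and v evaluated at d and e, p = a at d e and q = a' at -(d e). As p and q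
  commute with every letter, they are pulled to the front, and the commutator of v and u
  remains.\<close>

lemma (in group) contour_calc:
  assumes c: "u \<in> carrier G" "v \<in> carrier G" "p \<in> carrier G" "q \<in> carrier G"
    and pq: "p \<otimes> u = u \<otimes> p" "p \<otimes> v = v \<otimes> p" "q \<otimes> u = u \<otimes> q" "q \<otimes> v = v \<otimes> q" "q \<otimes> p = p \<otimes> q"
  shows "inv v \<otimes> ((inv u \<otimes> q) \<otimes> ((v \<otimes> p) \<otimes> u)) = (p \<otimes> q) \<otimes> (inv v \<otimes> (inv u \<otimes> (v \<otimes> u)))"
proof -
  \<comment> \<open>Left-commutation: together with associativity it lets rewriting move p and q
    past a letter inside a longer product.\<close>
  have L: "x \<otimes> (y \<otimes> z) = y \<otimes> (x \<otimes> z)" if "x \<otimes> y = y \<otimes> x" "x \<in> carrier G" "y \<in> carrier G" "z \<in> carrier G" for x y z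
    using that by (metis m_assoc)
  note C = commute_inv[OF c(3,1) pq(1)] commute_inv[OF c(3,2) pq(2)] commute_inv[OF c(4,1) pq(3)]
    commute_inv[OF c(4,2) pq(4)]
  show ?thesis
    using c by (simp add: m_assoc pq C L[OF pq(1)] L[OF pq(2)] L[OF pq(3)] L[OF pq(4)] L[OF pq(5)]
      L[OF C(1)] L[OF C(2)] L[OF C(3)] L[OF C(4)])
qed

text \<open>In the application inv p is the value of a at -(d e), produced by evaluating the
  transported side at -e; the outer inverse turns it back into p.\<close>

lemma (in group) mult_calc:
  assumes "u \<in> carrier G" "v \<in> carrier G" "p \<in> carrier G" "q \<in> carrier G"
  shows "inv (v \<otimes> (inv v \<otimes> inv p)) \<otimes> (u \<otimes> (inv u \<otimes> q)) = p \<otimes> q"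
  using assms by (simp add: m_assoc[symmetric])

context gbundle begin

text \<open>Here a and a' are the factors belonging to a square and to its exchange, and k is the
  value of a - a' at d e. The left-hand sides are the coboundary product and the contour product
  after the factored sides have been inserted.\<close>

lemma fibre_calc:
  assumes b: "b \<in> Ob S"
    and A: "a \<in> el (An S M L 1) b" "bpt S L 1 b a = x" "a' \<in> el (An S M L 1) b" "bpt S L 1 b a' = x"
      "u \<in> el (An S M L 1) b" "bpt S L 1 b u = x" "v \<in> el (An S M L 1) b" "bpt S L 1 b v = x"
    and f: "f \<in> into S b" and d: "d \<in> Dset S (dm S f)" and e: "e \<in> Dset S (dm S f)"
  defines "R \<equiv> rg S (dm S f)"
  defines "k \<equiv> mul L (dm S f) (a f [d \<otimes>\<^bsub>R\<^esub> e]) (a' f [\<ominus>\<^bsub>R\<^esub> (d \<otimes>\<^bsub>R\<^esub> e)])"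
  shows "mul L (dm S f)
      (ginv L (dm S f) (mul L (dm S f) (v f [e]) (mul L (dm S f) (v f [\<ominus>\<^bsub>R\<^esub> e]) (a f [d \<otimes>\<^bsub>R\<^esub> \<ominus>\<^bsub>R\<^esub> e]))))
      (mul L (dm S f) (u f [d]) (mul L (dm S f) (u f [\<ominus>\<^bsub>R\<^esub> d]) (a' f [e \<otimes>\<^bsub>R\<^esub> \<ominus>\<^bsub>R\<^esub> d]))) = k"
    and "mul L (dm S f) (v f [\<ominus>\<^bsub>R\<^esub> e])
      (mul L (dm S f) (mul L (dm S f) (u f [\<ominus>\<^bsub>R\<^esub> d]) (a' f [e \<otimes>\<^bsub>R\<^esub> \<ominus>\<^bsub>R\<^esub> d]))
        (mul L (dm S f) (mul L (dm S f) (v f [e]) (a f [d \<otimes>\<^bsub>R\<^esub> e])) (u f [d]))) =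
      mul L (dm S f) k (mul L (dm S f) (v f [\<ominus>\<^bsub>R\<^esub> e])
        (mul L (dm S f) (u f [\<ominus>\<^bsub>R\<^esub> d]) (mul L (dm S f) (v f [e]) (u f [d]))))"
proof -
  have bf: "dm S f \<in> Ob S" using f by simp
  have x: "rs M f x \<in> el M (dm S f)" using bpt_el[OF b A(1)] f A(2) by (auto intro: rs_M)
  interpret R: cring R unfolding R_def by (rule cring_at[OF bf])
  interpret H: group "fgrp (dm S f) (rs M f x)" by (rule fgrp_group[OF bf x])
  have C: "d \<in> carrier R" "e \<in> carrier R" "d \<otimes>\<^bsub>R\<^esub> d = \<zero>\<^bsub>R\<^esub>" "e \<otimes>\<^bsub>R\<^esub> e = \<zero>\<^bsub>R\<^esub>"
    using d e by (simp_all add: R_def Dset_iff)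
  let ?k = "d \<otimes>\<^bsub>R\<^esub> e"
  have k: "?k \<in> Dset S (dm S f)" "\<ominus>\<^bsub>R\<^esub> ?k \<in> Dset S (dm S f)"
    using bf d e by (simp_all add: R_def Dset_carrier)
  \<comment> \<open>Each product contains d d or e e. These equations place the parameters in D(2),
    where values of tangents commute.\<close>
  have kd: "?k \<otimes>\<^bsub>R\<^esub> d = \<zero>\<^bsub>R\<^esub>" and ke: "?k \<otimes>\<^bsub>R\<^esub> e = \<zero>\<^bsub>R\<^esub>"
    using C by (simp_all add: R.m_assoc) (simp_all add: R.m_comm[of e d] R.m_assoc[symmetric])
  have nk: "\<ominus>\<^bsub>R\<^esub> ?k \<otimes>\<^bsub>R\<^esub> d = \<zero>\<^bsub>R\<^esub>" "\<ominus>\<^bsub>R\<^esub> ?k \<otimes>\<^bsub>R\<^esub> e = \<zero>\<^bsub>R\<^esub>" "\<ominus>\<^bsub>R\<^esub> ?k \<otimes>\<^bsub>R\<^esub> ?k = \<zero>\<^bsub>R\<^esub>"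
    using C kd ke by (simp_all add: R.l_minus R.m_assoc[symmetric])
  have eq: "d \<otimes>\<^bsub>R\<^esub> \<ominus>\<^bsub>R\<^esub> e = \<ominus>\<^bsub>R\<^esub> ?k" "e \<otimes>\<^bsub>R\<^esub> \<ominus>\<^bsub>R\<^esub> d = \<ominus>\<^bsub>R\<^esub> ?k"
    using C by (simp_all add: R.r_minus R.m_comm)
  have el: "s f [i] \<in> carrier (fgrp (dm S f) (rs M f x))"
    if "s \<in> el (An S M L 1) b" "bpt S L 1 b s = x" "i \<in> Dset S (dm S f)" for s i
    using A1_at(1,2)[OF that(1) f that(3)] that(2) by simp
  have um: "s f [\<ominus>\<^bsub>R\<^esub> i] = inv\<^bsub>fgrp (dm S f) (rs M f x)\<^esub> (s f [i])"
    if "s \<in> el (An S M L 1) b" "bpt S L 1 b s = x" "i \<in> Dset S (dm S f)" for s i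
    using A1_uminus[OF that(1) f that(3)] fgrp_inv[OF bf x el[OF that]] by (simp add: R_def)
  note els = el[OF A(1,2) k(1)] el[OF A(3,4) k(2)] el[OF A(5,6) d] el[OF A(7,8) e]
  note ums = um[OF A(1,2) k(1)] um[OF A(5,6) d] um[OF A(7,8) e]
  have com: "mul L (dm S f) (s f [i]) (t f [j]) = mul L (dm S f) (t f [j]) (s f [i])"
    if "s \<in> el (An S M L 1) b" "bpt S L 1 b s = x" "t \<in> el (An S M L 1) b" "bpt S L 1 b t = x"
      "i \<in> Dset S (dm S f)" "j \<in> Dset S (dm S f)" "i \<otimes>\<^bsub>R\<^esub> j = \<zero>\<^bsub>R\<^esub>" for s t i j
    using A1_commute[OF that(1,3) _ f that(5,6)] that(2,4,7) by (simp add: R_def)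
  have "inv\<^bsub>fgrp (dm S f) (rs M f x)\<^esub> (v f [e] \<otimes>\<^bsub>fgrp (dm S f) (rs M f x)\<^esub>
      (v f [\<ominus>\<^bsub>R\<^esub> e] \<otimes>\<^bsub>fgrp (dm S f) (rs M f x)\<^esub> a f [\<ominus>\<^bsub>R\<^esub> ?k])) =
    ginv L (dm S f) (mul L (dm S f) (v f [e]) (mul L (dm S f) (v f [\<ominus>\<^bsub>R\<^esub> e]) (a f [\<ominus>\<^bsub>R\<^esub> ?k])))"
    using fgrp_inv[OF bf x, of "v f [e] \<otimes>\<^bsub>fgrp (dm S f) (rs M f x)\<^esub>
      (v f [\<ominus>\<^bsub>R\<^esub> e] \<otimes>\<^bsub>fgrp (dm S f) (rs M f x)\<^esub> a f [\<ominus>\<^bsub>R\<^esub> ?k])"] els(1,4)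
    unfolding ums by (metis H.inv_closed H.m_closed fgrp_simps(2))
  then show "mul L (dm S f)
      (ginv L (dm S f) (mul L (dm S f) (v f [e]) (mul L (dm S f) (v f [\<ominus>\<^bsub>R\<^esub> e]) (a f [d \<otimes>\<^bsub>R\<^esub> \<ominus>\<^bsub>R\<^esub> e]))))
      (mul L (dm S f) (u f [d]) (mul L (dm S f) (u f [\<ominus>\<^bsub>R\<^esub> d]) (a' f [e \<otimes>\<^bsub>R\<^esub> \<ominus>\<^bsub>R\<^esub> d]))) = k"
    using H.mult_calc[OF els(3,4,1,2)] unfolding eq k_def ums fgrp_simps(2) by simp
  show "mul L (dm S f) (v f [\<ominus>\<^bsub>R\<^esub> e])
      (mul L (dm S f) (mul L (dm S f) (u f [\<ominus>\<^bsub>R\<^esub> d]) (a' f [e \<otimes>\<^bsub>R\<^esub> \<ominus>\<^bsub>R\<^esub> d]))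
        (mul L (dm S f) (mul L (dm S f) (v f [e]) (a f [d \<otimes>\<^bsub>R\<^esub> e])) (u f [d]))) =
      mul L (dm S f) k (mul L (dm S f) (v f [\<ominus>\<^bsub>R\<^esub> e])
        (mul L (dm S f) (u f [\<ominus>\<^bsub>R\<^esub> d]) (mul L (dm S f) (v f [e]) (u f [d]))))"
    using H.contour_calc[OF els(3,4,1,2)]
      com[OF A(1,2,5,6) k(1) d kd] com[OF A(1,2,7,8) k(1) e ke] com[OF A(3,4,5,6) k(2) d nk(1)]
      com[OF A(3,4,7,8) k(2) e nk(2)] com[OF A(3,4,1,2) k(2,1) nk(3)]
    unfolding eq k_def ums fgrp_simps(2) by simp
qed

text \<open>For d = 0 or e = 0 one of the two tangents contributes units only, and the values of the
  other at opposite parameters cancel. So the commutator is a function of d e, which gives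
  existence.\<close>

lemma bracket_at:
  assumes c: "c \<in> Ob S" and u: "u \<in> el (An S M L 1) c" and v: "v \<in> el (An S M L 1) c"
    and uv: "bpt S L 1 c u = bpt S L 1 c v"
  shows "bracket S M L c u v \<in> el (An S M L 1) c" "bpt S L 1 c (bracket S M L c u v) = bpt S L 1 c v"
    and "\<And>f d e. \<lbrakk>f \<in> into S c; d \<in> Dset S (dm S f); e \<in> Dset S (dm S f)\<rbrakk> \<Longrightarrow>
      bracket S M L c u v f [d \<otimes>\<^bsub>rg S (dm S f)\<^esub> e] =
      mul L (dm S f) (v f [\<ominus>\<^bsub>rg S (dm S f)\<^esub> e]) (mul L (dm S f) (u f [\<ominus>\<^bsub>rg S (dm S f)\<^esub> d])
        (mul L (dm S f) (v f [e]) (u f [d])))"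
proof -
  let ?x = "bpt S L 1 c v"
  let ?F = "\<lambda>f d e. mul L (dm S f) (v f [\<ominus>\<^bsub>rg S (dm S f)\<^esub> e]) (mul L (dm S f) (u f [\<ominus>\<^bsub>rg S (dm S f)\<^esub> d])
        (mul L (dm S f) (v f [e]) (u f [d])))"
  have x: "?x \<in> el M c" by (rule bpt_el[OF c v])
  note V = A1_at[OF v] and U = A1_at[OF u]
  obtain t where t: "t \<in> el (An S M L 1) c" "bpt S L 1 c t = ?x"
    and tF: "\<And>f d e. \<lbrakk>f \<in> into S c; d \<in> Dset S (dm S f); e \<in> Dset S (dm S f)\<rbrakk> \<Longrightarrow>
      t f [d \<otimes>\<^bsub>rg S (dm S f)\<^esub> e] = ?F f d e"
  proof (rule A1_factor[OF c x, of ?F])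
    fix f d e assume f: "f \<in> into S c" "d \<in> Dset S (dm S f)" "e \<in> Dset S (dm S f)"
    then have n: "\<ominus>\<^bsub>rg S (dm S f)\<^esub> d \<in> Dset S (dm S f)" "\<ominus>\<^bsub>rg S (dm S f)\<^esub> e \<in> Dset S (dm S f)" by simp_all
    show "?F f d e \<in> el L (dm S f) \<and> src L (dm S f) (?F f d e) = rs M f ?x"
      using f n V(1,2) U(1,2) uv by (simp add: mul_el src_mul src_tgt)
    fix g assume g: "g \<in> into S (dm S f)"
    show "?F (cmp S f g) (rr S g d) (rr S g e) = rs L g (?F f d e)"
      using f n g V U uv by (simp add: mul_el src_mul src_tgt mul_rs[OF g] Dset_carrier)
  next
    fix f d assume f: "f \<in> into S c" "d \<in> Dset S (dm S f)"
    have bf: "dm S f \<in> Ob S" and y: "rs M f ?x \<in> el M (dm S f)" using f x by (auto intro: rs_M)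
    interpret R: cring "rg S (dm S f)" by (rule cring_at[OF bf])
    interpret H: group "fgrp (dm S f) (rs M f ?x)" by (rule fgrp_group[OF bf y])
    have z: "\<ominus>\<^bsub>rg S (dm S f)\<^esub> \<zero>\<^bsub>rg S (dm S f)\<^esub> = \<zero>\<^bsub>rg S (dm S f)\<^esub>" by simp
    have els: "u f [d] \<in> carrier (fgrp (dm S f) (rs M f ?x))" "v f [d] \<in> carrier (fgrp (dm S f) (rs M f ?x))"
      using f V(1,2) U(1,2) uv by simp_all
    have one: "v f [\<zero>\<^bsub>rg S (dm S f)\<^esub>] = \<one>\<^bsub>fgrp (dm S f) (rs M f ?x)\<^esub>" "u f [\<zero>\<^bsub>rg S (dm S f)\<^esub>] = \<one>\<^bsub>fgrp (dm S f) (rs M f ?x)\<^esub>"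
      using f V(3) U(3) uv by simp_all
    have um: "u f [\<ominus>\<^bsub>rg S (dm S f)\<^esub> d] = inv\<^bsub>fgrp (dm S f) (rs M f ?x)\<^esub> (u f [d])"
      "v f [\<ominus>\<^bsub>rg S (dm S f)\<^esub> d] = inv\<^bsub>fgrp (dm S f) (rs M f ?x)\<^esub> (v f [d])"
      using A1_uminus[OF u f] A1_uminus[OF v f] els by (simp_all add: fgrp_inv[OF bf y])
    show "?F f d \<zero>\<^bsub>rg S (dm S f)\<^esub> = unt L (dm S f) (rs M f ?x) \<and> ?F f \<zero>\<^bsub>rg S (dm S f)\<^esub> d = unt L (dm S f) (rs M f ?x)"
      unfolding z one um fgrp_simps(2)[where c = "dm S f" and x = "rs M f ?x", symmetric]
        fgrp_simps(3)[symmetric]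
      using els by (simp del: fgrp_simps)
  qed blast
  have "bracket S M L c u v = t"
    unfolding bracket_def Let_def A1_simps
  proof (rule the_equality)
    show "t \<in> el (An S M L 1) c \<and> (\<forall>f\<in>into S c. \<forall>d\<in>Dset S (dm S f). \<forall>e\<in>Dset S (dm S f).
        t f [d \<otimes>\<^bsub>rg S (dm S f)\<^esub> e] = ?F f d e)" using t tF by simp
    show "s = t" if "s \<in> el (An S M L 1) c \<and> (\<forall>f\<in>into S c. \<forall>d\<in>Dset S (dm S f). \<forall>e\<in>Dset S (dm S f).
        s f [d \<otimes>\<^bsub>rg S (dm S f)\<^esub> e] = ?F f d e)" for s
      using that by (intro A1_unique[OF _ t(1) c]) (simp_all add: tF)
  qed
  then show "bracket S M L c u v \<in> el (An S M L 1) c" "bpt S L 1 c (bracket S M L c u v) = bpt S L 1 c v"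
    "\<And>f d e. \<lbrakk>f \<in> into S c; d \<in> Dset S (dm S f); e \<in> Dset S (dm S f)\<rbrakk> \<Longrightarrow>
      bracket S M L c u v f [d \<otimes>\<^bsub>rg S (dm S f)\<^esub> e] = ?F f d e"
    using t tF by simp_all
qed

end

section \<open>Coboundary and contour derivative\<close>

context rep_form begin

lemma tside_zero_rs:
  assumes "f \<in> into S c" "\<gamma> \<in> el (An S M G 2) (dm S f)" "g \<in> into S (dm S f)" "e \<in> Dset S (dm S g)"
  shows "tside (cmp S f g) (rsf S (Dn S 2) g \<gamma>) \<zero>\<^bsub>rg S (dm S g)\<^esub> (idt S (dm S g)) [e] =
    tside f \<gamma> \<zero>\<^bsub>rg S (dm S f)\<^esub> g [e]"
  using tside_rs[OF assms(1,2) _ assms(3), of "\<zero>\<^bsub>rg S (dm S f)\<^esub>"] assms by simp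

abbreviation "mrhs f \<equiv> mult_rhs S M G L (dm S f) (\<rho>1 f) (\<omega> f)"
abbreviation "crhs f \<equiv> contour_rhs S M G L (dm S f) (\<rho>1 f) (\<omega> f)"

text \<open>Both defining products become expressions in the transported sides of \<gamma> and of
  its exchange: untransported sides at 0 are transported ones by \<open>tside_zero\<close>, and
  second sides are first sides of the exchanged square.\<close>

lemma rhs_tside:
  assumes f: "f \<in> into S c" and \<gamma>: "\<gamma> \<in> el (An S M G 2) (dm S f)"
    and d: "d \<in> Dset S (dm S f)" "e \<in> Dset S (dm S f)"
  defines "at \<equiv> \<lambda>t d. t (idt S (dm S f)) [d]" and "R \<equiv> rg S (dm S f)" and "\<gamma>' \<equiv> G.swap (dm S f) \<gamma>"
  shows "mrhs f \<gamma> d e = mul L (dm S f)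
      (ginv L (dm S f) (mul L (dm S f) (at (tside f \<gamma> \<zero>\<^bsub>R\<^esub>) e) (at (tside f \<gamma> d) (\<ominus>\<^bsub>R\<^esub> e))))
      (mul L (dm S f) (at (tside f \<gamma>' \<zero>\<^bsub>R\<^esub>) d) (at (tside f \<gamma>' e) (\<ominus>\<^bsub>R\<^esub> d)))"
    and "crhs f \<gamma> d e = mul L (dm S f) (at (tside f \<gamma> \<zero>\<^bsub>R\<^esub>) (\<ominus>\<^bsub>R\<^esub> e))
      (mul L (dm S f) (at (tside f \<gamma>' e) (\<ominus>\<^bsub>R\<^esub> d))
        (mul L (dm S f) (at (tside f \<gamma> d) e) (at (tside f \<gamma>' \<zero>\<^bsub>R\<^esub>) d)))"
proof -
  have b: "dm S f \<in> Ob S" using f by simp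
  have z: "\<zero>\<^bsub>rg S (dm S f)\<^esub> \<in> Dset S (dm S f)" using b by simp
  note eqs = tside_zero[OF f \<gamma>] tside_zero[OF f conjunct1[OF G.swap_An[OF \<gamma> b]]]
    G.face_swap[of "dm S f" \<gamma>] G.side_swap[OF z, of \<gamma>] G.side_swap[OF d(2), of \<gamma>]
    tside_def[of f \<gamma> d] tside_def[of f "G.swap (dm S f) \<gamma>" e]
  show "mrhs f \<gamma> d e = mul L (dm S f)
      (ginv L (dm S f) (mul L (dm S f) (at (tside f \<gamma> \<zero>\<^bsub>R\<^esub>) e) (at (tside f \<gamma> d) (\<ominus>\<^bsub>R\<^esub> e))))
      (mul L (dm S f) (at (tside f \<gamma>' \<zero>\<^bsub>R\<^esub>) d) (at (tside f \<gamma>' e) (\<ominus>\<^bsub>R\<^esub> d)))"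
    by (simp only: mult_rhs_def Let_def at_def R_def \<gamma>'_def eqs)
  show "crhs f \<gamma> d e = mul L (dm S f) (at (tside f \<gamma> \<zero>\<^bsub>R\<^esub>) (\<ominus>\<^bsub>R\<^esub> e))
      (mul L (dm S f) (at (tside f \<gamma>' e) (\<ominus>\<^bsub>R\<^esub> d))
        (mul L (dm S f) (at (tside f \<gamma> d) e) (at (tside f \<gamma>' \<zero>\<^bsub>R\<^esub>) d)))"
    by (simp only: contour_rhs_def Let_def at_def R_def \<gamma>'_def eqs)
qed

text \<open>Scaling the first variable replaces A(d) by A(a d), while u and B(e) are scaled as
  tangents, which moves their arguments d and -d to a d and -(a d). The second variable is the
  mirror image.\<close>

lemma mrhs_scl:
  assumes f: "f \<in> into S c" and \<gamma>: "\<gamma> \<in> el (An S M G 2) (dm S f)"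
    and d: "d \<in> Dset S (dm S f)" "e \<in> Dset S (dm S f)" and a: "a \<in> carrier (rg S (dm S f))"
  shows "mrhs f (scl S 2 0 (dm S f) a \<gamma>) d e = mrhs f \<gamma> (a \<otimes>\<^bsub>rg S (dm S f)\<^esub> d) e"
    and "mrhs f (scl S 2 1 (dm S f) a \<gamma>) d e = mrhs f \<gamma> d (a \<otimes>\<^bsub>rg S (dm S f)\<^esub> e)"
proof -
  let ?b = "dm S f"
  have b: "?b \<in> Ob S" using f by simp
  interpret R: cring "rg S ?b" by (rule cring_at[OF b])
  have s: "G.swap ?b \<gamma> \<in> el (An S M G 2) ?b" using G.swap_An[OF \<gamma> b] by simp
  have C: "d \<in> carrier (rg S ?b)" "e \<in> carrier (rg S ?b)" using d by (simp_all add: Dset_carrier)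
  have ad: "a \<otimes>\<^bsub>rg S ?b\<^esub> d \<in> Dset S ?b" "a \<otimes>\<^bsub>rg S ?b\<^esub> e \<in> Dset S ?b" using b d a by simp_all
  have sc: "scl S 1 0 ?b a t (idt S ?b) [i] = t (idt S ?b) [a \<otimes>\<^bsub>rg S ?b\<^esub> i]" if "i \<in> Dset S ?b" for t :: "'a \<Rightarrow> 'r list \<Rightarrow> 'l" and i
    using that b a by (simp add: scl_def rr_idt)
  show "mrhs f (scl S 2 0 ?b a \<gamma>) d e = mrhs f \<gamma> (a \<otimes>\<^bsub>rg S ?b\<^esub> d) e"
    using G.scl2_An[OF \<gamma> b a, of 0] d b a C
    by (simp add: rhs_tside[OF f] \<gamma> ad G.swap_scl[OF \<gamma> b a] tside_scl0[OF f \<gamma>] tside_scl1[OF f s] sc R.r_minus)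
  show "mrhs f (scl S 2 1 ?b a \<gamma>) d e = mrhs f \<gamma> d (a \<otimes>\<^bsub>rg S ?b\<^esub> e)"
    using G.scl2_An[OF \<gamma> b a, of 1] d b a C
    by (simp add: rhs_tside[OF f] \<gamma> ad G.swap_scl[OF \<gamma> b a] tside_scl0[OF f s] tside_scl1[OF f \<gamma>] sc R.r_minus)
qed

text \<open>The product for \<gamma> has the form inv p * q, with p from \<gamma> and q from the
  exchanged square. For the exchanged square it is inv q * p.\<close>

lemma mrhs_swap:
  assumes f: "f \<in> into S c" and \<gamma>: "\<gamma> \<in> el (An S M G 2) (dm S f)"
    and d: "d \<in> Dset S (dm S f)" "e \<in> Dset S (dm S f)"
  shows "mrhs f (G.swap (dm S f) \<gamma>) d e = ginv L (dm S f) (mrhs f \<gamma> e d)"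
proof -
  let ?b = "dm S f" and ?x = "bpt S G 2 (dm S f) \<gamma>"
  have b: "?b \<in> Ob S" using f by simp
  have x: "?x \<in> el M ?b" by (rule G.bpt_el[OF b \<gamma>])
  interpret H: group "fgrp ?b ?x" by (rule fgrp_group[OF b x])
  have s: "G.swap ?b \<gamma> \<in> el (An S M G 2) ?b" "bpt S G 2 ?b (G.swap ?b \<gamma>) = ?x" using G.swap_An[OF \<gamma> b] by simp_all
  have T: "tside f \<delta> i (idt S ?b) [j] \<in> carrier (fgrp ?b ?x)"
    if "\<delta> \<in> el (An S M G 2) ?b" "bpt S G 2 ?b \<delta> = ?x" "i \<in> Dset S ?b" "j \<in> Dset S ?b" for \<delta> i j
    using A1_at(1,2)[OF tside_A1(1)[OF f that(1,3)], of "idt S ?b" j] tside_A1(2)[OF f that(1,3)] that b x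
    by (simp add: psh_idt[OF M_psh])
  let ?T = "\<lambda>\<delta> i j. tside f \<delta> i (idt S ?b) [j]" and ?z = "\<zero>\<^bsub>rg S ?b\<^esub>" and ?m = "a_inv (rg S ?b)"
  define p where "p = mul L ?b (?T \<gamma> ?z d) (?T \<gamma> e (?m d))"
  define q where "q = mul L ?b (?T (G.swap ?b \<gamma>) ?z e) (?T (G.swap ?b \<gamma>) d (?m e))"
  have p: "p \<in> carrier (fgrp ?b ?x)"
    unfolding p_def fgrp_simps(2)[where c = ?b and x = ?x, symmetric] using b d by (intro H.m_closed T \<gamma>) simp_all
  have q: "q \<in> carrier (fgrp ?b ?x)"
    unfolding q_def fgrp_simps(2)[where c = ?b and x = ?x, symmetric] using b d s by (intro H.m_closed T) simp_all
  have "mrhs f (G.swap ?b \<gamma>) d e = mul L ?b (ginv L ?b q) p" "mrhs f \<gamma> e d = mul L ?b (ginv L ?b p) q"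
    using d by (simp_all add: rhs_tside[OF f] s \<gamma> G.swap_swap b p_def q_def)
  moreover have "inv\<^bsub>fgrp ?b ?x\<^esub> (inv\<^bsub>fgrp ?b ?x\<^esub> p \<otimes>\<^bsub>fgrp ?b ?x\<^esub> q) = inv\<^bsub>fgrp ?b ?x\<^esub> q \<otimes>\<^bsub>fgrp ?b ?x\<^esub> p"
    using p q by (simp add: H.inv_mult_group del: fgrp_simps)
  moreover have "ginv L ?b (inv\<^bsub>fgrp ?b ?x\<^esub> p \<otimes>\<^bsub>fgrp ?b ?x\<^esub> q) = inv\<^bsub>fgrp ?b ?x\<^esub> (inv\<^bsub>fgrp ?b ?x\<^esub> p \<otimes>\<^bsub>fgrp ?b ?x\<^esub> q)"
    using p q by (intro fgrp_inv[OF b x, symmetric] H.m_closed H.inv_closed)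
  ultimately show ?thesis
    using fgrp_inv[OF b x p] fgrp_inv[OF b x q] by simp
qed

text \<open>The witness is a - a'. Both equations are obtained at once because they refer to the
  same factors a and a', which are not visible outside the proof.\<close>

lemma coboundary_ex:
  assumes f: "f \<in> into S c" and \<gamma>: "\<gamma> \<in> el (An S M G 2) (dm S f)"
  shows "\<exists>\<kappa>. \<kappa> \<in> el (An S M L 1) (dm S f) \<and> bpt S L 1 (dm S f) \<kappa> = bpt S G 2 (dm S f) \<gamma> \<and>
    (\<forall>g\<in>into S (dm S f). \<forall>d\<in>Dset S (dm S g). \<forall>e\<in>Dset S (dm S g).
      \<kappa> g [d \<otimes>\<^bsub>rg S (dm S g)\<^esub> e] = mrhs (cmp S f g) (rsf S (Dn S 2) g \<gamma>) d e \<and>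
      crhs (cmp S f g) (rsf S (Dn S 2) g \<gamma>) d e = mul L (dm S g) (\<kappa> g [d \<otimes>\<^bsub>rg S (dm S g)\<^esub> e])
        (bracket S M L (dm S f) (tside f (G.swap (dm S f) \<gamma>) \<zero>\<^bsub>rg S (dm S f)\<^esub>) (tside f \<gamma> \<zero>\<^bsub>rg S (dm S f)\<^esub>)
          g [d \<otimes>\<^bsub>rg S (dm S g)\<^esub> e]))"
proof -
  let ?b = "dm S f" and ?x = "bpt S G 2 (dm S f) \<gamma>" and ?\<gamma> = "G.swap (dm S f) \<gamma>"
  have b: "?b \<in> Ob S" using f by simp
  interpret Rb: cring "rg S ?b" by (rule cring_at[OF b])
  have s: "?\<gamma> \<in> el (An S M G 2) ?b" "bpt S G 2 ?b ?\<gamma> = ?x" using G.swap_An[OF \<gamma> b] by simp_all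
  obtain a where a: "a \<in> el (An S M L 1) ?b" "bpt S L 1 ?b a = ?x"
    and Ta: "\<And>g d e. \<lbrakk>g \<in> into S ?b; d \<in> Dset S (dm S g); e \<in> Dset S (dm S g)\<rbrakk> \<Longrightarrow>
      tside (cmp S f g) (rsf S (Dn S 2) g \<gamma>) d (idt S (dm S g)) [e] =
        mul L (dm S g) (tside f \<gamma> \<zero>\<^bsub>rg S ?b\<^esub> g [e]) (a g [d \<otimes>\<^bsub>rg S (dm S g)\<^esub> e])"
    using tside_factor[OF f \<gamma>] by blast
  obtain a' where a': "a' \<in> el (An S M L 1) ?b" "bpt S L 1 ?b a' = ?x"
    and Ta': "\<And>g d e. \<lbrakk>g \<in> into S ?b; d \<in> Dset S (dm S g); e \<in> Dset S (dm S g)\<rbrakk> \<Longrightarrow>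
      tside (cmp S f g) (rsf S (Dn S 2) g ?\<gamma>) d (idt S (dm S g)) [e] =
        mul L (dm S g) (tside f ?\<gamma> \<zero>\<^bsub>rg S ?b\<^esub> g [e]) (a' g [d \<otimes>\<^bsub>rg S (dm S g)\<^esub> e])"
    using tside_factor[OF f s(1)] s(2) by metis
  let ?u = "tside f ?\<gamma> \<zero>\<^bsub>rg S ?b\<^esub>" and ?v = "tside f \<gamma> \<zero>\<^bsub>rg S ?b\<^esub>"
  have u: "?u \<in> el (An S M L 1) ?b" "bpt S L 1 ?b ?u = ?x" using tside_A1[OF f s(1)] b s(2) by simp_all
  have v: "?v \<in> el (An S M L 1) ?b" "bpt S L 1 ?b ?v = ?x" using tside_A1[OF f \<gamma>] b by simp_all
  \<comment> \<open>The summand -a'. Defining it by a scalar makes the witness a pointwise product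
    of two tangents, so that \<open>A1_mul\<close> applies.\<close>
  define n where "n = scl S 1 0 ?b (\<ominus>\<^bsub>rg S ?b\<^esub> \<one>\<^bsub>rg S ?b\<^esub>) a'"
  have n: "n \<in> el (An S M L 1) ?b" "bpt S L 1 ?b n = ?x"
    using A1_scl[OF a'(1) b, of "\<ominus>\<^bsub>rg S ?b\<^esub> \<one>\<^bsub>rg S ?b\<^esub>"] a'(2) by (simp_all add: n_def)
  define \<kappa> where "\<kappa> = ilam S (Dn S 1) ?b (\<lambda>g ds. mul L (dm S g) (a g ds) (n g ds))"
  have \<kappa>A: "\<kappa> \<in> el (An S M L 1) ?b" "bpt S L 1 ?b \<kappa> = ?x"
    using A1_mul[OF a(1) n(1) _ b] a(2) n(2) by (simp_all add: \<kappa>_def)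
  have \<kappa>: "\<kappa> g [d] = mul L (dm S g) (a g [d]) (a' g [\<ominus>\<^bsub>rg S (dm S g)\<^esub> d])"
    if g: "g \<in> into S ?b" "d \<in> Dset S (dm S g)" for g d
  proof -
    interpret R: cring "rg S (dm S g)" using g by (intro cring_at) simp
    show ?thesis using g by (simp add: \<kappa>_def n_def scl_def Dset_carrier R.l_minus)
  qed
  have "\<kappa> g [d \<otimes>\<^bsub>rg S (dm S g)\<^esub> e] = mrhs (cmp S f g) (rsf S (Dn S 2) g \<gamma>) d e \<and>
      crhs (cmp S f g) (rsf S (Dn S 2) g \<gamma>) d e = mul L (dm S g) (\<kappa> g [d \<otimes>\<^bsub>rg S (dm S g)\<^esub> e])
        (bracket S M L ?b ?u ?v g [d \<otimes>\<^bsub>rg S (dm S g)\<^esub> e])"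
    if g: "g \<in> into S ?b" and d: "d \<in> Dset S (dm S g)" and e: "e \<in> Dset S (dm S g)" for g d e
  proof -
    have fg: "cmp S f g \<in> into S c" "dm S (cmp S f g) = dm S g" using f g by simp_all
    have bg: "dm S g \<in> Ob S" using g by simp
    have de: "d \<otimes>\<^bsub>rg S (dm S g)\<^esub> e \<in> Dset S (dm S g)" using bg d e by (simp add: Dset_carrier)
    have r: "rsf S (Dn S 2) g \<gamma> \<in> el (An S M G 2) (dm S (cmp S f g))"
      using G.rsf_An[OF \<gamma> g] by (simp add: fg)
    have m: "\<ominus>\<^bsub>rg S (dm S g)\<^esub> d \<in> Dset S (dm S g)" "\<ominus>\<^bsub>rg S (dm S g)\<^esub> e \<in> Dset S (dm S g)"
      using bg d e by simp_all
    note rhs = rhs_tside[OF fg(1) r, unfolded fg(2), OF d e, folded G.swap_rs[OF g]]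
    note T0 = tside_zero_rs[OF f \<gamma> g] tside_zero_rs[OF f s(1) g]
    note calc = fibre_calc[OF b a a' u v g d e]
    have "bracket S M L ?b ?u ?v g [d \<otimes>\<^bsub>rg S (dm S g)\<^esub> e] =
      mul L (dm S g) (?v g [\<ominus>\<^bsub>rg S (dm S g)\<^esub> e]) (mul L (dm S g) (?u g [\<ominus>\<^bsub>rg S (dm S g)\<^esub> d])
        (mul L (dm S g) (?v g [e]) (?u g [d])))"
      using u v by (intro bracket_at(3)[OF b u(1) v(1) _ g d e]) simp
    then show ?thesis
      using calc unfolding fg(2) rhs by (simp add: T0 Ta[OF g] Ta'[OF g] d e m \<kappa>[OF g de])
  qed
  with \<kappa>A show ?thesis by blast
qed

text \<open>
  The multiplicative coboundary. It is chosen together with its relation to the contour product, but the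
  first equation alone determines it.
\<close>

definition cobdry :: "'a \<Rightarrow> ('a \<Rightarrow> 'r list \<Rightarrow> 'g) \<Rightarrow> 'a \<Rightarrow> 'r list \<Rightarrow> 'l" where
  "cobdry f \<gamma> = (SOME \<kappa>. \<kappa> \<in> el (An S M L 1) (dm S f) \<and> bpt S L 1 (dm S f) \<kappa> = bpt S G 2 (dm S f) \<gamma> \<and>
    (\<forall>g\<in>into S (dm S f). \<forall>d\<in>Dset S (dm S g). \<forall>e\<in>Dset S (dm S g).
      \<kappa> g [d \<otimes>\<^bsub>rg S (dm S g)\<^esub> e] = mrhs (cmp S f g) (rsf S (Dn S 2) g \<gamma>) d e \<and>
      crhs (cmp S f g) (rsf S (Dn S 2) g \<gamma>) d e = mul L (dm S g) (\<kappa> g [d \<otimes>\<^bsub>rg S (dm S g)\<^esub> e])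
        (bracket S M L (dm S f) (tside f (G.swap (dm S f) \<gamma>) \<zero>\<^bsub>rg S (dm S f)\<^esub>) (tside f \<gamma> \<zero>\<^bsub>rg S (dm S f)\<^esub>)
          g [d \<otimes>\<^bsub>rg S (dm S g)\<^esub> e])))"

lemma cobdry_at:
  assumes f: "f \<in> into S c" and \<gamma>: "\<gamma> \<in> el (An S M G 2) (dm S f)"
  shows "cobdry f \<gamma> \<in> el (An S M L 1) (dm S f)" "bpt S L 1 (dm S f) (cobdry f \<gamma>) = bpt S G 2 (dm S f) \<gamma>"
    and "\<lbrakk>g \<in> into S (dm S f); d \<in> Dset S (dm S g); e \<in> Dset S (dm S g)\<rbrakk> \<Longrightarrow>
      cobdry f \<gamma> g [d \<otimes>\<^bsub>rg S (dm S g)\<^esub> e] = mrhs (cmp S f g) (rsf S (Dn S 2) g \<gamma>) d e"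
    and "\<lbrakk>g \<in> into S (dm S f); d \<in> Dset S (dm S g); e \<in> Dset S (dm S g)\<rbrakk> \<Longrightarrow>
      crhs (cmp S f g) (rsf S (Dn S 2) g \<gamma>) d e = mul L (dm S g) (cobdry f \<gamma> g [d \<otimes>\<^bsub>rg S (dm S g)\<^esub> e])
        (bracket S M L (dm S f) (tside f (G.swap (dm S f) \<gamma>) \<zero>\<^bsub>rg S (dm S f)\<^esub>) (tside f \<gamma> \<zero>\<^bsub>rg S (dm S f)\<^esub>)
          g [d \<otimes>\<^bsub>rg S (dm S g)\<^esub> e])"
  using someI_ex[OF coboundary_ex[OF f \<gamma>], folded cobdry_def] by blast+

lemma cobdry_eqI:
  assumes f: "f \<in> into S c" and \<gamma>: "\<gamma> \<in> el (An S M G 2) (dm S f)"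
    and t: "t \<in> el (An S M L 1) (dm S f)"
    and eq: "\<And>g d e. \<lbrakk>g \<in> into S (dm S f); d \<in> Dset S (dm S g); e \<in> Dset S (dm S g)\<rbrakk> \<Longrightarrow>
      t g [d \<otimes>\<^bsub>rg S (dm S g)\<^esub> e] = mrhs (cmp S f g) (rsf S (Dn S 2) g \<gamma>) d e"
  shows "cobdry f \<gamma> = t"
  using f by (intro A1_unique[OF cobdry_at(1)[OF f \<gamma>] t]) (simp_all add: eq cobdry_at(3)[OF f \<gamma>])

end

section \<open>The coboundary as an alternating form, and the comparison with the contour\<close>

context rep_form begin

lemma scl2_rs:
  assumes g: "g \<in> into S b" and i: "i < 2" and a: "a \<in> carrier (rg S b)"
  shows "rsf S (Dn S 2) g (scl S 2 i b a \<gamma>) = scl S 2 i (dm S g) (rr S g a) (rsf S (Dn S 2) g \<gamma>)"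
  unfolding scl_def rsf_def[of S _ g "ilam _ _ _ _"]
proof (rule ilam_cong)
  fix h ds assume h: "h \<in> into S (dm S g)" and "ds \<in> el (Dn S 2) (dm S h)"
  then obtain d e where ds: "ds = [d, e]" "d \<in> Dset S (dm S h)" "e \<in> Dset S (dm S h)" by auto
  have "i = 0 \<or> i = 1" using i by auto
  then show "ilam S (Dn S 2) b (\<lambda>f ds. \<gamma> f (ds[i := rr S f a \<otimes>\<^bsub>rg S (dm S f)\<^esub> ds ! i])) (cmp S g h) ds =
    rsf S (Dn S 2) g \<gamma> h (ds[i := rr S h (rr S g a) \<otimes>\<^bsub>rg S (dm S h)\<^esub> ds ! i])"
    using g h ds a by (auto simp: rr_cmp One_nat_def)
qed

text \<open>Since a (d e) = (a d) e = d (a e), scaling either variable of \<gamma> has the same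
  effect, namely a scaling of the tangent.\<close>

lemma cobdry_scl:
  assumes f: "f \<in> into S c" and \<gamma>: "\<gamma> \<in> el (An S M G 2) (dm S f)" and i: "i < 2"
    and a: "a \<in> carrier (rg S (dm S f))"
  shows "cobdry f (scl S 2 i (dm S f) a \<gamma>) = scl S 1 0 (dm S f) a (cobdry f \<gamma>)"
proof (rule cobdry_eqI[OF f])
  have b: "dm S f \<in> Ob S" using f by simp
  show "scl S 2 i (dm S f) a \<gamma> \<in> el (An S M G 2) (dm S f)" using G.scl2_An[OF \<gamma> b a i] by simp
  show "scl S 1 0 (dm S f) a (cobdry f \<gamma>) \<in> el (An S M L 1) (dm S f)" using A1_scl[OF cobdry_at(1)[OF f \<gamma>] b a] by simp
  fix g d e assume g: "g \<in> into S (dm S f)" "d \<in> Dset S (dm S g)" "e \<in> Dset S (dm S g)"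
  have bg: "dm S g \<in> Ob S" using g by simp
  interpret R: cring "rg S (dm S g)" by (rule cring_at[OF bg])
  have fg: "cmp S f g \<in> into S c" "dm S (cmp S f g) = dm S g" using f g by simp_all
  have r: "rsf S (Dn S 2) g \<gamma> \<in> el (An S M G 2) (dm S (cmp S f g))"
    using G.rsf_An[OF \<gamma> g(1)] by (simp add: fg)
  let ?a = "rr S g a"
  have a': "?a \<in> carrier (rg S (dm S g))" using g a by simp
  have C: "d \<in> carrier (rg S (dm S g))" "e \<in> carrier (rg S (dm S g))" using g by (simp_all add: Dset_carrier)
  have ad: "?a \<otimes>\<^bsub>rg S (dm S g)\<^esub> d \<in> Dset S (dm S g)" "?a \<otimes>\<^bsub>rg S (dm S g)\<^esub> e \<in> Dset S (dm S g)"
    using bg g a' by simp_all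
  have "scl S 1 0 (dm S f) a (cobdry f \<gamma>) g [d \<otimes>\<^bsub>rg S (dm S g)\<^esub> e] =
      cobdry f \<gamma> g [?a \<otimes>\<^bsub>rg S (dm S g)\<^esub> (d \<otimes>\<^bsub>rg S (dm S g)\<^esub> e)]"
    using g bg C by (simp add: scl_def)
  moreover have "?a \<otimes>\<^bsub>rg S (dm S g)\<^esub> (d \<otimes>\<^bsub>rg S (dm S g)\<^esub> e) = (?a \<otimes>\<^bsub>rg S (dm S g)\<^esub> d) \<otimes>\<^bsub>rg S (dm S g)\<^esub> e"
    "?a \<otimes>\<^bsub>rg S (dm S g)\<^esub> (d \<otimes>\<^bsub>rg S (dm S g)\<^esub> e) = d \<otimes>\<^bsub>rg S (dm S g)\<^esub> (?a \<otimes>\<^bsub>rg S (dm S g)\<^esub> e)"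
    using C a' by (simp_all add: R.m_ac)
  moreover note cobdry_at(3)[OF f \<gamma> g(1) ad(1) g(3)] cobdry_at(3)[OF f \<gamma> g(1,2) ad(2)]
    mrhs_scl[OF fg(1) r, unfolded fg(2), OF g(2,3) a']
  moreover have "i = 0 \<or> i = 1" using i by auto
  ultimately show "scl S 1 0 (dm S f) a (cobdry f \<gamma>) g [d \<otimes>\<^bsub>rg S (dm S g)\<^esub> e] =
      mrhs (cmp S f g) (rsf S (Dn S 2) g (scl S 2 i (dm S f) a \<gamma>)) d e"
    unfolding scl2_rs[OF g(1) i a] fg(2) by metis
qed

text \<open>The exchange inverts the product and swaps d with e. As d e = e d, only the inversion is
  visible on the tangent, and inverting values is evaluating at the negative.\<close>

lemma cobdry_swap:
  assumes f: "f \<in> into S c" and \<gamma>: "\<gamma> \<in> el (An S M G 2) (dm S f)"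
  shows "cobdry f (G.swap (dm S f) \<gamma>) = scl S 1 0 (dm S f) (\<ominus>\<^bsub>rg S (dm S f)\<^esub> \<one>\<^bsub>rg S (dm S f)\<^esub>) (cobdry f \<gamma>)"
proof (rule cobdry_eqI[OF f])
  have b: "dm S f \<in> Ob S" using f by simp
  interpret Rb: cring "rg S (dm S f)" by (rule cring_at[OF b])
  show "G.swap (dm S f) \<gamma> \<in> el (An S M G 2) (dm S f)" using G.swap_An[OF \<gamma> b] by simp
  show "scl S 1 0 (dm S f) (\<ominus>\<^bsub>rg S (dm S f)\<^esub> \<one>\<^bsub>rg S (dm S f)\<^esub>) (cobdry f \<gamma>) \<in> el (An S M L 1) (dm S f)"
    using A1_scl[OF cobdry_at(1)[OF f \<gamma>] b] by simp
  fix g d e assume g: "g \<in> into S (dm S f)" "d \<in> Dset S (dm S g)" "e \<in> Dset S (dm S g)"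
  have bg: "dm S g \<in> Ob S" using g by simp
  interpret R: cring "rg S (dm S g)" by (rule cring_at[OF bg])
  have fg: "cmp S f g \<in> into S c" "dm S (cmp S f g) = dm S g" using f g by simp_all
  have r: "rsf S (Dn S 2) g \<gamma> \<in> el (An S M G 2) (dm S (cmp S f g))"
    using G.rsf_An[OF \<gamma> g(1)] by (simp add: fg)
  have C: "d \<in> carrier (rg S (dm S g))" "e \<in> carrier (rg S (dm S g))" using g by (simp_all add: Dset_carrier)
  have de: "d \<otimes>\<^bsub>rg S (dm S g)\<^esub> e \<in> Dset S (dm S g)" using bg g C by simp
  have "scl S 1 0 (dm S f) (\<ominus>\<^bsub>rg S (dm S f)\<^esub> \<one>\<^bsub>rg S (dm S f)\<^esub>) (cobdry f \<gamma>) g [d \<otimes>\<^bsub>rg S (dm S g)\<^esub> e] =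
      cobdry f \<gamma> g [\<ominus>\<^bsub>rg S (dm S g)\<^esub> (d \<otimes>\<^bsub>rg S (dm S g)\<^esub> e)]"
    using g de C by (simp add: scl_def R.l_minus)
  also have "\<dots> = ginv L (dm S g) (cobdry f \<gamma> g [e \<otimes>\<^bsub>rg S (dm S g)\<^esub> d])"
    using A1_uminus[OF cobdry_at(1)[OF f \<gamma>] g(1) de] C by (simp add: R.m_comm)
  also have "\<dots> = mrhs (cmp S f g) (rsf S (Dn S 2) g (G.swap (dm S f) \<gamma>)) d e"
    using mrhs_swap[OF fg(1) r, unfolded fg(2), OF g(2,3)] unfolding cobdry_at(3)[OF f \<gamma> g(1,3,2)] G.swap_rs[OF g(1)] fg(2)
    by simp
  finally show "scl S 1 0 (dm S f) (\<ominus>\<^bsub>rg S (dm S f)\<^esub> \<one>\<^bsub>rg S (dm S f)\<^esub>) (cobdry f \<gamma>) g [d \<otimes>\<^bsub>rg S (dm S g)\<^esub> e] =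
      mrhs (cmp S f g) (rsf S (Dn S 2) g (G.swap (dm S f) \<gamma>)) d e" .
qed

lemma cobdry_rs:
  assumes f: "f \<in> into S c" and \<gamma>: "\<gamma> \<in> el (An S M G 2) (dm S f)" and g: "g \<in> into S (dm S f)"
  shows "cobdry (cmp S f g) (rsf S (Dn S 2) g \<gamma>) = rsf S (Dn S 1) g (cobdry f \<gamma>)"
proof -
  have fg: "cmp S f g \<in> into S c" "dm S (cmp S f g) = dm S g" using f g by simp_all
  show ?thesis
  proof (rule cobdry_eqI[OF fg(1)], unfold fg(2))
    show "rsf S (Dn S 2) g \<gamma> \<in> el (An S M G 2) (dm S g)" using G.rsf_An[OF \<gamma> g] by simp
    show "rsf S (Dn S 1) g (cobdry f \<gamma>) \<in> el (An S M L 1) (dm S g)" using rsf_An[OF cobdry_at(1)[OF f \<gamma>] g] by simp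
    fix h d e assume h: "h \<in> into S (dm S g)" "d \<in> Dset S (dm S h)" "e \<in> Dset S (dm S h)"
    have "d \<otimes>\<^bsub>rg S (dm S h)\<^esub> e \<in> Dset S (dm S h)" using h by (simp add: Dset_carrier)
    then show "rsf S (Dn S 1) g (cobdry f \<gamma>) h [d \<otimes>\<^bsub>rg S (dm S h)\<^esub> e] =
        mult_rhs S M G L (dm S (cmp S (cmp S f g) h)) (\<rho>1 (cmp S (cmp S f g) h)) (\<omega> (cmp S (cmp S f g) h))
          (rsf S (Dn S 2) h (rsf S (Dn S 2) g \<gamma>)) d e"
      using cobdry_at(3)[OF f \<gamma>, of "cmp S g h" d e] f g h by (simp add: cmp_assoc[OF f g h(1)] rsf_cmp[OF g h(1)])
  qed
qed

lemma cobdry_form: "ilam S (An S M G 2) c cobdry \<in> forms S M G E 2 c"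
proof -
  have "ilam S (An S M G 2) c cobdry \<in> el (expo S (An S M G 2) E) c"
    by (rule ilam_expo[OF G.An_psh]) (simp_all add: cobdry_at cobdry_rs)
  moreover have "cobdry f (ilam S (Dn S 2) (dm S f) (\<lambda>g ds. \<gamma> g (permute_list \<sigma> ds))) =
      scl S 1 0 (dm S f) (if sign \<sigma> = 1 then \<one>\<^bsub>rg S (dm S f)\<^esub> else \<ominus>\<^bsub>rg S (dm S f)\<^esub> \<one>\<^bsub>rg S (dm S f)\<^esub>) (cobdry f \<gamma>)"
    "ilam S (Dn S 2) (dm S f) (\<lambda>g ds. \<gamma> g (permute_list \<sigma> ds)) \<in> el (An S M G 2) (dm S f)"
    if f: "f \<in> into S c" and \<gamma>: "\<gamma> \<in> el (An S M G 2) (dm S f)" and \<sigma>: "\<sigma> permutes {..<2}" for f \<gamma> \<sigma>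
  proof -
    have b: "dm S f \<in> Ob S" using f by simp
    have "{..<2} = {0, 1 :: nat}" by auto
    \<comment> \<open>Alternation has only two cases: the identity, where multiplication by 1 must
      be seen to act trivially, and the transposition, which is \<open>G.swap\<close>.\<close>
    then consider "\<sigma> = id" | "\<sigma> = Transposition.transpose 0 1"
      using \<sigma> permutes_doubleton_iff[of \<sigma> 0 1] by auto
    then have "cobdry f (ilam S (Dn S 2) (dm S f) (\<lambda>g ds. \<gamma> g (permute_list \<sigma> ds))) =
      scl S 1 0 (dm S f) (if sign \<sigma> = 1 then \<one>\<^bsub>rg S (dm S f)\<^esub> else \<ominus>\<^bsub>rg S (dm S f)\<^esub> \<one>\<^bsub>rg S (dm S f)\<^esub>) (cobdry f \<gamma>) \<and>
      ilam S (Dn S 2) (dm S f) (\<lambda>g ds. \<gamma> g (permute_list \<sigma> ds)) \<in> el (An S M G 2) (dm S f)"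
    proof cases
      case 1
      interpret R: cring "rg S (dm S f)" by (rule cring_at[OF b])
      have "ilam S (Dn S 2) (dm S f) (\<lambda>g ds. \<gamma> g (permute_list \<sigma> ds)) = \<gamma>"
        using G.An_expo[OF \<gamma>] by (simp add: 1 expo_eta)
      moreover have "scl S 1 0 (dm S f) \<one>\<^bsub>rg S (dm S f)\<^esub> (cobdry f \<gamma>) = cobdry f \<gamma>"
      proof (rule An_ext[where n = 1 and c = "dm S f"])
        fix g ds assume g: "g \<in> into S (dm S f)" and "ds \<in> el (Dn S 1) (dm S g)"
        then obtain d where ds: "ds = [d]" "d \<in> Dset S (dm S g)" by auto
        interpret Rg: cring "rg S (dm S g)" using g by (intro cring_at) simp
        show "scl S 1 0 (dm S f) \<one>\<^bsub>rg S (dm S f)\<^esub> (cobdry f \<gamma>) g ds = cobdry f \<gamma> g ds"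
          using g ds by (simp add: scl_def Dset_carrier)
      qed (use cobdry_at[OF f \<gamma>] A1_scl[OF cobdry_at(1)[OF f \<gamma>] b] in simp_all)
      ultimately show ?thesis using \<gamma> by (simp add: 1)
    next
      case 2
      have "permute_list \<sigma> [x, y] = [y, x]" for x y :: 'r
        by (simp add: 2 permute_list_def upt_rec One_nat_def)
      then have "ilam S (Dn S 2) (dm S f) (\<lambda>g ds. \<gamma> g (permute_list \<sigma> ds)) = G.swap (dm S f) \<gamma>"
        unfolding G.swap_def by (intro ilam_cong) auto
      moreover have "sign \<sigma> = - 1" by (simp add: 2 sign_swap_id)
      ultimately show ?thesis using cobdry_swap[OF f \<gamma>] G.swap_An[OF \<gamma> b] by simp
    qed
    then show "cobdry f (ilam S (Dn S 2) (dm S f) (\<lambda>g ds. \<gamma> g (permute_list \<sigma> ds))) =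
      scl S 1 0 (dm S f) (if sign \<sigma> = 1 then \<one>\<^bsub>rg S (dm S f)\<^esub> else \<ominus>\<^bsub>rg S (dm S f)\<^esub> \<one>\<^bsub>rg S (dm S f)\<^esub>) (cobdry f \<gamma>)"
      "ilam S (Dn S 2) (dm S f) (\<lambda>g ds. \<gamma> g (permute_list \<sigma> ds)) \<in> el (An S M G 2) (dm S f)" by simp_all
  qed
  moreover have "scl S 2 i (dm S f) a \<gamma> \<in> el (An S M G 2) (dm S f)"
    if "f \<in> into S c" "\<gamma> \<in> el (An S M G 2) (dm S f)" "i < 2" "a \<in> carrier (rg S (dm S f))" for f \<gamma> i a
    using G.scl2_An[OF that(2) _ that(4,3)] that(1) by simp
  ultimately show ?thesis
    unfolding forms_def Let_def A1_simps by (simp add: cobdry_at cobdry_scl)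
qed

text \<open>Evaluates the definite description: \<open>cobdry\<close> was chosen square by square,
  and the competitor \<eta> is compared with it on each square, where the values at products
  decide.\<close>

lemma mult_coboundary_eq: "mult_coboundary S M G L c \<rho>1 \<omega> = ilam S (An S M G 2) c cobdry"
  unfolding mult_coboundary_def
proof (rule the_equality)
  show "ilam S (An S M G 2) c cobdry \<in> forms S M G E 2 c \<and>
     (\<forall>f\<in>into S c. \<forall>\<gamma>\<in>el (An S M G 2) (dm S f). \<forall>d\<in>Dset S (dm S f). \<forall>e\<in>Dset S (dm S f).
        ilam S (An S M G 2) c cobdry f \<gamma> (idt S (dm S f)) [d \<otimes>\<^bsub>rg S (dm S f)\<^esub> e] = mrhs f \<gamma> d e)"
  proof (intro conjI cobdry_form ballI)
    fix f \<gamma> d e assume f: "f \<in> into S c" and \<gamma>: "\<gamma> \<in> el (An S M G 2) (dm S f)"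
      and d: "d \<in> Dset S (dm S f)" "e \<in> Dset S (dm S f)"
    have b: "dm S f \<in> Ob S" using f by simp
    show "ilam S (An S M G 2) c cobdry f \<gamma> (idt S (dm S f)) [d \<otimes>\<^bsub>rg S (dm S f)\<^esub> e] = mrhs f \<gamma> d e"
      using cobdry_at(3)[OF f \<gamma>, of "idt S (dm S f)" d e] f \<gamma> b d rsf_idt[OF G.An_expo[OF \<gamma>] b] by simp
  qed
next
  fix \<eta> assume \<eta>: "\<eta> \<in> forms S M G E 2 c \<and>
     (\<forall>f\<in>into S c. \<forall>\<gamma>\<in>el (An S M G 2) (dm S f). \<forall>d\<in>Dset S (dm S f). \<forall>e\<in>Dset S (dm S f).
        \<eta> f \<gamma> (idt S (dm S f)) [d \<otimes>\<^bsub>rg S (dm S f)\<^esub> e] = mrhs f \<gamma> d e)"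
  have ex: "\<eta> \<in> el (expo S (An S M G 2) E) c" "ilam S (An S M G 2) c cobdry \<in> el (expo S (An S M G 2) E) c"
    using \<eta> cobdry_form by (simp_all add: forms_def)
  show "\<eta> = ilam S (An S M G 2) c cobdry"
  proof (rule expo_ext[OF ex])
    fix f \<gamma> assume f: "f \<in> into S c" and \<gamma>: "\<gamma> \<in> el (An S M G 2) (dm S f)"
    have t: "\<eta> f \<gamma> \<in> el (An S M L 1) (dm S f)" using expo_el[OF ex(1) f \<gamma>] by simp
    have "cobdry f \<gamma> = \<eta> f \<gamma>"
    proof (rule cobdry_eqI[OF f \<gamma> t])
      fix g d e assume g: "g \<in> into S (dm S f)" "d \<in> Dset S (dm S g)" "e \<in> Dset S (dm S g)"
      have fg: "cmp S f g \<in> into S c" "dm S (cmp S f g) = dm S g" using f g by simp_all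
      have bg: "dm S g \<in> Ob S" using g by simp
      have de: "d \<otimes>\<^bsub>rg S (dm S g)\<^esub> e \<in> Dset S (dm S g)" using g by (simp add: Dset_carrier)
      have r: "rsf S (Dn S 2) g \<gamma> \<in> el (An S M G 2) (dm S (cmp S f g))"
        using G.rsf_An[OF \<gamma> g(1)] by (simp add: fg)
      \<comment> \<open>The equation required of \<eta> speaks of its values at the identity arrow
        only. Naturality rewrites the value at g as a value at the identity for the restricted
        square, where the equation applies.\<close>
      have "\<eta> (cmp S f g) (rsf S (Dn S 2) g \<gamma>) = rsf S (Dn S 1) g (\<eta> f \<gamma>)"
        using expo_nat[OF ex(1) f g(1) \<gamma>] by simp
      then have "\<eta> f \<gamma> g [d \<otimes>\<^bsub>rg S (dm S g)\<^esub> e] =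
          \<eta> (cmp S f g) (rsf S (Dn S 2) g \<gamma>) (idt S (dm S g)) [d \<otimes>\<^bsub>rg S (dm S g)\<^esub> e]"
        using g bg de by simp
      also have "\<dots> = mrhs (cmp S f g) (rsf S (Dn S 2) g \<gamma>) d e"
        using bspec[OF bspec[OF bspec[OF bspec[OF conjunct2[OF \<eta>] fg(1)] r], of d], of e] g by (simp add: fg(2))
      finally show "\<eta> f \<gamma> g [d \<otimes>\<^bsub>rg S (dm S g)\<^esub> e] = mrhs (cmp S f g) (rsf S (Dn S 2) g \<gamma>) d e" .
    qed
    then show "\<eta> f \<gamma> = ilam S (An S M G 2) c cobdry f \<gamma>" using f \<gamma> by simp
  qed
qed

text \<open>Coboundary plus bracket is a pointwise product by \<open>A1_vadd\<close>, and the last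
  clause of \<open>cobdry_at\<close> says that this product satisfies the contour equation.
  Uniqueness at products identifies it with the contour derivative.\<close>

lemma contour_eq:
  assumes c: "c \<in> Ob S" and \<gamma>: "\<gamma> \<in> el (An S M G 2) c"
  shows "contour_derivative S M G L c \<rho>1 \<omega> \<gamma> = vadd E c (mult_coboundary S M G L c \<rho>1 \<omega> (idt S c) \<gamma>)
      (bracket S M L c (\<omega> (idt S c) (side2 S G c \<gamma> \<zero>\<^bsub>rg S c\<^esub>)) (\<omega> (idt S c) (side1 S G c \<gamma> \<zero>\<^bsub>rg S c\<^esub>)))"
proof -
  have i: "idt S c \<in> into S c" "dm S (idt S c) = c" using c by simp_all
  have \<gamma>i: "\<gamma> \<in> el (An S M G 2) (dm S (idt S c))" using \<gamma> i by simp
  have s: "G.swap c \<gamma> \<in> el (An S M G 2) (dm S (idt S c))" "bpt S G 2 c (G.swap c \<gamma>) = bpt S G 2 c \<gamma>"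
    using G.swap_An[OF \<gamma> c] i by simp_all
  let ?u = "tside (idt S c) (G.swap c \<gamma>) \<zero>\<^bsub>rg S c\<^esub>" and ?v = "tside (idt S c) \<gamma> \<zero>\<^bsub>rg S c\<^esub>"
  \<comment> \<open>The arguments of the bracket are untransported; at parameter 0 they coincide
    with the transported sides for which the contour relation was proved.\<close>
  have uv: "\<omega> (idt S c) (side2 S G c \<gamma> \<zero>\<^bsub>rg S c\<^esub>) = ?u" "\<omega> (idt S c) (side1 S G c \<gamma> \<zero>\<^bsub>rg S c\<^esub>) = ?v"
    using tside_zero[OF i(1) s(1)] tside_zero[OF i(1) \<gamma>i] c by (simp_all add: G.side_swap)
  have u: "?u \<in> el (An S M L 1) c" "bpt S L 1 c ?u = bpt S G 2 c \<gamma>"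
    using tside_A1[OF i(1) s(1), of "\<zero>\<^bsub>rg S c\<^esub>"] c s(2) by simp_all
  have v: "?v \<in> el (An S M L 1) c" "bpt S L 1 c ?v = bpt S G 2 c \<gamma>"
    using tside_A1[OF i(1) \<gamma>i, of "\<zero>\<^bsub>rg S c\<^esub>"] c by simp_all
  let ?B = "bracket S M L c ?u ?v" and ?K = "cobdry (idt S c) \<gamma>"
  have B: "?B \<in> el (An S M L 1) c" "bpt S L 1 c ?B = bpt S G 2 c \<gamma>"
    using bracket_at(1,2)[OF c u(1) v(1)] u(2) v(2) by simp_all
  have K: "?K \<in> el (An S M L 1) c" "bpt S L 1 c ?K = bpt S G 2 c \<gamma>"
    using cobdry_at(1,2)[OF i(1) \<gamma>i] i by simp_all
  define \<kappa> where "\<kappa> = vadd E c ?K ?B"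
  have \<kappa>_eq: "\<kappa> = ilam S (Dn S 1) c (\<lambda>f ds. mul L (dm S f) (?K f ds) (?B f ds))"
    using A1_vadd[OF K(1) B(1) _ c] K(2) B(2) by (simp add: \<kappa>_def)
  have \<kappa>: "\<kappa> \<in> el (An S M L 1) c"
    using A1_mul[OF K(1) B(1) _ c] K(2) B(2) by (simp add: \<kappa>_eq)
  have \<kappa>d: "\<kappa> f [d \<otimes>\<^bsub>rg S (dm S f)\<^esub> e] = crhs f (rsf S (Dn S 2) f \<gamma>) d e"
    if f: "f \<in> into S c" "d \<in> Dset S (dm S f)" "e \<in> Dset S (dm S f)" for f d e
  proof -
    have "d \<otimes>\<^bsub>rg S (dm S f)\<^esub> e \<in> Dset S (dm S f)" using f by (simp add: Dset_carrier)
    then show ?thesis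
      using cobdry_at(4)[OF i(1) \<gamma>i, of f d e] f i(2) by (simp add: \<kappa>_eq)
  qed
  have "contour_derivative S M G L c \<rho>1 \<omega> \<gamma> = \<kappa>"
    unfolding contour_derivative_def A1_simps
  proof (rule the_equality)
    show "\<kappa> \<in> el (An S M L 1) c \<and> (\<forall>f\<in>into S c. \<forall>d\<in>Dset S (dm S f). \<forall>e\<in>Dset S (dm S f).
        \<kappa> f [d \<otimes>\<^bsub>rg S (dm S f)\<^esub> e] = crhs f (rsf S (Dn S 2) f \<gamma>) d e)"
      using \<kappa> \<kappa>d by simp
    show "t = \<kappa>" if "t \<in> el (An S M L 1) c \<and> (\<forall>f\<in>into S c. \<forall>d\<in>Dset S (dm S f). \<forall>e\<in>Dset S (dm S f).
        t f [d \<otimes>\<^bsub>rg S (dm S f)\<^esub> e] = crhs f (rsf S (Dn S 2) f \<gamma>) d e)" for t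
      using that by (intro A1_unique[OF _ \<kappa> c]) (simp_all add: \<kappa>d)
  qed
  then show ?thesis
    using i \<gamma> by (simp add: \<kappa>_def mult_coboundary_eq uv)
qed

end

theorem theorem18:
  fixes S :: "('o, 'a, 'r) line"
    and M :: "('o, 'a, 'p) psh"
    and G :: "('o, 'a, 'p, 'g) grpd"
    and L :: "('o, 'a, 'p, 'l) grpd"
  assumes "line_object S"
    and "presheaf S M" and "microlinear S M"
    and "groupoid S M G" and "microlinear S G"
    and "group_bundle S M L" and "microlinear S L"
    and "microlinear S (Phi_Lin S M (A1 S M L))"
    and "c \<in> Ob S"
    and "representation S M G (A1 S M L) c \<rho>1 \<rho>2"
    and "\<omega> \<in> forms S M G (A1 S M L) 1 c"
    and "\<gamma> \<in> el (An S M G 2) c"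
  shows "contour_derivative S M G L c \<rho>1 \<omega> \<gamma> =
    vadd (A1 S M L) c
      (mult_coboundary S M G L c \<rho>1 \<omega> (idt S c) \<gamma>)
      (bracket S M L c
        (\<omega> (idt S c) (side2 S G c \<gamma> \<zero>\<^bsub>rg S c\<^esub>))
        (\<omega> (idt S c) (side1 S G c \<gamma> \<zero>\<^bsub>rg S c\<^esub>)))"
proof -
  interpret rep_form S M L G c \<rho>1 \<rho>2 \<omega>
    using assms by unfold_locales (auto simp: line_object_def group_bundle_def)
  show ?thesis by (rule contour_eq) fact+
qed

end
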